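(* Let $G$ be a homogeneous Carnot group with horizontal space $\mathcal H$, and suppose $\{X_n\}_{n=1}^\infty$ are independent $\mathcal N(0,\mathrm{Id}_{\mathcal H})$ random variables on $\mathcal H$. Let $S_n:=\exp(X_1)\cdots\exp(X_n)$ and let $\mu_n$ be the distribution of $D_{\frac1n}S_n$. Then $\{\mu_n\}_{n=1}^\infty$ satisfies a large deviation principle on $G$ with the rate function $$J_{\mathcal N}(x)=\frac12\rho_{cc}^2(e,x),\qquad x\in G,$$ where $\rho_{cc}$ is the Carnot-Carath\'eodory distance on $G$.
   Context: A Carnot group of step $r$ is a connected, simply connected Lie group $G$ (identity $e$) whose Lie algebra is stratified: $\mathfrak{g}=V_1\oplus\cdots\oplus V_r$ with $[V_1,V_{i-1}]=V_i$ for $2\leqslant i\leqslant r$ and $[V_1,V_r]=\{0\}$. It is assumed that $\dim\mathfrak{g}\geqslant 3$ and that the center of $\mathfrak g$ is contained in $V_r$. $\mathcal{H}:=V_1$ is equipped with an inner product $\langle\cdot,\cdot\rangle_{\mathcal H}$ with norm $|\cdot|_{\mathcal H}$; $\exp:\mathfrak g\to G$ is a global diffeomorphism with inverse $\log$. A homogeneous Carnot group is $G$ identified with $(\mathbb R^N,\star)$ via exponential coordinates $x\mapsto\exp(\sum_i x_i\mathcal X_i)$ relative to a basis $\{\mathcal X_i\}_{i=1}^N$ of $\mathfrak g$ adapted to the stratification (consecutive blocks are bases of $V_1,\dots,V_r$), with $\star$ the group law. Dilations: for $a>0$, $\delta_a:\mathfrak g\to\mathfrak g$ is linear with $\delta_a(\mathcal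 X)=a^i\mathcal X$ for $\mathcal X\in V_i$, and $D_a:=\exp\circ\,\delta_a\circ\log:G\to G$. Carnot-Carath\'eodory distance: with $L_xy=xy$ and $\mathcal D_x:=(L_x)_*\mathcal H\subset T_xG$, a path $\gamma:[0,1]\to G$ is horizontal if it is absolutely continuous and $\gamma'(t)\in\mathcal D_{\gamma(t)}$ for a.e. $t$. Its Maurer-Cartan form is $c_\gamma(t):=(L_{\gamma(t)^{-1}})_*\gamma'(t)\in\mathcal H$ and its length is $\ell(\gamma)=\int_0^1|c_\gamma(t)|_{\mathcal H}dt$. Then $\rho_{cc}(x_1,x_2)$ is the infimum of $\ell(\gamma)$ over horizontal $\gamma$ with $\gamma(0)=x_1$, $\gamma(1)=x_2$. Large deviation principle: a rate function on a metric space $\mathcal M$ is a lower semi-continuous function $I:\mathcal M\to[0,\infty]$, not identically $\infty$. Probability measures $\{\mu_n\}$ satisfy the LDP with rate function $I$ if $\liminf_n\frac1n\log\mu_n(O)\geqslant-\inf_{O}I$ for all open $O$ and $\limsup_n\frac1n\log\mu_n(F)\leqslant-\inf_FI$ for all closed $F$. The topology on $G$ is its Lie group topology, which is also that of $\rho_{cc}$. *)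

theory Defs
  imports "HOL-Algebra.Group" "HOL-Probability.Probability"
begin

section \<open>Lie groups with underlying manifold \<open>\<real>\<^sup>N\<close>\<close>

primrec times_differentiable ::
  "nat \<Rightarrow> ('a::euclidean_space \<Rightarrow> 'b::euclidean_space) \<Rightarrow> bool" where
  "times_differentiable 0 f \<longleftrightarrow> continuous_on UNIV f"
| "times_differentiable (Suc k) f \<longleftrightarrow>
     (\<forall>x. f differentiable (at x)) \<and>
     (\<forall>v. times_differentiable k (\<lambda>x. frechet_derivative f (at x) v))"

definition smooth :: "('a::euclidean_space \<Rightarrow> 'b::euclidean_space) \<Rightarrow> bool" where
  "smooth f \<longleftrightarrow> (\<forall>k. times_differentiable k f)"

definition lie_group :: "('a::euclidean_space) monoid \<Rightarrow> bool" where
  "lie_group G \<longleftrightarrow> group G \<and> carrier G = UNIV \<and>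
     smooth (\<lambda>p. fst p \<otimes>\<^bsub>G\<^esub> snd p) \<and> smooth (\<lambda>x. inv\<^bsub>G\<^esub> x)"

text \<open>
  Every tangent space is identified with the ambient vector space \<^typ>\<open>'a\<close>. The Lie algebra is
  the tangent space at the identity; \<open>left_push G x y\<close> is the differential at \<open>y\<close>
  of the left translation by \<open>x\<close>.
\<close>

definition left_push :: "('a::euclidean_space) monoid \<Rightarrow> 'a \<Rightarrow> 'a \<Rightarrow> 'a \<Rightarrow> 'a" where
  "left_push G x y = frechet_derivative (\<lambda>z. x \<otimes>\<^bsub>G\<^esub> z) (at y)"

definition left_invariant_field :: "('a::euclidean_space) monoid \<Rightarrow> 'a \<Rightarrow> 'a \<Rightarrow> 'a" where
  "left_invariant_field G v x = left_push G x \<one>\<^bsub>G\<^esub> v"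

text \<open>
  The value at the identity of the commutator of vector fields, which in coordinates is
  \<open>[X, Y](x) = DY(x) (X x) - DX(x) (Y x)\<close>.
\<close>

definition lie_bracket :: "('a::euclidean_space) monoid \<Rightarrow> 'a \<Rightarrow> 'a \<Rightarrow> 'a" where
  "lie_bracket G u v =
     frechet_derivative (left_invariant_field G v) (at \<one>\<^bsub>G\<^esub>) (left_invariant_field G u \<one>\<^bsub>G\<^esub>) -
     frechet_derivative (left_invariant_field G u) (at \<one>\<^bsub>G\<^esub>) (left_invariant_field G v \<one>\<^bsub>G\<^esub>)"

definition lie_center :: "('a::euclidean_space) monoid \<Rightarrow> 'a set" where
  "lie_center G = {u. \<forall>v. lie_bracket G u v = 0}"

definition one_parameter_subgroup ::
  "('a::euclidean_space) monoid \<Rightarrow> (real \<Rightarrow> 'a) \<Rightarrow> 'a \<Rightarrow> bool" where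
  "one_parameter_subgroup G \<gamma> v \<longleftrightarrow>
     (\<forall>s t. \<gamma> (s + t) = \<gamma> s \<otimes>\<^bsub>G\<^esub> \<gamma> t) \<and> (\<gamma> has_vector_derivative v) (at 0)"

definition lie_exp :: "('a::euclidean_space) monoid \<Rightarrow> 'a \<Rightarrow> 'a" where
  "lie_exp G v = (THE g. \<exists>\<gamma>. one_parameter_subgroup G \<gamma> v \<and> g = \<gamma> 1)"

definition lie_log :: "('a::euclidean_space) monoid \<Rightarrow> 'a \<Rightarrow> 'a" where
  "lie_log G = inv_into UNIV (lie_exp G)"


section \<open>Homogeneous Carnot groups\<close>

definition stratification ::
  "('a::euclidean_space) monoid \<Rightarrow> (nat \<Rightarrow> 'a set) \<Rightarrow> nat \<Rightarrow> bool" where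
  "stratification G V r \<longleftrightarrow> 1 \<le> r \<and>
     (\<forall>i\<in>{1..r}. subspace (V i)) \<and>
     (\<forall>x. \<exists>!v. (\<forall>i\<in>{1..r}. v i \<in> V i) \<and> (\<forall>i. i \<notin> {1..r} \<longrightarrow> v i = 0) \<and> x = (\<Sum>i=1..r. v i)) \<and>
     (\<forall>i\<in>{2..r}. span {lie_bracket G u v | u v. u \<in> V 1 \<and> v \<in> V (i - 1)} = V i) \<and>
     (\<forall>u\<in>V 1. \<forall>v\<in>V r. lie_bracket G u v = 0)"

text \<open>
  The group is \<open>\<real>\<^sup>N\<close> itself, in exponential coordinates: \<open>exp\<close> sends \<open>v\<close> to \<open>v\<close>, i.e. the
  one-parameter subgroup with initial velocity \<open>v\<close> is \<open>t \<mapsto> t v\<close>. In particular the identity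
  is \<open>0\<close>. The basis vectors \<open>\<X>\<^sub>i\<close> of the Lie algebra are the vectors of the standard basis
  \<^const>\<open>Basis\<close>, which is adapted to the stratification: those lying in \<open>V i\<close> span it.
\<close>

definition homogeneous_carnot_group ::
  "(real ^ 'n::finite) monoid \<Rightarrow> (nat \<Rightarrow> (real ^ 'n) set) \<Rightarrow> nat \<Rightarrow> bool" where
  "homogeneous_carnot_group G V r \<longleftrightarrow>
     lie_group G \<and>
     (\<forall>v. one_parameter_subgroup G (\<lambda>t. t *\<^sub>R v) v) \<and>
     stratification G V r \<and>
     (\<forall>i\<in>{1..r}. span (Basis \<inter> V i) = V i) \<and>
     3 \<le> CARD('n) \<and>
     lie_center G \<subseteq> V r"

definition algebra_dilation ::
  "(nat \<Rightarrow> ('a::euclidean_space) set) \<Rightarrow> nat \<Rightarrow> real \<Rightarrow> 'a \<Rightarrow> 'a" where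
  "algebra_dilation V r a =
     (THE f. linear f \<and> (\<forall>i\<in>{1..r}. \<forall>x\<in>V i. f x = (a ^ i) *\<^sub>R x))"

definition group_dilation ::
  "('a::euclidean_space) monoid \<Rightarrow> (nat \<Rightarrow> 'a set) \<Rightarrow> nat \<Rightarrow> real \<Rightarrow> 'a \<Rightarrow> 'a" where
  "group_dilation G V r a = lie_exp G \<circ> algebra_dilation V r a \<circ> lie_log G"


section \<open>The Carnot-Caratheodory distance\<close>

text \<open>Only the values of \<open>ip\<close> on \<open>H \<times> H\<close> matter.\<close>

definition inner_product_on :: "('a::euclidean_space) set \<Rightarrow> ('a \<Rightarrow> 'a \<Rightarrow> real) \<Rightarrow> bool" where
  "inner_product_on H ip \<longleftrightarrow>
     (\<forall>x\<in>H. \<forall>y\<in>H. ip x y = ip y x) \<and>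
     (\<forall>x\<in>H. \<forall>y\<in>H. \<forall>z\<in>H. ip (x + y) z = ip x z + ip y z) \<and>
     (\<forall>x\<in>H. \<forall>y\<in>H. \<forall>c. ip (c *\<^sub>R x) y = c * ip x y) \<and>
     (\<forall>x\<in>H. x \<noteq> 0 \<longrightarrow> 0 < ip x x)"

definition absolutely_continuous_path :: "(real \<Rightarrow> 'a::euclidean_space) \<Rightarrow> bool" where
  "absolutely_continuous_path \<gamma> \<longleftrightarrow>
     (\<forall>\<epsilon>>0. \<exists>\<delta>>0. \<forall>d. d division_of \<Union>d \<longrightarrow> \<Union>d \<subseteq> {0..1} \<longrightarrow>
        (\<Sum>k\<in>d. Sup k - Inf k) < \<delta> \<longrightarrow> (\<Sum>k\<in>d. norm (\<gamma> (Sup k) - \<gamma> (Inf k))) < \<epsilon>)"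

definition horizontal_path ::
  "('a::euclidean_space) monoid \<Rightarrow> 'a set \<Rightarrow> (real \<Rightarrow> 'a) \<Rightarrow> bool" where
  "horizontal_path G H \<gamma> \<longleftrightarrow> absolutely_continuous_path \<gamma> \<and>
     (AE t in lebesgue_on {0..1}. \<exists>w\<in>left_push G (\<gamma> t) \<one>\<^bsub>G\<^esub> ` H.
        (\<gamma> has_vector_derivative w) (at t within {0..1}))"

definition maurer_cartan ::
  "('a::euclidean_space) monoid \<Rightarrow> (real \<Rightarrow> 'a) \<Rightarrow> real \<Rightarrow> 'a" where
  "maurer_cartan G \<gamma> t =
     left_push G (inv\<^bsub>G\<^esub> (\<gamma> t)) (\<gamma> t) (vector_derivative \<gamma> (at t within {0..1}))"

definition horizontal_length ::
  "('a::euclidean_space) monoid \<Rightarrow> ('a \<Rightarrow> 'a \<Rightarrow> real) \<Rightarrow> (real \<Rightarrow> 'a) \<Rightarrow> ennreal" where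
  "horizontal_length G ip \<gamma> =
     (\<integral>\<^sup>+ t. ennreal (sqrt (ip (maurer_cartan G \<gamma> t) (maurer_cartan G \<gamma> t)))
        \<partial>lebesgue_on {0..1})"

definition cc_distance ::
  "('a::euclidean_space) monoid \<Rightarrow> 'a set \<Rightarrow> ('a \<Rightarrow> 'a \<Rightarrow> real) \<Rightarrow> 'a \<Rightarrow> 'a \<Rightarrow> ennreal" where
  "cc_distance G H ip x y =
     (INF \<gamma>\<in>{\<gamma>. horizontal_path G H \<gamma> \<and> \<gamma> 0 = x \<and> \<gamma> 1 = y}. horizontal_length G ip \<gamma>)"


section \<open>Standard normal random variables and random walks\<close>

definition orthonormal_basis ::
  "('a::euclidean_space) set \<Rightarrow> ('a \<Rightarrow> 'a \<Rightarrow> real) \<Rightarrow> 'a set \<Rightarrow> bool" where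
  "orthonormal_basis H ip B \<longleftrightarrow>
     B \<subseteq> H \<and> span B = H \<and> (\<forall>b\<in>B. \<forall>c\<in>B. ip b c = (if b = c then 1 else 0))"

text \<open>
  \<open>N(0, Id)\<close> on the Euclidean space \<open>(H, ip)\<close>: the coordinates with respect to any orthonormal
  basis are independent standard normal real random variables.
\<close>

definition standard_normal_on ::
  "'w measure \<Rightarrow> ('a::euclidean_space) set \<Rightarrow> ('a \<Rightarrow> 'a \<Rightarrow> real) \<Rightarrow> ('w \<Rightarrow> 'a) \<Rightarrow> bool" where
  "standard_normal_on M H ip X \<longleftrightarrow>
     X \<in> borel_measurable M \<and> (\<forall>\<omega>\<in>space M. X \<omega> \<in> H) \<and>
     (\<forall>B. orthonormal_basis H ip B \<longrightarrow>
        prob_space.indep_vars M (\<lambda>_. borel) (\<lambda>b \<omega>. ip (X \<omega>) b) B \<and>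
        (\<forall>b\<in>B. distributed M lborel (\<lambda>\<omega>. ip (X \<omega>) b) std_normal_density))"

primrec partial_product :: "'a monoid \<Rightarrow> (nat \<Rightarrow> 'a) \<Rightarrow> nat \<Rightarrow> 'a" where
  "partial_product G g 0 = \<one>\<^bsub>G\<^esub>"
| "partial_product G g (Suc n) = partial_product G g n \<otimes>\<^bsub>G\<^esub> g (Suc n)"


section \<open>Large deviation principles\<close>

definition rate_function :: "('a::metric_space \<Rightarrow> ennreal) \<Rightarrow> bool" where
  "rate_function I \<longleftrightarrow>
     (\<forall>x c. c < I x \<longrightarrow> (\<forall>\<^sub>F y in nhds x. c < I y)) \<and> (\<exists>x. I x \<noteq> \<infinity>)"

text \<open>The convention \<open>log 0 = -\<infinity>\<close> is essential here, whereas \<open>ln 0 = 0\<close> in HOL.\<close>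

definition ext_ln :: "real \<Rightarrow> ereal" where
  "ext_ln p = (if p = 0 then -\<infinity> else ereal (ln p))"

text \<open>The sequence starts at \<open>n = 1\<close>; \<open>\<mu> 0\<close> is irrelevant.\<close>

definition large_deviation_principle ::
  "(nat \<Rightarrow> ('a::metric_space) measure) \<Rightarrow> ('a \<Rightarrow> ennreal) \<Rightarrow> bool" where
  "large_deviation_principle \<mu> I \<longleftrightarrow>
     (\<forall>n\<ge>1. prob_space (\<mu> n) \<and> sets (\<mu> n) = sets borel) \<and>
     rate_function I \<and>
     (\<forall>U. open U \<longrightarrow>
        liminf (\<lambda>n. ereal (1 / real n) * ext_ln (measure (\<mu> n) U)) \<ge> - enn2ereal (INF x\<in>U. I x)) \<and>
     (\<forall>F. closed F \<longrightarrow>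
        limsup (\<lambda>n. ereal (1 / real n) * ext_ln (measure (\<mu> n) F)) \<le> - enn2ereal (INF x\<in>F. I x))"

end

theory Submission
  imports Defs
begin

text \<open>
  In exponential coordinates a linear map which preserves the Lie bracket is a group homomorphism, so
  dilations are automorphisms and \<open>D\<^bsub>1/n\<^esub> S\<^sub>n\<close> is the product of the \<open>X\<^sub>i / n\<close>. The distance
  \<open>\<rho>(e, x)\<close> is the infimum of \<open>\<Sum>|w\<^sub>j|\<close> over all ways of writing \<open>x\<close> as a product of horizontal
  vectors \<open>w\<^sub>j\<close>: products are endpoints of piecewise smooth horizontal paths, a horizontal path is
  approximated by products of integrals of its Maurer-Cartan form, and the approximation error is absorbed
  because small elements are products of small total length (Chow, via openness of the endpoint map and
  dilations). Cutting the time interval into \<open>k\<close> blocks, on the event \<open>\<Sum>|X\<^sub>i|\<^sup>2 \<le> n R\<^sup>2\<close> the walk is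
  within \<open>O(1 / sqrt k)\<close> of the product of its \<open>k\<close> block averages, deterministically. The block averages
  are independent Gaussians, so an exponential Chebyshev bound for their energy gives the upper bound,
  and a lower bound for the Gaussian density near the increments of an almost optimal product with
  factors of equal length gives the lower bound.
\<close>

section \<open>Lie groups in exponential coordinates\<close>

text \<open>Identities along one-parameter subgroups are proved by exhibiting a curve that ought to
  be constant and computing its derivative only at 0, after a shift by the group law. This plays the
  part of uniqueness for differential equations. The obstacle is that Gaussian steps are unbounded.
  The energy event repairs this: by Cauchy-Schwarz, n/k of the steps X_i/n have total length at most
  R/sqrt k; a product of horizontal vectors differs from their sum by at most a constant times the
  squared length; and k such squares, of total length at most R, add up to at most R^2/sqrt k. Off
  the event the probability is at most exp(-nK), with K as large as desired; on it the walk stays in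
  a fixed ball, so arbitrary closed sets are handled directly. The number k of blocks is fixed
  before n grows. Hence the constant factor that every Gaussian coordinate of a block contributes to
  either bound leaves the exponential rate unchanged, and the Chebyshev parameter may be taken close
  to 1. Exponents and lengths are always compared with strict gaps; these gaps pay for the short
  correction products that accessibility provides.\<close>

lemma smooth_differentiable: "smooth f \<Longrightarrow> f differentiable (at x)"
  unfolding smooth_def by (metis times_differentiable.simps(2))

lemma smooth_has_derivative: "smooth f \<Longrightarrow> (f has_derivative frechet_derivative f (at x)) (at x)"
  using smooth_differentiable frechet_derivative_works by blast

lemma smooth_frechet_derivative: "smooth f \<Longrightarrow> smooth (\<lambda>x. frechet_derivative f (at x) v)"
  unfolding smooth_def by (metis times_differentiable.simps(2))

lemma smooth_continuous: "smooth f \<Longrightarrow> continuous_on S f"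
  unfolding smooth_def by (metis continuous_on_subset subset_UNIV times_differentiable.simps(1))

text \<open>Used to bound the operator norm of a derivative by its values on a basis, because
  \<open>smooth\<close> gives continuity of \<open>frechet_derivative f (at x) v\<close> in
  \<open>x\<close> for each fixed \<open>v\<close>.\<close>

lemma norm_linear_le_sum_Basis:
  fixes f :: "'a::euclidean_space \<Rightarrow> 'b::real_normed_vector"
  assumes "linear f"
  shows "norm (f h) \<le> (\<Sum>b\<in>Basis. norm (f b)) * norm h"
proof -
  have "f h = (\<Sum>b\<in>Basis. (h \<bullet> b) *\<^sub>R f b)"
    using assms by (metis (no_types, lifting) euclidean_representation linear_scale linear_sum sum.cong)
  then have "norm (f h) \<le> (\<Sum>b\<in>Basis. \<bar>h \<bullet> b\<bar> * norm (f b))"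
    by (metis (no_types, lifting) norm_scaleR norm_sum sum.cong)
  also have "\<dots> \<le> (\<Sum>b\<in>Basis. norm h * norm (f b))"
    by (intro sum_mono mult_right_mono) (auto simp: Basis_le_norm)
  finally show ?thesis by (simp add: sum_distrib_left mult.commute sum_distrib_right)
qed

lemma smooth_lipschitz_on_cball:
  fixes f :: "'a::euclidean_space \<Rightarrow> 'b::euclidean_space"
  assumes "smooth f"
  shows "\<exists>C\<ge>0. \<forall>x\<in>cball 0 R. \<forall>y\<in>cball 0 R. norm (f x - f y) \<le> C * norm (x - y)"
proof -
  let ?f' = "\<lambda>x. frechet_derivative f (at x)"
  have "continuous_on (cball 0 R) (\<lambda>x. \<Sum>b\<in>Basis. norm (?f' x b))"
    by (intro continuous_intros smooth_continuous smooth_frechet_derivative assms)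
  then have "bounded ((\<lambda>x. \<Sum>b\<in>Basis. norm (?f' x b)) ` cball 0 R)"
    by (intro compact_imp_bounded compact_continuous_image) auto
  then obtain C where C: "\<forall>x\<in>cball 0 R. norm (\<Sum>b\<in>Basis. norm (?f' x b)) \<le> C"
    unfolding bounded_iff by auto
  have lin: "linear (?f' x)" for x
    using smooth_has_derivative[OF assms] has_derivative_linear by blast
  have on: "onorm (?f' x) \<le> max C 0" if "x \<in> cball 0 R" for x
  proof (rule onorm_le)
    fix h
    have "norm (?f' x h) \<le> (\<Sum>b\<in>Basis. norm (?f' x b)) * norm h"
      by (rule norm_linear_le_sum_Basis[OF lin])
    also have "\<dots> \<le> max C 0 * norm h"
      using C that by (intro mult_right_mono) force+
    finally show "norm (?f' x h) \<le> max C 0 * norm h" .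
  qed
  have "norm (f x - f y) \<le> max C 0 * norm (x - y)" if "x \<in> cball 0 R" "y \<in> cball 0 R" for x y
    by (rule differentiable_bound[where S="cball 0 R" and f'="?f'"])
       (use that on in \<open>auto intro: has_derivative_at_withinI smooth_has_derivative[OF assms]\<close>)
  then show ?thesis by (intro exI[of _ "max C 0"]) auto
qed

section \<open>One-parameter subgroups and the exponential map\<close>

locale exp_group =
  fixes G :: "'a::euclidean_space monoid" (structure)
  assumes lie_group: "lie_group G"
    and exp_coordinates: "\<And>v. one_parameter_subgroup G (\<lambda>t. t *\<^sub>R v) v"
begin

lemma carrier_UNIV [simp]: "x \<in> carrier G"
  using lie_group by (simp add: lie_group_def)

sublocale group G
  using lie_group by (simp add: lie_group_def)

lemma scaleR_add_mult: "(s + t) *\<^sub>R v = (s *\<^sub>R v) \<otimes> (t *\<^sub>R v)"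
  using exp_coordinates[of v] by (simp add: one_parameter_subgroup_def)

lemma one_eq_0 [simp]: "\<one> = 0"
proof -
  have "0 = 0 \<otimes> (0::'a)" using scaleR_add_mult[of 0 0 0] by simp
  then show ?thesis using l_cancel_one[of 0 0] by simp
qed

lemma zero_mult [simp]: "0 \<otimes> x = x" and mult_zero [simp]: "x \<otimes> 0 = x"
  using l_one[of x] r_one[of x] by simp_all

lemma mult_uminus [simp]: "x \<otimes> (- x) = 0" and uminus_mult [simp]: "(- x) \<otimes> x = 0"
  using scaleR_add_mult[of 1 "-1" x] scaleR_add_mult[of "-1" 1 x] by auto

lemma inv_eq_uminus [simp]: "inv x = - x"
  using inv_equality[of "-x" x] by simp

lemma mult_assoc: "(x \<otimes> y) \<otimes> z = x \<otimes> (y \<otimes> z)"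
  using m_assoc[of x y z] by simp

lemma mult_uminus_cancel [simp]: "x \<otimes> (- x \<otimes> y) = y" "- x \<otimes> (x \<otimes> y) = y"
  by (simp_all flip: mult_assoc)

lemma uminus_mult_rev: "- (x \<otimes> y) = (- y) \<otimes> (- x)"
  using inv_mult_group[of x y] by simp

text \<open>Powers of a point lie on the line through it, so \<open>\<gamma> 1\<close> equals
  \<open>n\<close> times \<open>\<gamma> (1 / n)\<close> for every \<open>n\<close>, and this tends
  to the initial velocity. Uniqueness of one-parameter subgroups, hence the value of
  \<open>lie_exp\<close>, follows.\<close>

lemma one_parameter_subgroup_at_1:
  assumes "one_parameter_subgroup G \<gamma> v"
  shows "\<gamma> 1 = v"
proof -
  have add: "\<gamma> (s + t) = \<gamma> s \<otimes> \<gamma> t" for s t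
    using assms by (simp add: one_parameter_subgroup_def)
  have der: "(\<gamma> has_vector_derivative v) (at 0)"
    using assms by (simp add: one_parameter_subgroup_def)
  have 0: "\<gamma> 0 = 0"
    using add[of 0 0] l_cancel_one[of "\<gamma> 0" "\<gamma> 0"] by simp
  have mult: "\<gamma> (real n * t) = real n *\<^sub>R \<gamma> t" for n t
  proof (induction n)
    case (Suc n)
    have "\<gamma> (real (Suc n) * t) = \<gamma> (real n * t) \<otimes> \<gamma> t"
      by (simp add: add[symmetric] algebra_simps)
    also have "\<dots> = real (Suc n) *\<^sub>R \<gamma> t"
      using scaleR_add_mult[of "real n" 1 "\<gamma> t"] Suc by (simp add: add.commute)
    finally show ?case .
  qed (simp add: 0)
  have "((\<lambda>h. norm ((\<gamma> h - \<gamma> 0) - (h - 0) *\<^sub>R v) / norm (h - 0)) \<longlongrightarrow> 0) (at 0)"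
    using der unfolding has_vector_derivative_def has_derivative_iff_norm by simp
  moreover have "filterlim (\<lambda>n. inverse (real (Suc n))) (at 0) sequentially"
    unfolding filterlim_at using LIMSEQ_inverse_real_of_nat by auto
  ultimately have "(\<lambda>n. norm ((\<gamma> (inverse (real (Suc n))) - \<gamma> 0) - (inverse (real (Suc n)) - 0) *\<^sub>R v)
      / norm (inverse (real (Suc n)) - 0)) \<longlonglongrightarrow> 0"
    by (rule filterlim_compose)
  moreover have "norm ((\<gamma> (inverse (real (Suc n))) - \<gamma> 0) - (inverse (real (Suc n)) - 0) *\<^sub>R v)
      / norm (inverse (real (Suc n)) - 0) = norm (\<gamma> 1 - v)" for n
  proof -
    let ?k = "real (Suc n)"
    have "\<gamma> 1 = ?k *\<^sub>R \<gamma> (inverse ?k)"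
      using mult[of "Suc n" "inverse ?k"] by simp
    then have "\<gamma> 1 - v = ?k *\<^sub>R (\<gamma> (inverse ?k) - inverse ?k *\<^sub>R v)"
      by (simp add: scaleR_right_diff_distrib)
    then have "norm (\<gamma> 1 - v) = ?k * norm (\<gamma> (inverse ?k) - inverse ?k *\<^sub>R v)"
      by (metis norm_scaleR abs_of_nat)
    then show ?thesis using 0 by (simp add: divide_inverse mult.commute)
  qed
  ultimately have "(\<lambda>n::nat. norm (\<gamma> 1 - v)) \<longlonglongrightarrow> 0" by (simp only:)
  then show ?thesis by (simp add: LIMSEQ_const_iff)
qed

lemma lie_exp_eq [simp]: "lie_exp G = id"
proof
  fix v
  have "(THE g. \<exists>\<gamma>. one_parameter_subgroup G \<gamma> v \<and> g = \<gamma> 1) = v"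
    using one_parameter_subgroup_at_1 exp_coordinates[of v]
    by (intro the_equality) (auto intro!: exI[of _ "\<lambda>t. t *\<^sub>R v"])
  then show "lie_exp G v = id v" by (simp add: lie_exp_def)
qed

lemma lie_log_eq [simp]: "lie_log G = id"
  by (simp add: lie_log_def inv_id[unfolded id_def] id_def)

section \<open>The differential of the multiplication\<close>

definition dm :: "'a \<times> 'a \<Rightarrow> 'a \<times> 'a \<Rightarrow> 'a" where
  "dm p = frechet_derivative (\<lambda>p. fst p \<otimes> snd p) (at p)"

lemma smooth_mult: "smooth (\<lambda>p. fst p \<otimes> snd p)"
  using lie_group by (simp add: lie_group_def)

lemma smooth_dm: "smooth (\<lambda>p. dm p h)"
  unfolding dm_def by (rule smooth_frechet_derivative[OF smooth_mult])

lemma has_derivative_dm: "((\<lambda>p. fst p \<otimes> snd p) has_derivative dm p) (at p)"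
  unfolding dm_def by (rule smooth_has_derivative[OF smooth_mult])

lemma linear_dm: "linear (dm p)"
  using has_derivative_dm has_derivative_linear by blast

lemma has_derivative_mult [derivative_intros]:
  assumes "(u has_derivative u') (at t within S)" "(w has_derivative w') (at t within S)"
  shows "((\<lambda>t. u t \<otimes> w t) has_derivative (\<lambda>h. dm (u t, w t) (u' h, w' h))) (at t within S)"
  using has_derivative_compose[OF has_derivative_Pair[OF assms] has_derivative_dm] by simp

lemma has_vector_derivative_mult:
  assumes "(u has_vector_derivative u') (at t within S)" "(w has_vector_derivative w') (at t within S)"
  shows "((\<lambda>t. u t \<otimes> w t) has_vector_derivative dm (u t, w t) (u', w')) (at t within S)"
proof -
  have "dm p (h *\<^sub>R u', h *\<^sub>R w') = h *\<^sub>R dm p (u', w')" for p h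
    using linear_scale[OF linear_dm, of p h "(u', w')"] by simp
  with has_derivative_mult[OF assms[unfolded has_vector_derivative_def]]
  show ?thesis by (simp add: has_vector_derivative_def)
qed

lemma continuous_on_mult [continuous_intros]:
  assumes "continuous_on S u" "continuous_on S w"
  shows "continuous_on S (\<lambda>t. u t \<otimes> w t)"
  using continuous_on_compose2[OF smooth_continuous[OF smooth_mult, of UNIV]
      continuous_on_Pair[OF assms]] by simp

lemma continuous_on_dm [continuous_intros]:
  assumes "continuous_on S u" "continuous_on S a" 
  shows "continuous_on S (\<lambda>t. dm (u t) (a t))"
proof -
  have *: "dm p h = (\<Sum>b\<in>Basis. (h \<bullet> b) *\<^sub>R dm p b)" for p h
    using linear_dm[of p] by (metis (no_types, lifting) euclidean_representation linear_scale linear_sum sum.cong)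
  have "continuous_on S (\<lambda>t. dm (u t) b)" for b
    using continuous_on_compose2[OF smooth_continuous[OF smooth_dm, of UNIV] assms(1)] by simp
  then have "continuous_on S (\<lambda>t. \<Sum>b\<in>Basis. (a t \<bullet> b) *\<^sub>R dm (u t) b)"
    by (intro continuous_intros assms(2))
  then show ?thesis by (rule continuous_on_eq) (rule *[symmetric])
qed

lemma dm_add: "dm p (a + a', b + b') = dm p (a, b) + dm p (a', b')"
  using linear_add[OF linear_dm, of p "(a, b)" "(a', b')"] by simp

lemma dm_split: "dm p (a, b) = dm p (a, 0) + dm p (0, b)"
  using dm_add[of p a 0 0 b] by simp

lemma dm_scaleR: "dm p (c *\<^sub>R a, c *\<^sub>R b) = c *\<^sub>R dm p (a, b)"
  using linear_scale[OF linear_dm, of p c "(a, b)"] by simp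

lemma dm_snd_0: "dm (x, 0) (u, 0) = u"
proof -
  have "((\<lambda>z. z \<otimes> 0) has_derivative (\<lambda>h. dm (x, 0) (h, 0))) (at x)"
    using has_derivative_mult[of "\<lambda>z. z" "\<lambda>h. h" x UNIV "\<lambda>z. 0" "\<lambda>h. 0"] by simp
  then have "((\<lambda>z. z) has_derivative (\<lambda>h. dm (x, 0) (h, 0))) (at x)" by simp
  from has_derivative_unique[OF this has_derivative_ident] show ?thesis by metis
qed

lemma dm_fst_0: "dm (0, y) (0, v) = v"
proof -
  have "((\<lambda>z. 0 \<otimes> z) has_derivative (\<lambda>h. dm (0, y) (0, h))) (at y)"
    using has_derivative_mult[of "\<lambda>z. 0" "\<lambda>h. 0" y UNIV "\<lambda>z. z" "\<lambda>h. h"] by simp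
  then have "((\<lambda>z. z) has_derivative (\<lambda>h. dm (0, y) (0, h))) (at y)" by simp
  from has_derivative_unique[OF this has_derivative_ident] show ?thesis by metis
qed

lemma left_push_eq: "left_push G x y v = dm (x, y) (0, v)"
proof -
  have "((\<lambda>z. x \<otimes> z) has_derivative (\<lambda>h. dm (x, y) (0, h))) (at y)"
    using has_derivative_mult[of "\<lambda>z. x" "\<lambda>h. 0" y UNIV "\<lambda>z. z" "\<lambda>h. h"] by simp
  from frechet_derivative_at[OF this] show ?thesis unfolding left_push_def by metis
qed

text \<open>Differentiated associativity. At \<open>z = 0\<close> it says that the fields
  \<open>dm (x, 0) (0, v)\<close> are invariant under left translations.\<close>

lemma dm_chain: "dm (x, y \<otimes> z) (0, dm (y, z) (0, v)) = dm (x \<otimes> y, z) (0, v)"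
proof -
  have 1: "((\<lambda>z. x \<otimes> (y \<otimes> z)) has_derivative (\<lambda>h. dm (x, y \<otimes> z) (0, dm (y, z) (0, h)))) (at z)"
    by (rule derivative_eq_intros refl)+
  have 2: "((\<lambda>z. (x \<otimes> y) \<otimes> z) has_derivative (\<lambda>h. dm (x \<otimes> y, z) (0, h))) (at z)"
    by (rule derivative_eq_intros refl)+
  show ?thesis
    using fun_cong[OF has_derivative_unique[OF 1 2[unfolded mult_assoc]], of v] .
qed

lemma dm_inverse: "dm (x, 0) (0, dm (- x, x) (0, v)) = v" "dm (- x, x) (0, dm (x, 0) (0, v)) = v"
  using dm_chain[of x "-x" x v] dm_chain[of "-x" x 0 v] by (simp_all add: dm_fst_0)

text \<open>The derivative at the identity, in direction \<open>u\<close>, of the left-invariant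
  field of \<open>v\<close>: a mixed second derivative of the multiplication. It turns out to be
  half the Lie bracket and replaces the bracket from here on.\<close>

definition bil :: "'a \<Rightarrow> 'a \<Rightarrow> 'a" where
  "bil u v = frechet_derivative (\<lambda>p. dm p (0, v)) (at (0, 0)) (u, 0)"

lemma has_derivative_dm_snd:
  "((\<lambda>p. dm p (0, v)) has_derivative frechet_derivative (\<lambda>p. dm p (0, v)) (at p)) (at p)"
  by (rule smooth_has_derivative[OF smooth_dm])

lemma bil_eqI:
  assumes "((\<lambda>p. dm p (0, v)) has_derivative f) (at (0, 0))"
  shows "bil u v = f (u, 0)"
  unfolding bil_def using frechet_derivative_at[OF assms] by simp

lemma bil_add_left: "bil (u + u') v = bil u v + bil u' v"
  and bil_scaleR_left: "bil (c *\<^sub>R u) v = c *\<^sub>R bil u v"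
proof -
  have lin: "linear (frechet_derivative (\<lambda>p. dm p (0, v)) (at (0, 0)))"
    using has_derivative_dm_snd has_derivative_linear by blast
  show "bil (u + u') v = bil u v + bil u' v"
    unfolding bil_def using linear_add[OF lin, of "(u,0)" "(u',0)"] by simp
  show "bil (c *\<^sub>R u) v = c *\<^sub>R bil u v"
    unfolding bil_def using linear_scale[OF lin, of c "(u,0)"] by simp
qed

lemma bil_add_right: "bil u (v + v') = bil u v + bil u v'"
proof -
  have "((\<lambda>p. dm p (0, v) + dm p (0, v')) has_derivative
      (\<lambda>h. frechet_derivative (\<lambda>p. dm p (0, v)) (at (0, 0)) h +
           frechet_derivative (\<lambda>p. dm p (0, v')) (at (0, 0)) h)) (at (0, 0))"
    by (intro has_derivative_add has_derivative_dm_snd)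
  moreover have "(\<lambda>p. dm p (0, v) + dm p (0, v')) = (\<lambda>p. dm p (0, v + v'))"
    using dm_add[of _ 0 0 v v'] by auto
  ultimately show ?thesis using bil_eqI[of "v + v'"] by (simp add: bil_def)
qed

lemma bil_scaleR_right: "bil u (c *\<^sub>R v) = c *\<^sub>R bil u v"
proof -
  have "((\<lambda>p. c *\<^sub>R dm p (0, v)) has_derivative
      (\<lambda>h. c *\<^sub>R frechet_derivative (\<lambda>p. dm p (0, v)) (at (0, 0)) h)) (at (0, 0))"
    by (intro has_derivative_scaleR_right has_derivative_dm_snd)
  moreover have "(\<lambda>p. c *\<^sub>R dm p (0, v)) = (\<lambda>p. dm p (0, c *\<^sub>R v))"
    using dm_scaleR[of _ c 0 v] by auto
  ultimately show ?thesis using bil_eqI[of "c *\<^sub>R v"] by (simp add: bil_def)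
qed

lemma bilinear_bil: "bilinear bil"
  unfolding bilinear_def
  by (auto intro!: linearI simp: bil_add_left bil_add_right bil_scaleR_left bil_scaleR_right)

lemma lie_bracket_eq_bil: "lie_bracket G u v = bil u v - bil v u"
proof -
  have field: "left_invariant_field G v = (\<lambda>x. dm (x, 0) (0, v))" for v
    by (auto simp: left_invariant_field_def left_push_eq)
  have "((\<lambda>x. dm (x, 0) (0, v)) has_derivative (\<lambda>h. bil h v)) (at 0)" for v
    using has_derivative_compose[OF has_derivative_Pair[OF has_derivative_ident has_derivative_const],
        where g="\<lambda>p. dm p (0, v)", OF has_derivative_dm_snd, of 0 0 UNIV]
    by (simp add: bil_def)
  then have "frechet_derivative (left_invariant_field G v) (at 0) u = bil u v" for u v
    unfolding field using frechet_derivative_at by metis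
  then show ?thesis by (simp add: lie_bracket_def field dm_fst_0)
qed

end

lemma has_vector_derivative_shift:
  assumes "((\<lambda>s. f (t + s)) has_vector_derivative D) (at 0)"
  shows "(f has_vector_derivative D) (at (t::real))"
proof -
  have "((\<lambda>u. u - t) has_vector_derivative 1) (at t)"
    by (auto intro!: derivative_eq_intros)
  from vector_diff_chain_at[OF this, where g="\<lambda>s. f (t + s)" and g'=D] assms
  show ?thesis by (simp add: o_def)
qed

text \<open>Stated with shifts because, for the curves used below, the group law turns a shift into
  a fixed map applied to a curve that starts at time 0, so derivatives at 0 suffice.\<close>

lemma has_vector_derivative_zero_eq:
  fixes f :: "real \<Rightarrow> 'a::real_normed_vector"
  assumes "\<And>t. ((\<lambda>s. f (t + s)) has_vector_derivative 0) (at 0)"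
  shows "f s = f t"
proof -
  have "(f has_vector_derivative 0) (at x within UNIV)" for x
    using has_vector_derivative_shift[OF assms] by simp
  then obtain c where "\<And>x. f x = c"
    using has_vector_derivative_zero_constant[of UNIV f] by auto
  then show ?thesis by simp
qed

lemma has_vector_derivative_scaleR_at_0:
  fixes f :: "real \<Rightarrow> 'a::real_normed_vector"
  assumes "isCont f 0"
  shows "((\<lambda>s. s *\<^sub>R f s) has_vector_derivative f 0) (at 0)"
proof -
  have "((\<lambda>h. norm (f h - f 0)) \<longlongrightarrow> 0) (at 0)"
    using assms tendsto_norm_zero[OF LIM_zero[OF isContD[OF assms]]] by simp
  moreover have "norm (h *\<^sub>R f h - h *\<^sub>R f 0) / norm h = norm (f h - f 0)" if "h \<noteq> 0" for h
    using that by (simp add: scaleR_diff_right[symmetric])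
  ultimately have "((\<lambda>h. norm (h *\<^sub>R f h - h *\<^sub>R f 0) / norm h) \<longlongrightarrow> 0) (at 0)"
    by (subst tendsto_cong[where g="\<lambda>h. norm (f h - f 0)"]) (auto simp: eventually_at intro!: exI[of _ 1])
  then show ?thesis
    unfolding has_vector_derivative_def has_derivative_iff_norm
    by (simp add: bounded_linear_scaleR_left)
qed

lemma linear_has_vector_derivative:
  fixes f :: "'a::euclidean_space \<Rightarrow> 'b::real_normed_vector"
  assumes "linear f" "(g has_vector_derivative g') (at t within S)"
  shows "((\<lambda>t. f (g t)) has_vector_derivative f g') (at t within S)"
  using bounded_linear.has_vector_derivative[OF linear_conv_bounded_linear[THEN iffD1, OF assms(1)] assms(2)] .

context exp_group
begin

lemma bil_has_vector_derivative:
  "((\<lambda>s. dm (s *\<^sub>R u, 0) (0, v)) has_vector_derivative bil u v) (at 0)"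
proof -
  let ?D = "frechet_derivative (\<lambda>p. dm p (0, v)) (at (0, 0))"
  have "((\<lambda>s. (s *\<^sub>R u, 0::'a)) has_derivative (\<lambda>s. (s *\<^sub>R u, 0))) (at 0)"
    by (intro derivative_eq_intros) auto
  from has_derivative_compose[OF this, where g="\<lambda>p. dm p (0, v)" and g'="?D"]
  have "((\<lambda>s. dm (s *\<^sub>R u, 0) (0, v)) has_derivative (\<lambda>s. bil (s *\<^sub>R u) v)) (at 0)"
    using has_derivative_dm_snd[of v "(0, 0)"] by (simp add: bil_def)
  then show ?thesis by (simp add: has_vector_derivative_def bil_scaleR_left)
qed

text \<open>The line through \<open>u\<close> is a one-parameter subgroup, hence an integral curve
  of the left-invariant field of its own velocity.\<close>

lemma dm_self: "dm (s *\<^sub>R u, 0) (0, u) = u"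
proof -
  have id: "((\<lambda>t. t *\<^sub>R u) has_vector_derivative u) (at 0)"
    by (auto intro!: derivative_eq_intros)
  have "((\<lambda>t. s *\<^sub>R u \<otimes> t *\<^sub>R u) has_vector_derivative dm (s *\<^sub>R u, 0) (0, u)) (at 0)"
    using has_vector_derivative_mult[OF has_vector_derivative_const id] by simp
  moreover have "((\<lambda>t. s *\<^sub>R u \<otimes> t *\<^sub>R u) has_vector_derivative u) (at 0)"
    unfolding scaleR_add_mult[symmetric] by (auto intro!: derivative_eq_intros)
  ultimately show ?thesis by (rule vector_derivative_unique_at)
qed

text \<open>By \<open>dm_self\<close> the left-invariant field of \<open>u\<close> is constant along
  the line through \<open>u\<close>. Polarization then makes \<open>bil\<close>
  antisymmetric.\<close>

lemma bil_self: "bil u u = 0"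
proof -
  have "((\<lambda>s::real. u) has_vector_derivative bil u u) (at 0)"
    using bil_has_vector_derivative[of u u] by (simp add: dm_self)
  from vector_derivative_unique_at[OF this has_vector_derivative_const] show ?thesis .
qed

lemma bil_antisym: "bil v u = - bil u v"
proof -
  have "bil (u + v) (u + v) = bil v u + bil u v"
    by (simp only: bil_add_left bil_add_right) (simp add: bil_self)
  then have "bil v u + bil u v = 0" using bil_self[of "u + v"] by simp
  then show ?thesis by (simp add: eq_neg_iff_add_eq_0)
qed

lemma lie_bracket_eq: "lie_bracket G u v = 2 *\<^sub>R bil u v"
  using bil_antisym[of u v] by (simp add: lie_bracket_eq_bil scaleR_2)

lemma bil_0 [simp]: "bil 0 v = 0" "bil u 0 = 0"
  using bil_scaleR_left[of 0 0 v] bil_scaleR_right[of u 0 0] by simp_all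

lemma bil_uminus: "bil (- u) v = - bil u v" "bil u (- v) = - bil u v"
  using bil_scaleR_left[of "-1" u v] bil_scaleR_right[of u "-1" v] by simp_all

text \<open>Conjugation in the group. Since the exponential map is the identity, it is at the same
  time the adjoint representation and therefore linear in \<open>w\<close>.\<close>

definition Ad :: "'a \<Rightarrow> 'a \<Rightarrow> 'a" where
  "Ad g w = g \<otimes> w \<otimes> (- g)"

lemma Ad_0 [simp]: "Ad 0 w = w"
  by (simp add: Ad_def)

lemma Ad_mult_left: "Ad (g \<otimes> h) w = Ad g (Ad h w)"
  by (simp add: Ad_def uminus_mult_rev mult_assoc)

lemma Ad_uminus [simp]: "Ad (- g) (Ad g w) = w" "Ad g (Ad (- g) w) = w"
  by (simp_all flip: Ad_mult_left)

lemma Ad_mult_right: "Ad g (x \<otimes> y) = Ad g x \<otimes> Ad g y"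
  by (simp add: Ad_def mult_assoc)

lemma Ad_scaleR_add: "Ad ((s + t) *\<^sub>R x) w = Ad (s *\<^sub>R x) (Ad (t *\<^sub>R x) w)"
  by (simp add: Ad_mult_left scaleR_add_mult)

lemma Ad_has_vector_derivative':
  assumes "(a has_vector_derivative a') (at t)" "(w has_vector_derivative w') (at t)"
  shows "((\<lambda>t. Ad (a t) (w t)) has_vector_derivative
    dm (a t \<otimes> w t, - a t) (dm (a t, w t) (a', w'), - a')) (at t)"
  unfolding Ad_def
  by (intro has_vector_derivative_mult has_vector_derivative_minus assms)

text \<open>Conjugation carries the line through \<open>w\<close> to a one-parameter subgroup, whose
  value at 1 equals its initial velocity. That velocity is a composition of differentials, which is
  where the linearity of \<open>Ad g\<close> comes from.\<close>

lemma Ad_eq_dm: "Ad g w = dm (g, - g) (dm (g, 0) (0, w), 0)"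
proof -
  have "((\<lambda>t. t *\<^sub>R w) has_vector_derivative w) (at 0)"
    by (auto intro!: derivative_eq_intros)
  from Ad_has_vector_derivative'[OF has_vector_derivative_const this, of g]
  have "one_parameter_subgroup G (\<lambda>t. Ad g (t *\<^sub>R w)) (dm (g, - g) (dm (g, 0) (0, w), 0))"
    by (simp add: one_parameter_subgroup_def scaleR_add_mult Ad_mult_right)
  from one_parameter_subgroup_at_1[OF this] show ?thesis by simp
qed

lemma linear_Ad: "linear (Ad g)"
proof (rule linearI)
  show "Ad g (x + y) = Ad g x + Ad g y" for x y
    unfolding Ad_eq_dm using dm_add[of _ 0 0 x y] dm_add[of _ _ _ 0 0] by simp
  show "Ad g (c *\<^sub>R x) = c *\<^sub>R Ad g x" for c x
    unfolding Ad_eq_dm using dm_scaleR[of _ c 0 x] dm_scaleR[of _ c _ 0] by simp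
qed

text \<open>Turns a right translation into a left one: both sides are the velocity of
  \<open>t *\<^sub>R p \<otimes> z\<close>, read for the right-hand side as the inverse of
  \<open>- z \<otimes> t *\<^sub>R (- p)\<close>.\<close>

lemma dm_fst_eq: "dm (0, z) (p, 0) = dm (- z, 0) (0, p)"
proof -
  have id: "((\<lambda>t. t *\<^sub>R p) has_vector_derivative p) (at 0)" for p
    by (auto intro!: derivative_eq_intros)
  have "((\<lambda>t. t *\<^sub>R p \<otimes> z) has_vector_derivative dm (0, z) (p, 0)) (at 0)"
    using has_vector_derivative_mult[OF id has_vector_derivative_const, of p z] by simp
  moreover have "((\<lambda>t. - z \<otimes> t *\<^sub>R (- p)) has_vector_derivative dm (- z, 0) (0, - p)) (at 0)"
    using has_vector_derivative_mult[OF has_vector_derivative_const id, of "- z" "- p"] by simp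
  from has_vector_derivative_minus[OF this]
  have "((\<lambda>t. t *\<^sub>R p \<otimes> z) has_vector_derivative - dm (- z, 0) (0, - p)) (at 0)"
    by (simp add: uminus_mult_rev)
  ultimately have "dm (0, z) (p, 0) = - dm (- z, 0) (0, - p)"
    by (rule vector_derivative_unique_at)
  also have "\<dots> = dm (- z, 0) (0, p)"
    using dm_scaleR[of _ "-1" 0 p] by simp
  finally show ?thesis .
qed

lemma Ad_has_vector_derivative:
  assumes "(a has_vector_derivative a') (at 0)" "(w has_vector_derivative w') (at 0)" "a 0 = 0"
  shows "((\<lambda>t. Ad (a t) (w t)) has_vector_derivative 2 *\<^sub>R bil a' (w 0) + w') (at 0)"
proof -
  define E where "E z = dm (- z, 0) (0, a') - dm (z, 0) (0, a')" for z
  have D: "dm (z, 0) (dm (0, z) (a', w'), - a') = E z + w'" for z w'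
  proof -
    have "dm (z, 0) (dm (0, z) (a', w'), - a')
        = dm (0, z) (a', w') - dm (z, 0) (0, a')"
      using dm_split[of "(z,0)" "dm (0, z) (a', w')" "-a'"] dm_scaleR[of "(z,0)" "-1" 0 a']
      by (simp add: dm_snd_0)
    moreover have "dm (0, z) (a', w') = dm (- z, 0) (0, a') + w'"
      using dm_split[of "(0,z)" a' w'] by (simp add: dm_fst_0 dm_fst_eq)
    ultimately show ?thesis by (simp add: E_def)
  qed
  have der: "((\<lambda>t. Ad (t *\<^sub>R a') z) has_vector_derivative E z) (at 0)" for z
  proof -
    have "((\<lambda>t. t *\<^sub>R a') has_vector_derivative a') (at 0)"
      by (auto intro!: derivative_eq_intros)
    from Ad_has_vector_derivative'[OF this has_vector_derivative_const, of z] show ?thesis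
      using D[of z 0] by simp
  qed
  \<comment> \<open>\<open>E\<close> inherits homogeneity from the linearity of \<open>Ad\<close>. A
    homogeneous map agrees along each line with its own derivative at 0, and the formula defining
    \<open>E\<close> expresses that derivative through \<open>bil\<close>.\<close>
  have "E (s *\<^sub>R z) = s *\<^sub>R E z" for s z
  proof -
    have "((\<lambda>t. Ad (t *\<^sub>R a') (s *\<^sub>R z)) has_vector_derivative s *\<^sub>R E z) (at 0)"
      using linear_has_vector_derivative[OF linear_scale_self der, of s z]
      by (simp add: linear_scale[OF linear_Ad])
    from vector_derivative_unique_at[OF der this] show ?thesis .
  qed
  moreover have "((\<lambda>s. E (s *\<^sub>R z)) has_vector_derivative - bil z a' - bil z a') (at 0)" for z
    unfolding E_def using has_vector_derivative_diff[OF bil_has_vector_derivative[of "-z" a'] bil_has_vector_derivative[of z a']]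
    by (simp add: bil_uminus)
  ultimately have "((\<lambda>s. s *\<^sub>R E z) has_vector_derivative - bil z a' - bil z a') (at 0)" for z
    by simp
  moreover have "((\<lambda>s. s *\<^sub>R E z) has_vector_derivative E z) (at 0)" for z
    by (auto intro!: derivative_eq_intros)
  ultimately have "E z = - bil z a' - bil z a'" for z
    using vector_derivative_unique_at by blast
  then have "E z = 2 *\<^sub>R bil a' z" for z
    using bil_antisym[of z a'] by (simp add: scaleR_2)
  then show ?thesis
    using Ad_has_vector_derivative'[OF assms(1,2)] assms(3) D[of "w 0" w'] by simp
qed

lemma has_vector_derivative_scaleR_id: "((\<lambda>t. t *\<^sub>R x) has_vector_derivative x) (at t within S)"
  by (auto intro!: derivative_eq_intros)

lemma bil_hom:
  assumes "linear f" "\<And>x y. f (x \<otimes> y) = f x \<otimes> f y"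
  shows "bil (f u) (f v) = f (bil u v)"
proof -
  have "dm (f x, 0) (0, f v) = f (dm (x, 0) (0, v))" for x
  proof -
    have 1: "((\<lambda>t. f (x \<otimes> t *\<^sub>R v)) has_vector_derivative f (dm (x, 0) (0, v))) (at 0)"
      using has_vector_derivative_mult[OF has_vector_derivative_const has_vector_derivative_scaleR_id]
      by (intro linear_has_vector_derivative[OF assms(1)]) (metis scaleR_zero_left)
    have 2: "((\<lambda>t. f x \<otimes> t *\<^sub>R f v) has_vector_derivative dm (f x, 0) (0, f v)) (at 0)"
      using has_vector_derivative_mult[OF has_vector_derivative_const has_vector_derivative_scaleR_id, of "f x" "f v" 0]
      by simp
    show ?thesis
      using vector_derivative_unique_at[OF 2] 1 by (simp add: assms linear_scale[OF assms(1)])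
  qed
  then have "((\<lambda>s. f (dm (s *\<^sub>R u, 0) (0, v))) has_vector_derivative bil (f u) (f v)) (at 0)"
    using bil_has_vector_derivative[of "f u" "f v"] by (simp add: linear_scale[OF assms(1), symmetric])
  from vector_derivative_unique_at[OF this linear_has_vector_derivative[OF assms(1) bil_has_vector_derivative]]
  show ?thesis .
qed

lemma bil_Ad: "bil (Ad g u) (Ad g v) = Ad g (bil u v)"
  by (rule bil_hom[OF linear_Ad Ad_mult_right])

text \<open>The derivative at \<open>t = 0\<close> of the invariance of \<open>bil\<close> under
  \<open>Ad (t *\<^sub>R x)\<close>.\<close>

lemma bil_jacobi: "bil x (bil u v) = bil (bil x u) v + bil u (bil x v)"
proof -
  have der: "((\<lambda>t. Ad (t *\<^sub>R x) y) has_vector_derivative 2 *\<^sub>R bil x y) (at 0)" for y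
    using Ad_has_vector_derivative[OF has_vector_derivative_scaleR_id has_vector_derivative_const, of x y]
    by simp
  have "bounded_bilinear bil"
    using bilinear_bil bilinear_conv_bounded_bilinear by blast
  from bounded_bilinear.has_vector_derivative[OF this der der, of u v]
  have "((\<lambda>t. Ad (t *\<^sub>R x) (bil u v)) has_vector_derivative
      bil u (2 *\<^sub>R bil x v) + bil (2 *\<^sub>R bil x u) v) (at 0)"
    by (simp add: bil_Ad)
  from vector_derivative_unique_at[OF this der]
  have "2 *\<^sub>R bil x (bil u v) = 2 *\<^sub>R (bil (bil x u) v + bil u (bil x v))"
    by (simp add: bil_scaleR_left bil_scaleR_right scaleR_add_right add.commute)
  then show ?thesis by (metis scaleR_cancel_left zero_neq_numeral)
qed

end

section \<open>Bracket-preserving linear maps are group homomorphisms\<close>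

locale lie_algebra_endo = exp_group +
  fixes f :: "'a \<Rightarrow> 'a"
  assumes linear_f: "linear f"
    and f_bil: "\<And>u v. f (bil u v) = bil (f u) (f v)"
begin

text \<open>Along \<open>t *\<^sub>R x\<close> both sides solve the same linear equation. The curve
  \<open>c\<close> transports one of them back by the inverse flow, and the two bracket terms of its
  derivative cancel.\<close>

lemma f_Ad: "f (Ad x w) = Ad (f x) (f w)"
proof -
  have f_scale: "f (t *\<^sub>R y) = t *\<^sub>R f y" for t y
    using linear_scale[OF linear_f] .
  define c where "c t = Ad (- t *\<^sub>R f x) (f (Ad (t *\<^sub>R x) w))" for t
  have "c 1 = c 0"
  proof (rule has_vector_derivative_zero_eq)
    fix t
    let ?z = "Ad (t *\<^sub>R x) w"
    have "((\<lambda>s. f (Ad (s *\<^sub>R x) ?z)) has_vector_derivative f (2 *\<^sub>R bil x ?z)) (at 0)"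
      using Ad_has_vector_derivative[OF has_vector_derivative_scaleR_id has_vector_derivative_const, of x ?z]
      by (intro linear_has_vector_derivative[OF linear_f]) simp
    moreover have "((\<lambda>s. - s *\<^sub>R f x) has_vector_derivative - f x) (at 0)"
      by (auto intro!: derivative_eq_intros)
    ultimately have "((\<lambda>s. Ad (- s *\<^sub>R f x) (f (Ad (s *\<^sub>R x) ?z))) has_vector_derivative
        2 *\<^sub>R bil (- f x) (f ?z) + f (2 *\<^sub>R bil x ?z)) (at 0)"
      using Ad_has_vector_derivative[of "\<lambda>s. - s *\<^sub>R f x" "- f x" "\<lambda>s. f (Ad (s *\<^sub>R x) ?z)"] by simp
    then have "((\<lambda>s. Ad (- s *\<^sub>R f x) (f (Ad (s *\<^sub>R x) ?z))) has_vector_derivative 0) (at 0)"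
      by (simp add: bil_uminus f_scale f_bil)
    from linear_has_vector_derivative[OF linear_Ad this, of "- t *\<^sub>R f x"]
    have "((\<lambda>s. Ad (- t *\<^sub>R f x) (Ad (- s *\<^sub>R f x) (f (Ad (s *\<^sub>R x) ?z)))) has_vector_derivative 0) (at 0)"
      by (simp add: linear_0[OF linear_Ad])
    moreover have "c (t + s) = Ad (- t *\<^sub>R f x) (Ad (- s *\<^sub>R f x) (f (Ad (s *\<^sub>R x) ?z)))" for s
      using Ad_scaleR_add[of "-t" "-s" "f x"] Ad_scaleR_add[of s t x w]
      by (simp add: c_def add.commute)
    ultimately show "((\<lambda>s. c (t + s)) has_vector_derivative 0) (at 0)" by simp
  qed
  then have "Ad (- f x) (f (Ad x w)) = f w" by (simp add: c_def)
  then show ?thesis by (metis Ad_uminus(2))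
qed

text \<open>With \<open>A\<close> the differential of left translations at the identity and \<open>B = A\<^sup>-\<^sup>1\<close>, the curve
  \<open>u(t) = B(t y) (t v)\<close> satisfies the cocycle identity \<open>u(t + s) = Ad(-s y) u(t) + u(s)\<close>, which
  replaces the closed formula for the differential of the exponential map.\<close>

lemma f_dm_uminus: "f (dm (- y, y) (0, v)) = dm (- f y, f y) (0, f v)"
proof -
  have f_scale: "f (t *\<^sub>R y) = t *\<^sub>R f y" for t y
    using linear_scale[OF linear_f] .
  define u where "u y v t = dm (- t *\<^sub>R y, t *\<^sub>R y) (0, t *\<^sub>R v)" for y v t
  have u_0: "u y v 0 = 0" for y v
    using dm_scaleR[of "(0,0)" 0 0 v] by (simp add: u_def)
  have u_der: "((\<lambda>s. u y v s) has_vector_derivative v) (at 0)" for y v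
  proof -
    let ?g = "\<lambda>s. dm (- s *\<^sub>R y, s *\<^sub>R y) (0, v)"
    have "continuous_on UNIV ?g" by (intro continuous_intros)
    then have "isCont ?g 0" by (simp add: continuous_on_eq_continuous_at)
    moreover have "?g 0 = v" by (simp add: dm_fst_0)
    moreover have "u y v s = s *\<^sub>R ?g s" for s
      using dm_scaleR[of _ s 0 v] by (simp add: u_def)
    ultimately show ?thesis using has_vector_derivative_scaleR_at_0[of ?g] by simp
  qed
  \<comment> \<open>The product of the inverse of \<open>(t + s) *\<^sub>R y\<close> with
    \<open>(t + s) *\<^sub>R z\<close> is regrouped so that the same expression at time
    \<open>t\<close> stands in the middle, and then differentiated at \<open>z = y\<close> in
    direction \<open>v\<close>.\<close>
  have cocycle: "u y v (t + s) = Ad (- s *\<^sub>R y) (u y v t) + u y v s" for y v t s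
  proof -
    have line: "((\<lambda>\<sigma>. t *\<^sub>R (y + \<sigma> *\<^sub>R v)) has_vector_derivative t *\<^sub>R v) (at 0)" for t
      by (auto intro!: derivative_eq_intros)
    have 1: "((\<lambda>\<sigma>. (- t *\<^sub>R y) \<otimes> (t *\<^sub>R (y + \<sigma> *\<^sub>R v))) has_vector_derivative u y v t) (at 0)" for t
      using has_vector_derivative_mult[OF has_vector_derivative_const line] by (simp add: u_def)
    have 2: "((\<lambda>\<sigma>. (- s *\<^sub>R y) \<otimes> (((- t *\<^sub>R y) \<otimes> (t *\<^sub>R (y + \<sigma> *\<^sub>R v))) \<otimes> (s *\<^sub>R (y + \<sigma> *\<^sub>R v))))
        has_vector_derivative dm (- s *\<^sub>R y, s *\<^sub>R y) (0, dm (0, s *\<^sub>R y) (u y v t, s *\<^sub>R v))) (at 0)"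
      using has_vector_derivative_mult[OF has_vector_derivative_const has_vector_derivative_mult[OF 1 line],
          of "- s *\<^sub>R y" t s] by simp
    have eq: "(- s *\<^sub>R y) \<otimes> (((- t *\<^sub>R y) \<otimes> (t *\<^sub>R z)) \<otimes> (s *\<^sub>R z))
        = (- (t + s) *\<^sub>R y) \<otimes> ((t + s) *\<^sub>R z)" for z
    proof -
      have "- (t + s) = - s + - t" by simp
      then show ?thesis by (simp only: scaleR_add_mult mult_assoc)
    qed
    have "u y v (t + s) = dm (- s *\<^sub>R y, s *\<^sub>R y) (0, dm (0, s *\<^sub>R y) (u y v t, s *\<^sub>R v))"
      using vector_derivative_unique_at[OF 1 2[unfolded eq]] .
    also have "\<dots> = dm (- s *\<^sub>R y, s *\<^sub>R y) (0, dm (0, s *\<^sub>R y) (u y v t, 0)) + u y v s"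
      using dm_split[of "(0, s *\<^sub>R y)" "u y v t" "s *\<^sub>R v"] dm_add[of "(- s *\<^sub>R y, s *\<^sub>R y)" 0 0]
      by (simp add: dm_fst_0 u_def)
    also have "dm (- s *\<^sub>R y, s *\<^sub>R y) (0, dm (0, s *\<^sub>R y) (u y v t, 0)) = Ad (- s *\<^sub>R y) (u y v t)"
    proof -
      let ?h = "u y v t"
      have "((\<lambda>\<sigma>. (- s *\<^sub>R y) \<otimes> (\<sigma> *\<^sub>R ?h \<otimes> (s *\<^sub>R y))) has_vector_derivative
          dm (- s *\<^sub>R y, s *\<^sub>R y) (0, dm (0, s *\<^sub>R y) (?h, 0))) (at 0)"
        using has_vector_derivative_mult[OF has_vector_derivative_const
            has_vector_derivative_mult[OF has_vector_derivative_scaleR_id has_vector_derivative_const],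
            of "- s *\<^sub>R y" ?h "s *\<^sub>R y" 0] by simp
      moreover have "(- s *\<^sub>R y) \<otimes> (\<sigma> *\<^sub>R ?h \<otimes> (s *\<^sub>R y)) = \<sigma> *\<^sub>R Ad (- s *\<^sub>R y) ?h" for \<sigma>
        using linear_scale[OF linear_Ad, of "- s *\<^sub>R y" \<sigma> ?h] by (simp add: Ad_def mult_assoc)
      ultimately show ?thesis
        using vector_derivative_unique_at has_vector_derivative_scaleR_id by (simp, blast)
    qed
    finally show ?thesis .
  qed
  \<comment> \<open>The failure of the claim at time \<open>t\<close>. It satisfies the cocycle
    identity and has zero derivative at 0, so undoing the twist by
    \<open>Ad (t *\<^sub>R f y)\<close> makes it constant.\<close>
  define e where "e t = f (u y v t) - u (f y) (f v) t" for t
  have e_0: "e 0 = 0" by (simp add: e_def u_0 linear_0[OF linear_f])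
  have e_der: "(e has_vector_derivative 0) (at 0)"
    unfolding e_def
    using has_vector_derivative_diff[OF linear_has_vector_derivative[OF linear_f u_der] u_der, of y v "f y" "f v"]
    by simp
  have e_cocycle: "e (t + s) = Ad (- s *\<^sub>R f y) (e t) + e s" for t s
    by (simp add: e_def cocycle linear_add[OF linear_f] f_Ad linear_diff[OF linear_Ad]
        linear_neg[OF linear_f] f_scale)
  define c where "c t = Ad (t *\<^sub>R f y) (e t)" for t
  have "c 1 = c 0"
  proof (rule has_vector_derivative_zero_eq)
    fix t
    have "((\<lambda>s. Ad (s *\<^sub>R f y) (e s)) has_vector_derivative 0) (at 0)"
      using Ad_has_vector_derivative[OF has_vector_derivative_scaleR_id e_der, of "f y"] by (simp add: e_0)
    from linear_has_vector_derivative[OF linear_Ad this, of "t *\<^sub>R f y"]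
    have "((\<lambda>s. c t + Ad (t *\<^sub>R f y) (Ad (s *\<^sub>R f y) (e s))) has_vector_derivative 0) (at 0)"
      using has_vector_derivative_add[OF has_vector_derivative_const] by (fastforce simp: linear_0[OF linear_Ad])
    moreover have "c (t + s) = c t + Ad (t *\<^sub>R f y) (Ad (s *\<^sub>R f y) (e s))" for s
      by (simp add: c_def Ad_scaleR_add e_cocycle linear_add[OF linear_Ad])
    ultimately show "((\<lambda>s. c (t + s)) has_vector_derivative 0) (at 0)" by simp
  qed
  then have "Ad (f y) (e 1) = 0" by (simp add: c_def e_0)
  then have "e 1 = 0" by (metis Ad_uminus(1) linear_0[OF linear_Ad])
  then show ?thesis by (simp add: e_def u_def)
qed

lemma f_dm: "f (dm (y, 0) (0, v)) = dm (f y, 0) (0, f v)"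
proof -
  have "f v = dm (- f y, f y) (0, f (dm (y, 0) (0, v)))"
    using f_dm_uminus[of y "dm (y, 0) (0, v)"] by (simp add: dm_inverse)
  then show ?thesis by (metis dm_inverse(1))
qed

text \<open>By \<open>f_dm\<close> the curves \<open>f (x \<otimes> t *\<^sub>R v)\<close> and
  \<open>f x \<otimes> t *\<^sub>R f v\<close> follow the same left-invariant field from the same
  point. Their agreement is read off from the quotient \<open>c\<close>, whose derivative
  vanishes.\<close>

lemma f_mult: "f (x \<otimes> v) = f x \<otimes> f v"
proof -
  define c where "c t = f (x \<otimes> t *\<^sub>R v) \<otimes> - t *\<^sub>R f v" for t
  have "c 1 = c 0"
  proof (rule has_vector_derivative_zero_eq)
    fix t
    let ?y = "x \<otimes> t *\<^sub>R v"
    have "((\<lambda>s. ?y \<otimes> s *\<^sub>R v) has_vector_derivative dm (?y, 0) (0, v)) (at 0)"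
      using has_vector_derivative_mult[OF has_vector_derivative_const has_vector_derivative_scaleR_id, of ?y v 0]
      by simp
    from linear_has_vector_derivative[OF linear_f this]
    have 1: "((\<lambda>s. f (?y \<otimes> s *\<^sub>R v)) has_vector_derivative dm (f ?y, 0) (0, f v)) (at 0)"
      by (simp add: f_dm)
    have 2: "((\<lambda>s. - s *\<^sub>R f v) has_vector_derivative - f v) (at 0)"
      by (auto intro!: derivative_eq_intros)
    have "dm (f ?y, 0) (dm (f ?y, 0) (0, f v), - f v) = 0"
      using dm_split[of "(f ?y, 0)" "dm (f ?y, 0) (0, f v)" "- f v"] dm_scaleR[of "(f ?y, 0)" "-1" 0 "f v"]
      by (simp add: dm_snd_0)
    then have "((\<lambda>s. f (?y \<otimes> s *\<^sub>R v) \<otimes> - s *\<^sub>R f v) has_vector_derivative 0) (at 0)"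
      using has_vector_derivative_mult[OF 1 2] by simp
    from has_vector_derivative_mult[OF this has_vector_derivative_const, of "- t *\<^sub>R f v"]
    have "((\<lambda>s. (f (?y \<otimes> s *\<^sub>R v) \<otimes> - s *\<^sub>R f v) \<otimes> - t *\<^sub>R f v) has_vector_derivative 0) (at 0)"
      by (simp add: linear_0[OF linear_dm, unfolded zero_prod_def])
    moreover have "c (t + s) = (f (?y \<otimes> s *\<^sub>R v) \<otimes> - s *\<^sub>R f v) \<otimes> - t *\<^sub>R f v" for s
      using scaleR_add_mult[of t s v] scaleR_add_mult[of "-s" "-t" "f v"]
      by (simp add: c_def mult_assoc add.commute)
    ultimately show "((\<lambda>s. c (t + s)) has_vector_derivative 0) (at 0)" by simp
  qed
  then have "f (x \<otimes> v) \<otimes> - f v = f x" by (simp add: c_def)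
  then show ?thesis by (metis mult_assoc uminus_mult mult_zero)
qed

end

section \<open>Products and dilations in stratified groups\<close>

context exp_group
begin

section \<open>Local Lipschitz and second-order estimates for the multiplication\<close>

lemma mult_lipschitz:
  "\<exists>C\<ge>0. \<forall>x x' y y'. norm x \<le> R \<longrightarrow> norm x' \<le> R \<longrightarrow> norm y \<le> R \<longrightarrow> norm y' \<le> R \<longrightarrow>
    norm (x \<otimes> y - x' \<otimes> y') \<le> C * (norm (x - x') + norm (y - y'))"
proof -
  obtain C where C: "C \<ge> 0" "\<And>p q. p \<in> cball 0 (2 * R) \<Longrightarrow> q \<in> cball 0 (2 * R) \<Longrightarrow>
      norm (fst p \<otimes> snd p - fst q \<otimes> snd q) \<le> C * norm (p - q)"
    using smooth_lipschitz_on_cball[OF smooth_mult, of "2 * R"] by blast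
  have "norm (x \<otimes> y - x' \<otimes> y') \<le> C * (norm (x - x') + norm (y - y'))"
    if "norm x \<le> R" "norm x' \<le> R" "norm y \<le> R" "norm y' \<le> R" for x x' y y'
  proof -
    have "norm (x, y) \<le> 2 * R" "norm (x', y') \<le> 2 * R"
      using norm_Pair_le[of x y] norm_Pair_le[of x' y'] that by linarith+
    then have "norm (x \<otimes> y - x' \<otimes> y') \<le> C * norm (x - x', y - y')"
      using C(2)[of "(x, y)" "(x', y')"] by simp
    also have "\<dots> \<le> C * (norm (x - x') + norm (y - y'))"
      using C(1) norm_Pair_le by (intro mult_left_mono) auto
    finally show ?thesis .
  qed
  with C(1) show ?thesis by blast
qed

lemma mult3_lipschitz:
  "\<exists>C\<ge>0. \<forall>p g h q. norm p \<le> R \<longrightarrow> norm g \<le> R \<longrightarrow> norm h \<le> R \<longrightarrow> norm q \<le> R \<longrightarrow>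
    norm (p \<otimes> g \<otimes> q - p \<otimes> h \<otimes> q) \<le> C * norm (g - h)"
proof -
  obtain C where C: "C \<ge> 0" "\<And>x x' y y'. norm x \<le> R \<Longrightarrow> norm x' \<le> R \<Longrightarrow> norm y \<le> R \<Longrightarrow> norm y' \<le> R \<Longrightarrow>
      norm (x \<otimes> y - x' \<otimes> y') \<le> C * (norm (x - x') + norm (y - y'))"
    using mult_lipschitz[of R] by blast
  \<comment> \<open>Products of two factors from the ball of radius \<open>R\<close> leave that
    ball; \<open>S\<close> contains them, so that the Lipschitz estimate can be applied a second
    time.\<close>
  define S where "S = max R (C * (R + R))"
  obtain D where D: "D \<ge> 0" "\<And>x x' y y'. norm x \<le> S \<Longrightarrow> norm x' \<le> S \<Longrightarrow> norm y \<le> S \<Longrightarrow> norm y' \<le> S \<Longrightarrow>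
      norm (x \<otimes> y - x' \<otimes> y') \<le> D * (norm (x - x') + norm (y - y'))"
    using mult_lipschitz[of S] by blast
  have bd: "norm (x \<otimes> y) \<le> S" if "norm x \<le> R" "norm y \<le> R" for x y
  proof -
    have "0 \<le> R" using that(1) norm_ge_zero order_trans by blast
    then have "norm (x \<otimes> y) \<le> C * (norm x + norm y)"
      using C(2)[of x 0 y 0] that by simp
    also have "\<dots> \<le> C * (R + R)" using that C(1) by (intro mult_left_mono add_mono) auto
    finally show ?thesis by (simp add: S_def)
  qed
  have "norm (p \<otimes> g \<otimes> q - p \<otimes> h \<otimes> q) \<le> D * C * norm (g - h)"
    if "norm p \<le> R" "norm g \<le> R" "norm h \<le> R" "norm q \<le> R" for p g h q
  proof -
    have "norm (p \<otimes> g \<otimes> q - p \<otimes> h \<otimes> q) \<le> D * (norm (p \<otimes> g - p \<otimes> h) + norm (q - q))"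
      using that by (intro D(2) bd) (auto simp: S_def)
    also have "\<dots> \<le> D * (C * (norm (p - p) + norm (g - h)))"
      using C(2)[of p p g h] D(1) that by (intro mult_left_mono) auto
    finally show ?thesis by simp
  qed
  with C(1) D(1) show ?thesis by (intro exI[of _ "D * C"]) auto
qed

text \<open>At \<open>x = 0\<close> the differential of left translation is the identity for every
  \<open>y\<close>. Comparing the base points \<open>(x, y)\<close> and \<open>(0, y)\<close> gives
  the factor \<open>norm x\<close>.\<close>

lemma dm_snd_near_id:
  "\<exists>D\<ge>0. \<forall>x y v. norm x \<le> R \<longrightarrow> norm y \<le> R \<longrightarrow> norm (dm (x, y) (0, v) - v) \<le> D * norm x * norm v"
proof -
  have "\<exists>C\<ge>0. \<forall>p\<in>cball 0 (2 * R). \<forall>q\<in>cball 0 (2 * R).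
      norm (dm p (0, b) - dm q (0, b)) \<le> C * norm (p - q)" for b
    by (rule smooth_lipschitz_on_cball[OF smooth_dm])
  then obtain C where C: "\<And>b. C b \<ge> 0" "\<And>b p q. p \<in> cball 0 (2 * R) \<Longrightarrow> q \<in> cball 0 (2 * R) \<Longrightarrow>
      norm (dm p (0, b) - dm q (0, b)) \<le> C b * norm (p - q)"
    by metis
  define D where "D = (\<Sum>b\<in>Basis. C b)"
  have D0: "D \<ge> 0" unfolding D_def by (intro sum_nonneg C)
  have lin: "linear (\<lambda>v. dm (x, y) (0, v) - v)" for x y
    using dm_add[of "(x,y)" 0 0] dm_scaleR[of "(x,y)" _ 0]
    by (intro linearI) (auto simp: algebra_simps)
  have "norm (dm (x, y) (0, v) - v) \<le> D * norm x * norm v" if "norm x \<le> R" "norm y \<le> R" for x y v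
  proof -
    have "norm (dm (x, y) (0, b) - b) \<le> C b * norm x" for b
    proof -
      have "norm (x, y) \<le> 2 * R" "norm (0::'a, y) \<le> 2 * R"
        using norm_Pair_le[of x y] norm_Pair_le[of 0 y] that norm_ge_zero[of x] by (simp_all, linarith+)
      then show ?thesis using C(2)[of "(x, y)" "(0, y)" b] by (simp add: dm_fst_0)
    qed
    then have "(\<Sum>b\<in>Basis. norm (dm (x, y) (0, b) - b)) \<le> D * norm x"
      unfolding D_def sum_distrib_right by (intro sum_mono)
    then show ?thesis
      by (intro order_trans[OF norm_linear_le_sum_Basis[OF lin]] mult_right_mono norm_ge_zero)
  qed
  with D0 show ?thesis by blast
qed

text \<open>The difference vanishes at \<open>w = 0\<close>, and its derivative in \<open>w\<close>
  is already of size \<open>norm x\<close>, so the mean value inequality contributes the factor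
  \<open>norm w\<close>.\<close>

lemma mult_second_order:
  "\<exists>C\<ge>0. \<forall>x w. norm x \<le> R \<longrightarrow> norm w \<le> R \<longrightarrow> norm (x \<otimes> w - x - w) \<le> C * norm x * norm w"
proof -
  obtain D where D: "D \<ge> 0" "\<And>x y v. norm x \<le> R \<Longrightarrow> norm y \<le> R \<Longrightarrow> norm (dm (x, y) (0, v) - v) \<le> D * norm x * norm v"
    using dm_snd_near_id[of R] by blast
  have "norm (x \<otimes> w - x - w) \<le> D * norm x * norm w" if "norm x \<le> R" "norm w \<le> R" for x w
  proof -
    have "norm ((x \<otimes> w - x - w) - (x \<otimes> 0 - x - 0)) \<le> D * norm x * norm (w - 0)"
    proof (rule differentiable_bound[where S="cball 0 R" and f'="\<lambda>y v. dm (x, y) (0, v) - v"])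
      show "((\<lambda>w. x \<otimes> w - x - w) has_derivative (\<lambda>v. dm (x, y) (0, v) - v)) (at y within cball 0 R)" for y
        by (auto intro!: derivative_eq_intros)
      show "onorm (\<lambda>v. dm (x, y) (0, v) - v) \<le> D * norm x" if "y \<in> cball 0 R" for y
        using that \<open>norm x \<le> R\<close> D(2) by (intro onorm_le) auto
      show "0 \<in> cball 0 R" using that(1) norm_ge_zero[of x] by (simp, linarith)
    qed (use that in auto)
    then show ?thesis by simp
  qed
  with D(1) show ?thesis by blast
qed

section \<open>Products of lists of group elements\<close>

definition gprod :: "'a list \<Rightarrow> 'a" where
  "gprod ws = foldr (\<otimes>) ws 0"

lemma gprod_Nil [simp]: "gprod [] = 0"
  and gprod_Cons [simp]: "gprod (w # ws) = w \<otimes> gprod ws"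
  by (simp_all add: gprod_def)

lemma gprod_append [simp]: "gprod (xs @ ys) = gprod xs \<otimes> gprod ys"
  by (induction xs) (simp_all add: mult_assoc)

lemma gprod_replicate: "gprod (replicate k w) = real k *\<^sub>R w"
  using scaleR_add_mult[of 1 _ w] by (induction k) simp_all

lemma uminus_gprod: "- gprod ws = gprod (rev (map uminus ws))"
  by (induction ws) (simp_all add: uminus_mult_rev)

text \<open>Telescoping: factors are exchanged one at a time, with the entries of \<open>hs\<close>
  already inserted on the left, collected in \<open>p\<close>, and those of \<open>gs\<close> still
  waiting on the right. Hence bounds are asked for prefixes of \<open>hs\<close> and suffixes of
  \<open>gs\<close>, and the constant does not depend on the number of factors.\<close>

lemma gprod_replace_aux:
  assumes C: "\<And>p g h q. norm p \<le> R \<Longrightarrow> norm g \<le> R \<Longrightarrow> norm h \<le> R \<Longrightarrow> norm q \<le> R \<Longrightarrow>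
      norm (p \<otimes> g \<otimes> q - p \<otimes> h \<otimes> q) \<le> C * norm (g - h)"
    and "length gs = length hs"
    and "\<forall>g\<in>set gs. norm g \<le> R" "\<forall>h\<in>set hs. norm h \<le> R"
    and "\<And>i. norm (p \<otimes> gprod (take i hs)) \<le> R" "\<And>i. norm (gprod (drop i gs)) \<le> R"
  shows "norm (p \<otimes> gprod gs - p \<otimes> gprod hs) \<le> C * (\<Sum>(g, h)\<leftarrow>zip gs hs. norm (g - h))"
  using assms(2-)
proof (induction gs hs arbitrary: p rule: list_induct2)
  case (Cons g gs h hs)
  have "norm (p \<otimes> h \<otimes> gprod (take i hs)) \<le> R" for i
    using Cons.prems(3)[of "Suc i"] by (simp add: mult_assoc)
  moreover have "norm (gprod (drop i gs)) \<le> R" for i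
    using Cons.prems(4)[of "Suc i"] by simp
  ultimately have "norm ((p \<otimes> h) \<otimes> gprod gs - (p \<otimes> h) \<otimes> gprod hs)
      \<le> C * (\<Sum>(g, h)\<leftarrow>zip gs hs. norm (g - h))"
    using Cons.prems by (intro Cons.IH) auto
  moreover have "norm (p \<otimes> g \<otimes> gprod gs - p \<otimes> h \<otimes> gprod gs) \<le> C * norm (g - h)"
    using Cons.prems(1,2) Cons.prems(3)[of 0] Cons.prems(4)[of 1] by (intro C) auto
  ultimately have "norm ((p \<otimes> g \<otimes> gprod gs - p \<otimes> h \<otimes> gprod gs)
      + ((p \<otimes> h) \<otimes> gprod gs - (p \<otimes> h) \<otimes> gprod hs)) \<le> C * norm (g - h) + C * (\<Sum>(g, h)\<leftarrow>zip gs hs. norm (g - h))"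
    by (intro norm_triangle_mono)
  then show ?case by (simp add: mult_assoc distrib_left)
qed simp

lemma gprod_replace:
  "\<exists>C\<ge>0. \<forall>gs hs. length gs = length hs \<longrightarrow> (\<forall>g\<in>set gs. norm g \<le> R) \<longrightarrow> (\<forall>h\<in>set hs. norm h \<le> R) \<longrightarrow>
    (\<forall>i. norm (gprod (take i hs)) \<le> R) \<longrightarrow> (\<forall>i. norm (gprod (drop i gs)) \<le> R) \<longrightarrow>
    norm (gprod gs - gprod hs) \<le> C * (\<Sum>(g, h)\<leftarrow>zip gs hs. norm (g - h))"
proof -
  obtain C where C: "C \<ge> 0" "\<And>p g h q. norm p \<le> R \<Longrightarrow> norm g \<le> R \<Longrightarrow> norm h \<le> R \<Longrightarrow> norm q \<le> R \<Longrightarrow>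
      norm (p \<otimes> g \<otimes> q - p \<otimes> h \<otimes> q) \<le> C * norm (g - h)"
    using mult3_lipschitz[of R] by blast
  show ?thesis
    using gprod_replace_aux[of R C _ _ 0] C by (intro exI[of _ C]) simp
qed

lemma partial_product_eq_gprod: "partial_product G g n = gprod (map g [1..<Suc n])"
  by (induction n) simp_all

end

section \<open>Stratification, dilations and products of horizontal vectors\<close>

locale carnot = exp_group +
  fixes V :: "nat \<Rightarrow> 'a set" and r :: nat
  assumes stratification: "stratification G V r"
begin

lemma r_ge_1: "1 \<le> r"
  and subspace_V: "i \<in> {1..r} \<Longrightarrow> subspace (V i)"
  using stratification by (simp_all add: stratification_def)

lemma subspace_V1: "subspace (V 1)"
  using subspace_V[of 1] r_ge_1 by simp

definition layers :: "'a \<Rightarrow> nat \<Rightarrow> 'a" where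
  "layers x = (THE v. (\<forall>i\<in>{1..r}. v i \<in> V i) \<and> (\<forall>i. i \<notin> {1..r} \<longrightarrow> v i = 0) \<and> x = (\<Sum>i=1..r. v i))"

lemma ex1_layers:
  "\<exists>!v. (\<forall>i\<in>{1..r}. v i \<in> V i) \<and> (\<forall>i. i \<notin> {1..r} \<longrightarrow> v i = 0) \<and> x = (\<Sum>i=1..r. v i)"
  using stratification unfolding stratification_def by blast

lemma layers: "i \<in> {1..r} \<Longrightarrow> layers x i \<in> V i" "i \<notin> {1..r} \<Longrightarrow> layers x i = 0"
  "(\<Sum>i=1..r. layers x i) = x"
  using theI'[OF ex1_layers[of x]] unfolding layers_def[symmetric] by auto

lemma sum_layers: "(\<Sum>i=Suc 0..r. layers x i) = x"
  using layers(3) by simp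

lemma layers_eqI:
  assumes "\<And>i. i \<in> {1..r} \<Longrightarrow> v i \<in> V i" "\<And>i. i \<notin> {1..r} \<Longrightarrow> v i = 0" "x = (\<Sum>i=1..r. v i)"
  shows "layers x = v"
  unfolding layers_def using assms by (intro the1_equality[OF ex1_layers]) auto

lemma layers_add: "layers (x + y) i = layers x i + layers y i"
proof -
  have "layers (x + y) = (\<lambda>i. layers x i + layers y i)"
    by (rule layers_eqI) (auto simp: layers sum_layers subspace_add[OF subspace_V] sum.distrib)
  then show ?thesis by simp
qed

lemma layers_scaleR: "layers (c *\<^sub>R x) i = c *\<^sub>R layers x i"
proof -
  have "layers (c *\<^sub>R x) = (\<lambda>i. c *\<^sub>R layers x i)"
    by (rule layers_eqI) (auto simp: layers sum_layers subspace_scale[OF subspace_V] scaleR_sum_right[symmetric])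
  then show ?thesis by simp
qed

lemma layers_in_V:
  assumes "i \<in> {1..r}" "x \<in> V i"
  shows "layers x j = (if j = i then x else 0)"
proof -
  have "layers x = (\<lambda>j. if j = i then x else 0)"
    by (rule layers_eqI) (use assms subspace_0[OF subspace_V] in auto)
  then show ?thesis by simp
qed

definition dil :: "real \<Rightarrow> 'a \<Rightarrow> 'a" where
  "dil a x = (\<Sum>i=1..r. a ^ i *\<^sub>R layers x i)"

lemma linear_dil: "linear (dil a)"
  by (rule linearI)
    (auto simp: dil_def layers_add layers_scaleR sum.distrib scaleR_add_right scaleR_sum_right mult.commute)

lemma dil_in_V: "i \<in> {1..r} \<Longrightarrow> x \<in> V i \<Longrightarrow> dil a x = a ^ i *\<^sub>R x"
  by (simp add: dil_def layers_in_V if_distrib cong: if_cong)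

lemma dil_V1: "x \<in> V 1 \<Longrightarrow> dil a x = a *\<^sub>R x"
  using dil_in_V[of 1 x a] r_ge_1 by simp

lemma linear_eq_dil:
  assumes "linear f" "\<And>i x. i \<in> {1..r} \<Longrightarrow> x \<in> V i \<Longrightarrow> f x = a ^ i *\<^sub>R x"
  shows "f = dil a"
proof
  fix x
  have "f x = (\<Sum>i=1..r. f (layers x i))"
    by (subst layers(3)[of x, symmetric]) (simp add: linear_sum[OF assms(1)] del: layers)
  also have "\<dots> = dil a x"
    unfolding dil_def by (intro sum.cong refl assms(2) layers)
  finally show "f x = dil a x" .
qed

lemma algebra_dilation_eq: "algebra_dilation V r a = dil a"
  unfolding algebra_dilation_def
  using linear_dil dil_in_V linear_eq_dil by (intro the_equality) auto

lemma group_dilation_eq: "group_dilation G V r a = dil a"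
  by (simp add: group_dilation_def algebra_dilation_eq)

lemma dil_dil: "dil a (dil b x) = dil (a * b) x"
proof -
  have "dil a \<circ> dil b = dil (a * b)"
    by (rule linear_eq_dil)
      (auto simp: dil_in_V linear_scale[OF linear_dil] power_mult_distrib intro!: linear_compose linear_dil)
  from fun_cong[OF this, of x] show ?thesis by simp
qed

lemma dil_1 [simp]: "dil 1 x = x"
  by (simp add: dil_def sum_layers)

lemma dil_inverse: "a \<noteq> 0 \<Longrightarrow> dil (1 / a) (dil a x) = x" "a \<noteq> 0 \<Longrightarrow> dil a (dil (1 / a) x) = x"
  by (simp_all add: dil_dil)

lemma bil_V1:
  assumes "u \<in> V 1" "i \<in> {1..r}" "v \<in> V i"
  shows "if i = r then bil u v = 0 else bil u v \<in> V (Suc i)"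
proof (cases "i = r")
  case True
  then have "lie_bracket G u v = 0"
    using stratification assms by (simp add: stratification_def)
  then show ?thesis using True by (simp add: lie_bracket_eq)
next
  case False
  then have i: "Suc i \<in> {2..r}" using assms(2) by auto
  then have "span {lie_bracket G u v | u v. u \<in> V 1 \<and> v \<in> V (Suc i - 1)} = V (Suc i)"
    using stratification unfolding stratification_def by blast
  then have "lie_bracket G u v \<in> V (Suc i)"
    using assms by (auto intro!: span_base)
  then have "(1/2) *\<^sub>R lie_bracket G u v \<in> V (Suc i)"
    using i by (intro subspace_scale subspace_V) auto
  then show ?thesis using False by (simp add: lie_bracket_eq)
qed

text \<open>The form in which generation by the first layer is used: iterated brackets with
  horizontal vectors exhaust every layer, and the layers span.\<close>

lemma V_generated:
  assumes "subspace S" "V 1 \<subseteq> S" "\<And>u v. u \<in> V 1 \<Longrightarrow> v \<in> S \<Longrightarrow> bil u v \<in> S"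
  shows "S = UNIV"
proof -
  have V: "V i \<subseteq> S" if "i \<in> {1..r}" for i
    using that
  proof (induction i)
    case (Suc i)
    show ?case
    proof (cases "i = 0")
      case False
      then have "Suc i \<in> {2..r}" using Suc.prems by auto
      then have "span {lie_bracket G u v | u v. u \<in> V 1 \<and> v \<in> V (Suc i - 1)} = V (Suc i)"
        using stratification unfolding stratification_def by blast
      moreover have "{lie_bracket G u v | u v. u \<in> V 1 \<and> v \<in> V (Suc i - 1)} \<subseteq> S"
        using Suc False assms by (auto simp: lie_bracket_eq intro!: subspace_scale[OF assms(1)])
      ultimately show ?thesis using span_minimal assms(1) by blast
    qed (use assms(2) in simp)
  qed simp
  have "x \<in> S" for x
  proof -
    have "(\<Sum>i=1..r. layers x i) \<in> S"
      using V layers(1) by (intro subspace_sum[OF assms(1)]) blast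
    then show ?thesis by (simp add: sum_layers)
  qed
  then show ?thesis by auto
qed

text \<open>The grading settles the case of horizontal \<open>x\<close> and \<open>y\<close> in a
  single layer. By the Jacobi identity the set of good \<open>x\<close> is closed under brackets
  with horizontal vectors, so \<open>V_generated\<close> makes it everything.\<close>

lemma dil_bil: "dil a (bil x y) = bil (dil a x) (dil a y)"
proof -
  define S where "S = {x. \<forall>y. dil a (bil x y) = bil (dil a x) (dil a y)}"
  have "subspace S"
    unfolding S_def
    by (auto intro!: subspaceI simp: linear_0[OF linear_dil] linear_add[OF linear_dil] linear_scale[OF linear_dil]
        bil_add_left bil_scaleR_left)
  moreover have V1: "V 1 \<subseteq> S"
  proof
    fix u assume u: "u \<in> V 1"
    have "dil a (bil u v) = bil (dil a u) (dil a v)" if "i \<in> {1..r}" "v \<in> V i" for i v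
    proof -
      have "bil (dil a u) (dil a v) = a ^ Suc i *\<^sub>R bil u v"
        by (simp add: dil_V1[OF u] dil_in_V[OF that] bil_scaleR_left bil_scaleR_right)
      moreover have "dil a (bil u v) = a ^ Suc i *\<^sub>R bil u v"
      proof (cases "i = r")
        case True
        then show ?thesis using bil_V1[OF u that] by (simp add: linear_0[OF linear_dil])
      next
        case False
        then show ?thesis using bil_V1[OF u that] that(1) by (intro dil_in_V) auto
      qed
      ultimately show ?thesis by simp
    qed
    then have *: "dil a (bil u (layers y i)) = bil (dil a u) (dil a (layers y i))" if "i \<in> {1..r}" for i y
      using that layers(1) by blast
    have lin: "linear (bil w)" for w
      by (intro linearI bil_add_right bil_scaleR_right)
    have "dil a (bil u y) = bil (dil a u) (dil a y)" for y
    proof -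
      have "dil a (bil u (\<Sum>i=1..r. layers y i)) = (\<Sum>i=1..r. dil a (bil u (layers y i)))"
        by (simp add: linear_sum[OF lin] linear_sum[OF linear_dil] del: layers)
      also have "\<dots> = (\<Sum>i=1..r. bil (dil a u) (dil a (layers y i)))"
        by (intro sum.cong refl *)
      also have "\<dots> = bil (dil a u) (dil a (\<Sum>i=1..r. layers y i))"
        by (simp add: linear_sum[OF lin] linear_sum[OF linear_dil] del: layers)
      finally show ?thesis by (simp add: sum_layers)
    qed
    then show "u \<in> S" by (simp add: S_def)
  qed
  moreover have "bil u v \<in> S" if "u \<in> V 1" "v \<in> S" for u v
  proof -
    have eq: "bil (bil u v) y = bil u (bil v y) - bil v (bil u y)" for u v y
      using bil_jacobi[of u v y] by simp
    have "u \<in> S" using that(1) V1 by auto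
    then show ?thesis using that(2) unfolding S_def by (simp add: eq linear_diff[OF linear_dil])
  qed
  ultimately have "S = UNIV" by (rule V_generated)
  then show ?thesis by (auto simp: S_def)
qed

sublocale dil: lie_algebra_endo G "dil a" for a
  by (intro lie_algebra_endo.intro lie_algebra_endo_axioms.intro exp_group_axioms linear_dil dil_bil)

lemma dil_gprod: "dil a (gprod ws) = gprod (map (dil a) ws)"
  by (induction ws) (simp_all add: linear_0[OF linear_dil] dil.f_mult)

text \<open>While \<open>K\<close> times the accumulated length is at most 1, the partial products
  stay in the unit ball, where one Lipschitz constant bounds the growth caused by each further
  factor. \<open>K \<ge> 1\<close> keeps the factors in that ball too.\<close>

lemma gprod_norm_le_small:
  "\<exists>K>0. \<forall>ws. (\<Sum>w\<leftarrow>ws. norm w) * K \<le> 1 \<longrightarrow> norm (gprod ws) \<le> K * (\<Sum>w\<leftarrow>ws. norm w)"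
proof -
  obtain C where C: "C \<ge> 0" "\<And>x x' y y'. norm x \<le> 1 \<Longrightarrow> norm x' \<le> 1 \<Longrightarrow> norm y \<le> 1 \<Longrightarrow> norm y' \<le> 1 \<Longrightarrow>
      norm (x \<otimes> y - x' \<otimes> y') \<le> C * (norm (x - x') + norm (y - y'))"
    using mult_lipschitz[of 1] by blast
  define K where "K = max C 1"
  have K: "K \<ge> 1" "K \<ge> C" by (auto simp: K_def)
  have "norm (gprod ws) \<le> K * (\<Sum>w\<leftarrow>ws. norm w)" if "(\<Sum>w\<leftarrow>ws. norm w) * K \<le> 1" for ws
    using that
  proof (induction ws rule: rev_induct)
    case (snoc w ws)
    let ?s = "\<Sum>w\<leftarrow>ws. norm w"
    have s: "0 \<le> ?s" by (intro sum_list_nonneg) auto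
    have "?s * K \<le> 1" using snoc.prems K(1) by (simp add: algebra_simps) (smt (verit) mult_nonneg_nonneg norm_ge_zero)
    then have IH: "norm (gprod ws) \<le> K * ?s" by (rule snoc.IH)
    have Ks: "0 \<le> K * ?s" using s K(1) by simp
    have "K * norm w + K * ?s \<le> 1" using snoc.prems by (simp add: algebra_simps)
    moreover have "norm w \<le> K * norm w" using mult_right_mono[OF K(1), of "norm w"] by simp
    ultimately have w: "norm w \<le> 1" using Ks by linarith
    have "norm (gprod ws) \<le> 1" using IH \<open>?s * K \<le> 1\<close> by (simp add: mult.commute)
    then have "norm (gprod ws \<otimes> w - gprod ws \<otimes> 0) \<le> C * norm w"
      using C(2)[of "gprod ws" "gprod ws" w 0] w by simp
    also have "\<dots> \<le> K * norm w" using K by (intro mult_right_mono) auto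
    finally have "norm (gprod ws \<otimes> w) \<le> norm (gprod ws) + K * norm w"
      using norm_triangle_sub[of "gprod ws \<otimes> w" "gprod ws"] by simp
    then show ?case using IH by (simp add: algebra_simps)
  qed simp
  then show ?thesis using K by (intro exI[of _ K]) auto
qed

text \<open>A small dilation \<open>a\<close> brings the total length below the threshold of
  \<open>gprod_norm_le_small\<close>. Undoing it on the product is a fixed bounded linear map and
  costs only a constant.\<close>

lemma gprod_norm_le:
  "\<exists>C\<ge>0. \<forall>ws. set ws \<subseteq> V 1 \<longrightarrow> (\<Sum>w\<leftarrow>ws. norm w) \<le> R \<longrightarrow> norm (gprod ws) \<le> C * (\<Sum>w\<leftarrow>ws. norm w)"
proof -
  obtain K where K: "K > 0" "\<And>ws. (\<Sum>w\<leftarrow>ws. norm w) * K \<le> 1 \<Longrightarrow> norm (gprod ws) \<le> K * (\<Sum>w\<leftarrow>ws. norm w)"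
    using gprod_norm_le_small by blast
  define a where "a = 1 / (K * (\<bar>R\<bar> + 1))"
  have a: "a > 0" using K(1) by (simp add: a_def)
  have "bounded_linear (dil (1 / a))"
    using linear_dil linear_conv_bounded_linear by blast
  then obtain B where B: "B > 0" "\<And>x. norm (dil (1 / a) x) \<le> norm x * B"
    using bounded_linear.pos_bounded by blast
  have "norm (gprod ws) \<le> K * a * B * (\<Sum>w\<leftarrow>ws. norm w)"
    if "set ws \<subseteq> V 1" "(\<Sum>w\<leftarrow>ws. norm w) \<le> R" for ws
  proof -
    let ?s = "\<Sum>w\<leftarrow>ws. norm w"
    have map: "map (dil a) ws = map (\<lambda>w. a *\<^sub>R w) ws"
      using that(1) by (auto simp: dil_V1)
    have sum: "(\<Sum>w\<leftarrow>map (dil a) ws. norm w) = a * ?s"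
      unfolding map using a by (simp add: o_def sum_list_const_mult)
    have "a * ?s * K \<le> 1"
    proof -
      have "a * ?s * K = ?s / (\<bar>R\<bar> + 1)" using K(1) by (simp add: a_def)
      moreover have "?s \<le> \<bar>R\<bar> + 1" "0 < \<bar>R\<bar> + 1" using that(2) by linarith+
      ultimately show ?thesis by (simp add: divide_le_eq_1_pos)
    qed
    then have "norm (gprod (map (dil a) ws)) \<le> K * (a * ?s)"
      using K(2)[of "map (dil a) ws"] by (simp only: sum)
    then have "norm (dil a (gprod ws)) \<le> K * (a * ?s)" by (simp add: dil_gprod)
    then have "norm (dil (1 / a) (dil a (gprod ws))) \<le> K * (a * ?s) * B"
      using B order_trans[OF B(2)[of "dil a (gprod ws)"]] by (simp add: mult_right_mono)
    then show ?thesis using a by (simp add: dil_inverse mult_ac)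
  qed
  then show ?thesis using K(1) a B(1) by (intro exI[of _ "K * a * B"]) auto
qed

lemma gprod_bounded:
  "\<exists>C\<ge>0. \<forall>ws. set ws \<subseteq> V 1 \<longrightarrow> (\<Sum>w\<leftarrow>ws. norm w) \<le> R \<longrightarrow> norm (gprod ws) \<le> C"
proof -
  obtain C where C: "C \<ge> 0" "\<And>ws. set ws \<subseteq> V 1 \<Longrightarrow> (\<Sum>w\<leftarrow>ws. norm w) \<le> R \<Longrightarrow> norm (gprod ws) \<le> C * (\<Sum>w\<leftarrow>ws. norm w)"
    using gprod_norm_le[of R] by blast
  have "norm (gprod ws) \<le> C * \<bar>R\<bar>" if "set ws \<subseteq> V 1" "(\<Sum>w\<leftarrow>ws. norm w) \<le> R" for ws
    using C(2)[OF that] mult_left_mono[of "\<Sum>w\<leftarrow>ws. norm w" "\<bar>R\<bar>" C] C(1) that(2) by linarith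
  then show ?thesis using C(1) by (intro exI[of _ "C * \<bar>R\<bar>"]) auto
qed

text \<open>Appending \<open>w\<close> costs at most a constant times the length so far times
  \<open>norm w\<close>, by \<open>mult_second_order\<close>. These mixed terms sum to at most the
  square of the total length.\<close>

lemma gprod_second_order:
  "\<exists>C\<ge>0. \<forall>ws. set ws \<subseteq> V 1 \<longrightarrow> (\<Sum>w\<leftarrow>ws. norm w) \<le> R \<longrightarrow>
    norm (gprod ws - sum_list ws) \<le> C * (\<Sum>w\<leftarrow>ws. norm w)\<^sup>2"
proof -
  obtain K where K: "K \<ge> 0" "\<And>ws. set ws \<subseteq> V 1 \<Longrightarrow> (\<Sum>w\<leftarrow>ws. norm w) \<le> R \<Longrightarrow> norm (gprod ws) \<le> K * (\<Sum>w\<leftarrow>ws. norm w)"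
    using gprod_norm_le[of R] by blast
  obtain C where C: "C \<ge> 0" "\<And>x w. norm x \<le> max (K * R) R \<Longrightarrow> norm w \<le> max (K * R) R \<Longrightarrow>
      norm (x \<otimes> w - x - w) \<le> C * norm x * norm w"
    using mult_second_order[of "max (K * R) R"] by blast
  have "norm (gprod ws - sum_list ws) \<le> C * K * (\<Sum>w\<leftarrow>ws. norm w)\<^sup>2"
    if "set ws \<subseteq> V 1" "(\<Sum>w\<leftarrow>ws. norm w) \<le> R" for ws
    using that
  proof (induction ws rule: rev_induct)
    case (snoc w ws)
    let ?s = "\<Sum>w\<leftarrow>ws. norm w"
    have s: "0 \<le> ?s" by (intro sum_list_nonneg) auto
    have "?s + norm w \<le> R" using snoc.prems(2) by simp
    then have sR: "?s \<le> R" "norm w \<le> R" using s norm_ge_zero[of w] by linarith+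
    have p: "norm (gprod ws) \<le> K * ?s" using K(2) snoc.prems(1) sR by simp
    moreover have "K * ?s \<le> K * R" using sR K(1) by (intro mult_left_mono)
    ultimately have "norm (gprod ws \<otimes> w - gprod ws - w) \<le> C * norm (gprod ws) * norm w"
      using sR by (intro C(2)) auto
    also have "\<dots> \<le> C * (K * ?s) * norm w"
      using p C(1) by (intro mult_right_mono mult_left_mono) auto
    finally have 1: "norm (gprod ws \<otimes> w - gprod ws - w) \<le> C * (K * ?s) * norm w" .
    have 2: "norm (gprod ws - sum_list ws) \<le> C * K * ?s\<^sup>2"
      using snoc.IH snoc.prems sR by simp
    have eq: "gprod (ws @ [w]) - sum_list (ws @ [w]) = (gprod ws \<otimes> w - gprod ws - w) + (gprod ws - sum_list ws)"
      by simp
    have "norm (gprod (ws @ [w]) - sum_list (ws @ [w])) \<le> C * (K * ?s) * norm w + C * K * ?s\<^sup>2"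
      unfolding eq by (rule norm_triangle_mono[OF 1 2])
    also have "\<dots> \<le> C * K * (?s + norm w)\<^sup>2"
    proof -
      have "?s * norm w + ?s\<^sup>2 \<le> (?s + norm w)\<^sup>2"
        using s by (simp add: power2_eq_square algebra_simps)
      then have "C * K * (?s * norm w + ?s\<^sup>2) \<le> C * K * (?s + norm w)\<^sup>2"
        using C(1) K(1) by (intro mult_left_mono) auto
      then show ?thesis by (simp add: algebra_simps)
    qed
    finally show ?case by simp
  qed simp
  then show ?thesis using C(1) K(1) by (intro exI[of _ "C * K"]) auto
qed

end

section \<open>Horizontal length and accessibility\<close>

locale inner_product_subspace =
  fixes H :: "'a::euclidean_space set" and ip :: "'a \<Rightarrow> 'a \<Rightarrow> real"
  assumes subspace_H: "subspace H" and inner_product_on: "inner_product_on H ip"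
begin

lemma ip_commute: "x \<in> H \<Longrightarrow> y \<in> H \<Longrightarrow> ip x y = ip y x"
  and ip_add_left: "x \<in> H \<Longrightarrow> y \<in> H \<Longrightarrow> z \<in> H \<Longrightarrow> ip (x + y) z = ip x z + ip y z"
  and ip_scaleR_left: "x \<in> H \<Longrightarrow> y \<in> H \<Longrightarrow> ip (c *\<^sub>R x) y = c * ip x y"
  and ip_pos: "x \<in> H \<Longrightarrow> x \<noteq> 0 \<Longrightarrow> 0 < ip x x"
  using inner_product_on unfolding inner_product_on_def by blast+

lemma ip_0_left: "y \<in> H \<Longrightarrow> ip 0 y = 0"
  using ip_scaleR_left[of y y 0] by simp

lemma ip_sum_left:
  assumes "\<And>a. a \<in> A \<Longrightarrow> f a \<in> H" "y \<in> H"
  shows "ip (\<Sum>a\<in>A. f a) y = (\<Sum>a\<in>A. ip (f a) y)"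
  using assms
proof (induction A rule: infinite_finite_induct)
  case (insert a A)
  then have "(\<Sum>a\<in>A. f a) \<in> H" by (intro subspace_sum[OF subspace_H]) auto
  with insert show ?case by (simp add: ip_add_left)
qed (simp_all add: ip_0_left)

lemma ip_orthonormal_sum:
  assumes "finite B" "B \<subseteq> H" "\<And>b c. b \<in> B \<Longrightarrow> c \<in> B \<Longrightarrow> ip b c = (if b = c then 1 else 0)" "c \<in> B"
  shows "ip (\<Sum>b\<in>B. u b *\<^sub>R b) c = u c"
proof -
  have "ip (\<Sum>b\<in>B. u b *\<^sub>R b) c = (\<Sum>b\<in>B. u b * ip b c)"
    using assms(2,4) subspace_scale[OF subspace_H]
    by (subst ip_sum_left) (auto simp: ip_scaleR_left subset_iff intro!: sum.cong)
  also have "\<dots> = (\<Sum>b\<in>B. if b = c then u b else 0)"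
    using assms(3,4) by (intro sum.cong) auto
  finally show ?thesis using assms(1,4) by simp
qed

lemma orthonormal_independent:
  assumes "finite B" "B \<subseteq> H" "\<And>b c. b \<in> B \<Longrightarrow> c \<in> B \<Longrightarrow> ip b c = (if b = c then 1 else 0)"
  shows "independent B"
proof -
  have "u x = 0" if "(\<Sum>x\<in>B. u x *\<^sub>R x) = 0" "x \<in> B" for u x
    using ip_orthonormal_sum[OF assms \<open>x \<in> B\<close>, of u] ip_0_left[of x] assms(2) that by auto
  then show ?thesis unfolding dependent_finite[OF assms(1)] by blast
qed

text \<open>An orthonormal set of maximal size spans: otherwise one Gram-Schmidt step would enlarge
  it.\<close>

lemma orthonormal_basis_exists: "\<exists>B. finite B \<and> orthonormal_basis H ip B"
proof -
  define P where "P B \<longleftrightarrow> finite B \<and> B \<subseteq> H \<and> (\<forall>b\<in>B. \<forall>c\<in>B. ip b c = (if b = c then 1 else 0))" for B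
  have P_ind: "independent B" if "P B" for B
    using that unfolding P_def by (intro orthonormal_independent) auto
  have "\<exists>k. (\<exists>B. P B \<and> card B = k) \<and> (\<forall>y. (\<exists>B. P B \<and> card B = y) \<longrightarrow> y \<le> k)"
  proof (rule Nat.ex_has_greatest_nat)
    show "\<exists>B. P B \<and> card B = 0" by (rule exI[of _ "{}"]) (simp add: P_def)
    show "\<forall>y. (\<exists>B. P B \<and> card B = y) \<longrightarrow> y \<le> DIM('a)"
      using P_ind independent_bound by blast
  qed
  then obtain B where B: "P B" "\<And>C. P C \<Longrightarrow> card C \<le> card B" by auto
  have fin: "finite B" and BH: "B \<subseteq> H"
    and on: "\<And>b c. b \<in> B \<Longrightarrow> c \<in> B \<Longrightarrow> ip b c = (if b = c then 1 else 0)"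
    using B(1) by (auto simp: P_def)
  have "span B \<subseteq> H" using BH subspace_H by (rule span_minimal)
  moreover have "x \<in> span B" if x: "x \<in> H" for x
  proof (rule ccontr)
    assume notin: "x \<notin> span B"
    define p where "p = (\<Sum>b\<in>B. ip x b *\<^sub>R b)"
    have pB: "p \<in> span B" unfolding p_def by (intro span_sum span_scale span_base)
    then have pH: "p \<in> H" using \<open>span B \<subseteq> H\<close> by auto
    define y where "y = x + (-1) *\<^sub>R p"
    have yH: "y \<in> H" unfolding y_def by (intro subspace_add subspace_scale subspace_H x pH)
    have "y \<noteq> 0" using notin pB by (auto simp: y_def)
    then have pos: "0 < ip y y" using ip_pos[OF yH] by simp
    have yc: "ip y c = 0" if c: "c \<in> B" for c
    proof -
      have cH: "c \<in> H" using c BH by auto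
      have "ip y c = ip x c + ip ((-1) *\<^sub>R p) c"
        unfolding y_def by (intro ip_add_left x cH subspace_scale subspace_H pH)
      also have "ip ((-1) *\<^sub>R p) c = (-1) * ip p c" by (rule ip_scaleR_left[OF pH cH])
      also have "ip p c = ip x c" unfolding p_def by (rule ip_orthonormal_sum[OF fin BH on c])
      finally show ?thesis by simp
    qed
    define e where "e = (1 / sqrt (ip y y)) *\<^sub>R y"
    have eH: "e \<in> H" unfolding e_def by (intro subspace_scale subspace_H yH)
    have ec: "ip e c = 0" if "c \<in> B" for c
      using that BH yH by (auto simp: e_def ip_scaleR_left yc)
    have ee: "ip e e = 1"
    proof -
      have "ip e e = (1 / sqrt (ip y y)) * ip y e"
        using yH eH by (subst e_def) (simp add: ip_scaleR_left)
      also have "ip y e = ip e y" using ip_commute yH eH by blast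
      also have "\<dots> = (1 / sqrt (ip y y)) * ip y y" unfolding e_def by (rule ip_scaleR_left[OF yH yH])
      finally show ?thesis using pos by (simp add: field_simps)
    qed
    have "e \<notin> B" using ee ec by force
    have ce: "ip c e = 0" if "c \<in> B" for c
      using ip_commute[of c e] ec[OF that] that BH eH by auto
    have "P (insert e B)"
      unfolding P_def using fin BH eH on ee ec ce \<open>e \<notin> B\<close> by auto
    from B(2)[OF this] show False using \<open>e \<notin> B\<close> fin by simp
  qed
  ultimately have "span B = H" by auto
  then show ?thesis using fin BH on unfolding orthonormal_basis_def by blast
qed

text \<open>An orthonormal basis of \<open>H\<close> is sent injectively into the standard basis.
  Afterwards \<open>ip\<close> can be handled through the ambient norm and inner product, composed
  with a linear map that is defined on the whole space.\<close>

lemma isometry_exists: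
  assumes "finite B" "orthonormal_basis H ip B"
  shows "\<exists>\<phi>::'a \<Rightarrow> 'a. linear \<phi> \<and> (\<forall>x\<in>H. \<forall>y\<in>H. ip x y = \<phi> x \<bullet> \<phi> y)
    \<and> (\<forall>x\<in>H. \<phi> x \<bullet> \<phi> x = (\<Sum>b\<in>B. (ip x b)\<^sup>2))"
proof -
  have B: "B \<subseteq> H" "span B = H" and on: "\<And>b c. b \<in> B \<Longrightarrow> c \<in> B \<Longrightarrow> ip b c = (if b = c then 1 else 0)"
    using assms(2) by (auto simp: orthonormal_basis_def)
  have ind: "independent B" by (rule orthonormal_independent[OF assms(1) B(1) on])
  have "card B \<le> card (Basis :: 'a set)" using independent_bound[OF ind] by simp
  then obtain \<sigma> where \<sigma>: "inj_on \<sigma> B" "\<sigma> ` B \<subseteq> (Basis :: 'a set)"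
    using inj_on_iff_card_le[OF assms(1) finite_Basis] by blast
  obtain \<phi> where \<phi>: "linear \<phi>" "\<forall>b\<in>B. \<phi> b = \<sigma> b"
    using linear_independent_extend[OF ind, of \<sigma>] by blast
  have rep: "x = (\<Sum>b\<in>B. ip x b *\<^sub>R b)" if x: "x \<in> H" for x
  proof -
    obtain u where u: "x = (\<Sum>b\<in>B. u b *\<^sub>R b)"
      using x B(2) span_finite[OF assms(1)] by auto
    have "ip x b = u b" if "b \<in> B" for b
      unfolding u by (rule ip_orthonormal_sum[OF assms(1) B(1) on that])
    then show ?thesis using u by simp
  qed
  have \<sigma>\<sigma>: "\<sigma> b \<bullet> \<sigma> c = (if b = c then 1 else 0)" if "b \<in> B" "c \<in> B" for b c
  proof -
    have "\<sigma> b \<in> Basis" "\<sigma> c \<in> Basis" "\<sigma> b = \<sigma> c \<longleftrightarrow> b = c"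
      using that \<sigma> by (auto simp: inj_on_def)
    then show ?thesis by (simp add: inner_Basis)
  qed
  have ip: "ip x y = (\<Sum>b\<in>B. ip x b * ip y b)" if "x \<in> H" "y \<in> H" for x y
  proof -
    have "ip (\<Sum>b\<in>B. ip x b *\<^sub>R b) y = (\<Sum>b\<in>B. ip x b * ip b y)"
      using that B(1) subspace_scale[OF subspace_H]
      by (subst ip_sum_left) (auto simp: ip_scaleR_left subset_iff intro!: sum.cong)
    moreover have "ip b y = ip y b" if "b \<in> B" for b
      using ip_commute \<open>y \<in> H\<close> B(1) that by blast
    ultimately show ?thesis using rep[OF that(1)] by simp
  qed
  have dot: "\<phi> x \<bullet> \<phi> y = (\<Sum>b\<in>B. ip x b * ip y b)" if "x \<in> H" "y \<in> H" for x y
  proof -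
    have \<phi>': "\<phi> x = (\<Sum>b\<in>B. ip x b *\<^sub>R \<sigma> b)" if "x \<in> H" for x
      by (subst rep[OF that]) (simp add: linear_sum[OF \<phi>(1)] linear_scale[OF \<phi>(1)] \<phi>(2))
    have "\<phi> x \<bullet> \<phi> y = (\<Sum>b\<in>B. \<Sum>c\<in>B. ip x c * (ip y b * (\<sigma> c \<bullet> \<sigma> b)))"
      unfolding \<phi>'[OF that(1)] \<phi>'[OF that(2)]
      by (simp add: inner_sum_left inner_sum_right sum_distrib_left mult.assoc mult.left_commute)
    also have "\<dots> = (\<Sum>b\<in>B. \<Sum>c\<in>B. if c = b then ip x c * ip y b else 0)"
      by (intro sum.cong refl) (auto simp: \<sigma>\<sigma>)
    finally show ?thesis using assms(1) by simp
  qed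
  show ?thesis
    using \<phi>(1) by (intro exI[of _ \<phi>]) (auto simp: ip dot power2_eq_square)
qed

end

lemma has_vector_derivative_in_subspace:
  fixes f :: "real \<Rightarrow> 'a::euclidean_space"
  assumes "subspace W" "\<And>t. f t \<in> W" "(f has_vector_derivative D) (at t)"
  shows "D \<in> W"
proof -
  have "D \<bullet> n = 0" if n: "n \<in> orthogonal_comp W" for n
  proof -
    have "((\<lambda>t. f t \<bullet> n) has_vector_derivative D \<bullet> n) (at t)"
      by (rule bounded_linear.has_vector_derivative[OF bounded_linear_inner_left assms(3)])
    moreover have "f t \<bullet> n = 0" for t
      using n assms(2) by (auto simp: orthogonal_comp_def orthogonal_def)
    ultimately have "((\<lambda>t. 0) has_vector_derivative D \<bullet> n) (at t)" by simp
    from vector_derivative_unique_at[OF this has_vector_derivative_const] show ?thesis .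
  qed
  then have "D \<in> orthogonal_comp (orthogonal_comp W)"
    by (auto simp: orthogonal_comp_def orthogonal_def inner_commute)
  then show ?thesis using orthogonal_comp_self[OF assms(1)] by simp
qed

locale carnot_metric = carnot +
  fixes ip :: "'a \<Rightarrow> 'a \<Rightarrow> real"
  assumes inner_product_V1: "inner_product_on (V 1) ip"
begin

sublocale H: inner_product_subspace "V 1" ip
  using subspace_V1 inner_product_V1 by unfold_locales

definition onb :: "'a set" where
  "onb = (SOME B. finite B \<and> orthonormal_basis (V 1) ip B)"

lemma onb: "finite onb" "orthonormal_basis (V 1) ip onb"
  using someI_ex[OF H.orthonormal_basis_exists] unfolding onb_def[symmetric] by auto

definition isom :: "'a \<Rightarrow> 'a" where
  "isom = (SOME \<phi>. linear \<phi> \<and> (\<forall>x\<in>V 1. \<forall>y\<in>V 1. ip x y = \<phi> x \<bullet> \<phi> y)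
    \<and> (\<forall>x\<in>V 1. \<phi> x \<bullet> \<phi> x = (\<Sum>b\<in>onb. (ip x b)\<^sup>2)))"

lemma isom: "linear isom" "x \<in> V 1 \<Longrightarrow> y \<in> V 1 \<Longrightarrow> ip x y = isom x \<bullet> isom y"
  and norm_isom: "x \<in> V 1 \<Longrightarrow> (norm (isom x))\<^sup>2 = (\<Sum>b\<in>onb. (ip x b)\<^sup>2)"
  using someI_ex[OF H.isometry_exists[OF onb]] unfolding isom_def[symmetric]
  by (auto simp: power2_norm_eq_inner)

lemma norm_isom_eq: "x \<in> V 1 \<Longrightarrow> sqrt (ip x x) = norm (isom x)"
  by (simp add: isom norm_eq_sqrt_inner)

lemma isom_scaleR [simp]: "norm (isom (c *\<^sub>R x)) = \<bar>c\<bar> * norm (isom x)"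
  by (simp add: linear_scale[OF isom(1)])

lemma isom_uminus [simp]: "norm (isom (- x)) = norm (isom x)"
  by (simp add: linear_neg[OF isom(1)])

lemma isom_eq_0: "x \<in> V 1 \<Longrightarrow> isom x = 0 \<Longrightarrow> x = 0"
  using H.ip_pos[of x] isom(2)[of x x] by force

definition lc :: real where
  "lc = (SOME C. 0 < C \<and> (\<forall>x\<in>V 1. norm x \<le> C * norm (isom x)))"

lemma lc: "0 < lc" "x \<in> V 1 \<Longrightarrow> norm x \<le> lc * norm (isom x)"
proof -
  have "bounded_linear isom" using isom(1) linear_conv_bounded_linear by blast
  then obtain e where e: "e > 0" "\<forall>x\<in>V 1. e * norm x \<le> norm (isom x)"
    using injective_imp_isometric[OF closed_subspace[OF subspace_V1] subspace_V1, of isom] isom_eq_0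
    by (auto simp: mult.commute)
  have "norm x \<le> 1 / e * norm (isom x)" if "x \<in> V 1" for x
    using e that by (auto simp: field_simps)
  then have "\<exists>C>0. \<forall>x\<in>V 1. norm x \<le> C * norm (isom x)"
    using e(1) by (intro exI[of _ "1 / e"]) auto
  from someI_ex[OF this] show "0 < lc" "x \<in> V 1 \<Longrightarrow> norm x \<le> lc * norm (isom x)"
    unfolding lc_def[symmetric] by auto
qed

section \<open>Points reached by products of bounded horizontal length\<close>

definition len :: "'a list \<Rightarrow> real" where
  "len ws = (\<Sum>w\<leftarrow>ws. norm (isom w))"

lemma len_simps [simp]: "len [] = 0" "len (w # ws) = norm (isom w) + len ws"
  "len (xs @ ys) = len xs + len ys"
  by (simp_all add: len_def)

lemma len_nonneg: "0 \<le> len ws"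
  unfolding len_def by (intro sum_list_nonneg) auto

lemma sum_norm_le_len: "set ws \<subseteq> V 1 \<Longrightarrow> (\<Sum>w\<leftarrow>ws. norm w) \<le> lc * len ws"
  by (induction ws) (auto simp: distrib_left intro!: add_mono lc)

text \<open>A bound on the distance from the identity with an explicit witness in place of an
  infimum. Products add the bounds, inverses keep them and dilations scale them.\<close>

definition reach :: "real \<Rightarrow> 'a \<Rightarrow> bool" where
  "reach L x \<longleftrightarrow> (\<exists>ws. set ws \<subseteq> V 1 \<and> len ws \<le> L \<and> gprod ws = x)"

lemma reach_nonneg: "reach L x \<Longrightarrow> 0 \<le> L"
  unfolding reach_def using len_nonneg order_trans by blast

lemma reach_mono: "reach L x \<Longrightarrow> L \<le> L' \<Longrightarrow> reach L' x"
  unfolding reach_def using order_trans by blast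

lemma reach_0: "0 \<le> L \<Longrightarrow> reach L 0"
  unfolding reach_def by (intro exI[of _ "[]"]) auto

lemma reach_gprod: "set ws \<subseteq> V 1 \<Longrightarrow> reach (len ws) (gprod ws)"
  unfolding reach_def by blast

lemma reach_mult: "reach L x \<Longrightarrow> reach L' y \<Longrightarrow> reach (L + L') (x \<otimes> y)"
  unfolding reach_def by (metis (no_types, lifting) add_mono gprod_append le_sup_iff len_simps(3) set_append)

lemma reach_V1: "w \<in> V 1 \<Longrightarrow> reach (norm (isom w)) w"
  using reach_gprod[of "[w]"] by simp

lemma reach_uminus: "reach L x \<Longrightarrow> reach L (- x)"
proof -
  have "len (rev (map uminus ws)) = len ws" for ws by (induction ws) simp_all
  then show "reach L x \<Longrightarrow> reach L (- x)"
    unfolding reach_def uminus_gprod[symmetric]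
    by (metis (no_types, lifting) uminus_gprod image_subset_iff list.set_map set_rev subset_iff subspace_neg[OF subspace_V1])
qed

lemma reach_dil:
  assumes "0 \<le> a" "reach L x"
  shows "reach (a * L) (dil a x)"
proof -
  obtain ws where ws: "set ws \<subseteq> V 1" "len ws \<le> L" "gprod ws = x"
    using assms(2) unfolding reach_def by blast
  have map: "map (dil a) ws = map (\<lambda>w. a *\<^sub>R w) ws" using ws(1) by (auto simp: dil_V1)
  have "gprod (map (\<lambda>w. a *\<^sub>R w) ws) = dil a x"
    unfolding map[symmetric] using ws(3) dil_gprod[of a ws] by simp
  moreover have "len (map (\<lambda>w. a *\<^sub>R w) ws) = a * len ws"
    using assms(1) by (simp add: len_def o_def sum_list_const_mult)
  moreover have "set (map (\<lambda>w. a *\<^sub>R w) ws) \<subseteq> V 1"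
    using ws(1) subspace_scale[OF subspace_V1] by auto
  ultimately show ?thesis
    unfolding reach_def using mult_left_mono[OF ws(2) assms(1)] by metis
qed

lemma reach_bounded: "\<exists>C\<ge>0. \<forall>x. reach L x \<longrightarrow> norm x \<le> C"
proof -
  obtain C where C: "C \<ge> 0" "\<And>ws. set ws \<subseteq> V 1 \<Longrightarrow> (\<Sum>w\<leftarrow>ws. norm w) \<le> lc * L \<Longrightarrow> norm (gprod ws) \<le> C"
    using gprod_bounded[of "lc * L"] by blast
  have "norm x \<le> C" if x: "reach L x" for x
  proof -
    obtain ws where ws: "set ws \<subseteq> V 1" "len ws \<le> L" "gprod ws = x"
      using x unfolding reach_def by blast
    have "(\<Sum>w\<leftarrow>ws. norm w) \<le> lc * L"
      using sum_norm_le_len[OF ws(1)] mult_left_mono[OF ws(2), of lc] lc(1) by linarith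
    with C(2)[OF ws(1)] ws(3) show ?thesis by simp
  qed
  with C(1) show ?thesis by blast
qed

lemma reach_gprod_map:
  "(\<And>c. c \<in> set cs \<Longrightarrow> reach (l c) (g c)) \<Longrightarrow> reach (\<Sum>c\<leftarrow>cs. l c) (gprod (map g cs))"
  by (induction cs) (auto intro: reach_0 reach_mult)

section \<open>Accessibility: neighbourhoods of the identity are reached\<close>

definition conj_V1 :: "'a set" where
  "conj_V1 = {Ad (gprod ws) w | ws w. set ws \<subseteq> V 1 \<and> w \<in> V 1}"

text \<open>The span is invariant under \<open>Ad (t *\<^sub>R u)\<close> for horizontal
  \<open>u\<close>. Differentiating at \<open>t = 0\<close> stays inside the subspace, so it is
  closed under \<open>bil u\<close> and \<open>V_generated\<close> applies.\<close>

lemma span_conj_V1: "span conj_V1 = UNIV"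
proof (rule V_generated)
  show "V 1 \<subseteq> span conj_V1"
  proof
    fix w assume "w \<in> V 1"
    then have "Ad (gprod []) w \<in> conj_V1" unfolding conj_V1_def by (force intro: exI[of _ "[]"])
    then show "w \<in> span conj_V1" by (simp add: span_base)
  qed
  fix u v assume u: "u \<in> V 1" and v: "v \<in> span conj_V1"
  have "Ad (t *\<^sub>R u) v \<in> span conj_V1" for t
  proof -
    have "Ad (t *\<^sub>R u) x \<in> conj_V1" if x: "x \<in> conj_V1" for x
    proof -
      obtain ws w where ws: "set ws \<subseteq> V 1" "w \<in> V 1" "x = Ad (gprod ws) w"
        using x by (auto simp: conj_V1_def)
      then have "Ad (t *\<^sub>R u) x = Ad (gprod (t *\<^sub>R u # ws)) w" by (simp add: Ad_mult_left)
      then show ?thesis unfolding conj_V1_def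
        using ws u subspace_scale[OF subspace_V1] by (intro CollectI exI[of _ "t *\<^sub>R u # ws"] exI[of _ w]) auto
    qed
    then have "Ad (t *\<^sub>R u) ` conj_V1 \<subseteq> conj_V1" by auto
    then have "Ad (t *\<^sub>R u) ` span conj_V1 \<subseteq> span conj_V1"
      by (metis linear_span_image linear_Ad span_mono)
    then show ?thesis using v by auto
  qed
  then have "2 *\<^sub>R bil u v \<in> span conj_V1"
    using has_vector_derivative_in_subspace[OF subspace_span, where f="\<lambda>t. Ad (t *\<^sub>R u) v" and t=0]
      Ad_has_vector_derivative[OF has_vector_derivative_scaleR_id has_vector_derivative_const, of u v]
    by simp
  then have "(1/2) *\<^sub>R (2 *\<^sub>R bil u v) \<in> span conj_V1" by (rule span_scale)
  then show "bil u v \<in> span conj_V1" by simp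
qed simp

lemma reach_near_0: "\<exists>K. \<exists>\<eta>>0. \<forall>x. norm x < \<eta> \<longrightarrow> reach K x"
proof -
  obtain C where C: "C \<subseteq> conj_V1" "independent C" "conj_V1 \<subseteq> span C"
    using maximal_independent_subset by blast
  have spanC: "span C = UNIV"
    using span_minimal[OF C(3) subspace_span] span_conj_V1 by auto
  obtain cs where cs: "set cs = C" "distinct cs"
    using finite_distinct_list[OF finiteI_independent[OF C(2)]] by blast
  have "\<exists>\<psi>. \<forall>c. linear (\<psi> c) \<and> (\<forall>x\<in>C. \<psi> c x = (if x = c then 1 else (0::real)))"
    by (intro choice allI linear_independent_extend[OF C(2)])
  then obtain \<psi> where "\<forall>c. linear (\<psi> c) \<and> (\<forall>x\<in>C. \<psi> c x = (if x = c then 1 else (0::real)))" ..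
  then have \<psi>: "\<And>c. linear (\<psi> c)" "\<And>c x. x \<in> C \<Longrightarrow> \<psi> c x = (if x = c then 1 else (0::real))"
    by auto
  have bl: "bounded_linear (\<psi> c)" for c using \<psi>(1) linear_conv_bounded_linear by blast
  have expand: "(\<Sum>c\<leftarrow>cs. \<psi> c y *\<^sub>R c) = y" for y
  proof -
    have "(\<Sum>c\<in>C. \<psi> c y *\<^sub>R c) = y"
    proof (rule linear_eq_on[where B=C and f="\<lambda>y. \<Sum>c\<in>C. \<psi> c y *\<^sub>R c" and g="\<lambda>y. y"])
      show "linear (\<lambda>y. \<Sum>c\<in>C. \<psi> c y *\<^sub>R c)"
        by (intro linear_compose_sum linearI ballI)
          (auto simp: linear_add[OF \<psi>(1)] linear_scale[OF \<psi>(1)] scaleR_add_left)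
      show "(\<Sum>c\<in>C. \<psi> c b *\<^sub>R c) = b" if "b \<in> C" for b
      proof -
        have "(\<Sum>c\<in>C. \<psi> c b *\<^sub>R c) = (\<Sum>c\<in>C. if c = b then c else 0)"
          using that \<psi>(2) by (intro sum.cong) auto
        then show ?thesis using that finiteI_independent[OF C(2)] by simp
      qed
    qed (simp_all add: spanC linear_id[unfolded id_def])
    then show ?thesis using cs by (simp add: sum_list_distinct_conv_sum_set)
  qed
  \<comment> \<open>The endpoint map in coordinates with respect to a basis of conjugates of
    horizontal vectors. Its derivative at 0 is the identity, because the coordinates add up to the
    vector; the open mapping theorem used below then gives a neighbourhood of 0 in the image of the
    unit ball.\<close>
  define F where "F ds y = gprod (map (\<lambda>c. \<psi> c y *\<^sub>R c) ds)" for ds y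
  have F0: "F ds 0 = 0" for ds
    by (induction ds) (simp_all add: F_def linear_0[OF \<psi>(1)])
  have der: "(F ds has_derivative (\<lambda>y. \<Sum>c\<leftarrow>ds. \<psi> c y *\<^sub>R c)) (at 0)" for ds
  proof (induction ds)
    case (Cons c ds)
    have "((\<lambda>y. \<psi> c y *\<^sub>R c) has_derivative (\<lambda>y. \<psi> c y *\<^sub>R c)) (at 0)"
      by (intro bounded_linear_imp_has_derivative bounded_linear_compose[OF bounded_linear_scaleR_left bl])
    from has_derivative_mult[OF this Cons.IH]
    have "((\<lambda>y. \<psi> c y *\<^sub>R c \<otimes> F ds y) has_derivative
        (\<lambda>y. dm (0, 0) (\<psi> c y *\<^sub>R c, \<Sum>c\<leftarrow>ds. \<psi> c y *\<^sub>R c))) (at 0)"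
      by (simp add: F0 linear_0[OF \<psi>(1)])
    moreover have "dm (0, 0) (u, v) = u + v" for u v
      using dm_split[of "(0,0)" u v] by (simp add: dm_fst_0 dm_snd_0)
    ultimately show ?case by (simp add: F_def)
  qed (simp add: F_def)
  have cont: "continuous_on UNIV (F ds)" for ds
  proof (induction ds)
    case (Cons c ds)
    have "continuous_on UNIV (\<lambda>y. \<psi> c y *\<^sub>R c \<otimes> F ds y)"
      by (intro continuous_intros Cons linear_continuous_on[OF bl])
    then show ?case by (simp add: F_def)
  qed (simp add: F_def)
  have "F cs 0 \<in> interior (F cs ` ball 0 1)"
    by (rule sussmann_open_mapping[OF open_UNIV cont _ der, where g'="\<lambda>x. x"])
      (auto simp: expand o_def id_def)
  then obtain \<eta> where \<eta>: "\<eta> > 0" "ball 0 \<eta> \<subseteq> F cs ` ball 0 1"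
    unfolding mem_interior by (auto simp: F0)
  have "\<exists>l. \<forall>y\<in>ball 0 1. reach l (\<psi> c y *\<^sub>R c)" if c: "c \<in> C" for c
  proof -
    obtain ws w where ws: "set ws \<subseteq> V 1" "w \<in> V 1" "c = Ad (gprod ws) w"
      using C(1) c by (auto simp: conj_V1_def)
    obtain B where B: "B > 0" "\<And>x. norm (\<psi> c x) \<le> norm x * B"
      using bounded_linear.pos_bounded[OF bl] by blast
    \<comment> \<open>Conjugating by the product of \<open>ws\<close> costs its length twice. The
      coefficient of the horizontal vector in the middle is at most \<open>B\<close> on the unit
      ball.\<close>
    have "reach (len ws + B * norm (isom w) + len ws) (\<psi> c y *\<^sub>R c)" if "y \<in> ball 0 1" for y
    proof -
      have "\<bar>\<psi> c y\<bar> \<le> norm y * B" using B(2)[of y] by simp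
      also have "\<dots> \<le> 1 * B" using that B(1) by (intro mult_right_mono) auto
      finally have "\<bar>\<psi> c y\<bar> * norm (isom w) \<le> B * norm (isom w)" by (intro mult_right_mono) auto
      then have "reach (B * norm (isom w)) (\<psi> c y *\<^sub>R w)"
        using reach_V1[OF subspace_scale[OF subspace_V1 ws(2)], of "\<psi> c y"] reach_mono by simp
      then have "reach (len ws + B * norm (isom w) + len ws) (gprod ws \<otimes> (\<psi> c y *\<^sub>R w) \<otimes> - gprod ws)"
        using reach_gprod[OF ws(1)] by (intro reach_mult reach_uminus)
      then show ?thesis using ws(3) linear_scale[OF linear_Ad] by (simp add: Ad_def)
    qed
    then show ?thesis by blast
  qed
  then have "\<exists>l. \<forall>c\<in>C. \<forall>y\<in>ball 0 1. reach (l c) (\<psi> c y *\<^sub>R c)" by (intro bchoice) auto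
  then obtain l where l: "\<And>c y. c \<in> C \<Longrightarrow> y \<in> ball 0 1 \<Longrightarrow> reach (l c) (\<psi> c y *\<^sub>R c)" by blast
  have "reach (\<Sum>c\<leftarrow>cs. l c) x" if x: "norm x < \<eta>" for x
  proof -
    have "x \<in> F cs ` ball 0 1" using \<eta>(2) x by auto
    then obtain y where y: "y \<in> ball 0 1" "x = F cs y" by blast
    show ?thesis unfolding y(2) F_def using l y(1) cs(1) by (intro reach_gprod_map) auto
  qed
  with \<eta>(1) show ?thesis by blast
qed

text \<open>Dilation by \<open>a\<close> multiplies lengths by \<open>a\<close> and its inverse is
  bounded, so the one ball reached with length \<open>K\<close> yields a ball for every positive
  length.\<close>

lemma reach_small:
  assumes "\<epsilon> > 0"
  shows "\<exists>\<eta>>0. \<forall>x. norm x < \<eta> \<longrightarrow> reach \<epsilon> x"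
proof -
  obtain K \<eta> where K: "\<eta> > 0" "\<And>x. norm x < \<eta> \<Longrightarrow> reach K x" using reach_near_0 by blast
  have "K \<ge> 0" using K(2)[of 0] K(1) reach_nonneg by auto
  define a where "a = \<epsilon> / (K + 1)"
  have a: "a > 0" "a * K \<le> \<epsilon>" using assms \<open>K \<ge> 0\<close> by (auto simp: a_def field_simps)
  have "bounded_linear (dil (1 / a))" using linear_dil linear_conv_bounded_linear by blast
  then obtain B where B: "B > 0" "\<And>x. norm (dil (1 / a) x) \<le> norm x * B"
    using bounded_linear.pos_bounded by blast
  have "reach \<epsilon> x" if "norm x < \<eta> / B" for x
  proof -
    have "norm x * B < \<eta>" using that B(1) by (simp add: pos_less_divide_eq)
    then have "reach K (dil (1 / a) x)" using B(2)[of x] by (intro K(2)) linarith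
    then have "reach (a * K) (dil a (dil (1 / a) x))" using a(1) by (intro reach_dil) auto
    then show ?thesis using a reach_mono by (simp add: dil_inverse)
  qed
  then show ?thesis using K(1) B(1) by (intro exI[of _ "\<eta> / B"]) auto
qed

lemma reach_close:
  assumes "\<epsilon> > 0"
  shows "\<exists>\<eta>>0. \<forall>x y. norm x \<le> R \<longrightarrow> norm y \<le> R \<longrightarrow> norm (x - y) < \<eta> \<longrightarrow> reach \<epsilon> (- x \<otimes> y)"
proof -
  obtain \<eta> where \<eta>: "\<eta> > 0" "\<And>x. norm x < \<eta> \<Longrightarrow> reach \<epsilon> x" using reach_small[OF assms] by blast
  obtain C where C: "C \<ge> 0" "\<And>x x' y y'. norm x \<le> R \<Longrightarrow> norm x' \<le> R \<Longrightarrow> norm y \<le> R \<Longrightarrow> norm y' \<le> R \<Longrightarrow>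
      norm (x \<otimes> y - x' \<otimes> y') \<le> C * (norm (x - x') + norm (y - y'))"
    using mult_lipschitz[of R] by blast
  have "reach \<epsilon> (- x \<otimes> y)" if "norm x \<le> R" "norm y \<le> R" "norm (x - y) < \<eta> / (C + 1)" for x y
  proof (rule \<eta>(2))
    have "norm (- x \<otimes> y) \<le> C * norm (x - y)"
      using C(2)[of "-x" "-x" y x] that by (simp add: norm_minus_commute)
    also have "\<dots> \<le> (C + 1) * norm (x - y)" by (intro mult_right_mono) auto
    also have "\<dots> < \<eta>" using that(3) C(1) by (simp add: pos_less_divide_eq mult.commute)
    finally show "norm (- x \<otimes> y) < \<eta>" .
  qed
  then show ?thesis using \<eta>(1) C(1) by (intro exI[of _ "\<eta> / (C + 1)"]) auto
qed

lemma gprod_concat: "gprod (concat xss) = gprod (map gprod xss)"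
  by (induction xss) simp_all

text \<open>Cutting a product into many factors of almost equal length turns length into energy.\<close>

lemma reach_equal_factors:
  assumes "reach L x" "L < L'"
  shows "\<exists>K0. \<forall>k\<ge>K0. \<exists>ws. length ws = k \<and> set ws \<subseteq> V 1 \<and> (\<forall>w\<in>set ws. norm (isom w) \<le> L' / real k) \<and> gprod ws = x"
proof -
  obtain ws where ws: "set ws \<subseteq> V 1" "len ws \<le> L" "gprod ws = x"
    using assms(1) unfolding reach_def by blast
  define L1 where "L1 = (L + L') / 2"
  have L1: "0 < L1" "L < L1" "L1 < L'" using reach_nonneg[OF assms(1)] assms(2) by (auto simp: L1_def)
  define m where "m = length ws"
  \<comment> \<open>Chosen so that \<open>L1 / \<kappa> \<le> L' / k\<close> for
    \<open>\<kappa> = k - m\<close>: \<open>m\<close> of the \<open>k\<close> places are reserved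
    for rounding, and the gap between \<open>L1\<close> and \<open>L'\<close> makes up for
    them.\<close>
  define K0 where "K0 = m + 1 + nat \<lceil>L' * m / (L' - L1)\<rceil>"
  have "\<exists>vs. length vs = k \<and> set vs \<subseteq> V 1 \<and> (\<forall>w\<in>set vs. norm (isom w) \<le> L' / real k) \<and> gprod vs = x"
    if "k \<ge> K0" for k
  proof -
    define \<kappa> where "\<kappa> = k - m"
    have \<kappa>: "\<kappa> > 0" "real \<kappa> = real k - real m" "k > 0" using that by (auto simp: \<kappa>_def K0_def)
    have bound: "L1 / real \<kappa> \<le> L' / real k"
    proof -
      have "L' * m / (L' - L1) \<le> real k" using that unfolding K0_def by linarith
      then have "L' * m \<le> real k * (L' - L1)" using L1 by (simp add: pos_divide_le_eq)
      then have "L1 * real k \<le> L' * (real k - real m)" by (simp add: algebra_simps)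
      then have "L1 * real k \<le> L' * real \<kappa>" by (simp only: \<kappa>(2))
      then show ?thesis using \<kappa>(1,3) by (simp add: field_simps)
    qed
    \<comment> \<open>The number of equal pieces of \<open>w\<close>, each of length at most
      \<open>L1 / \<kappa>\<close>. Rounding up costs at most one piece per factor, so there are at
      most \<open>\<kappa> + m = k\<close> pieces; zero vectors pad the list later.\<close>
    define n where "n w = nat \<lceil>real \<kappa> * norm (isom w) / L1\<rceil>" for w
    have n: "real \<kappa> * norm (isom w) / L1 \<le> real (n w)" "real (n w) \<le> real \<kappa> * norm (isom w) / L1 + 1" for w
    proof -
      have "0 \<le> real \<kappa> * norm (isom w) / L1" using L1 by simp
      then show "real \<kappa> * norm (isom w) / L1 \<le> real (n w)" "real (n w) \<le> real \<kappa> * norm (isom w) / L1 + 1"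
        unfolding n_def by linarith+
    qed
    have n0: "w = 0" if "w \<in> V 1" "n w = 0" for w
    proof -
      have "real \<kappa> * norm (isom w) / L1 \<le> 0" using n(1)[of w] that(2) by simp
      then have "norm (isom w) \<le> 0" using \<kappa>(1) L1(1) by (simp add: divide_le_0_iff mult_le_0_iff)
      then show ?thesis using isom_eq_0 that(1) by simp
    qed
    define part where "part w = replicate (n w) ((1 / real (n w)) *\<^sub>R w)" for w
    have gpart: "gprod (part w) = w" if "w \<in> V 1" for w
      using n0[OF that] by (cases "n w = 0") (auto simp: part_def gprod_replicate)
    define us where "us = concat (map part ws)"
    have "map (gprod \<circ> part) ws = ws" using gpart ws(1) by (intro map_idI) auto
    then have "gprod us = x" using ws(3) by (simp add: us_def gprod_concat)
    have us_V1: "set us \<subseteq> V 1"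
      using ws(1) subspace_scale[OF subspace_V1] by (auto simp: us_def part_def)
    have us_le: "norm (isom u) \<le> L' / real k" if u: "u \<in> set us" for u
    proof -
      obtain w where w: "w \<in> set ws" "u = (1 / real (n w)) *\<^sub>R w" "n w \<noteq> 0"
        using u by (auto simp: us_def part_def)
      have "norm (isom w) / real (n w) \<le> L1 / real \<kappa>"
        using n(1)[of w] w(3) \<kappa>(1) L1(1) by (simp add: field_simps)
      then show ?thesis using bound w(2) by simp
    qed
    have "length us \<le> k"
    proof -
      have "real (length us) = (\<Sum>w\<leftarrow>ws. real (n w))"
        unfolding us_def by (induction ws) (simp_all add: part_def)
      also have "\<dots> \<le> (\<Sum>w\<leftarrow>ws. real \<kappa> / L1 * norm (isom w) + 1)"
        using n(2) by (intro sum_list_mono) (simp add: field_simps)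
      also have "\<dots> = real \<kappa> / L1 * len ws + real m"
        unfolding m_def len_def by (induction ws) (simp_all add: distrib_left)
      also have "\<dots> \<le> real \<kappa> / L1 * L1 + real m"
        using ws(2) L1 by (intro add_right_mono mult_left_mono) auto
      also have "\<dots> = real k" using L1 \<kappa> by simp
      finally show ?thesis by simp
    qed
    define vs where "vs = us @ replicate (k - length us) 0"
    have "L' / real k \<ge> 0" using L1 by simp
    then have "length vs = k \<and> set vs \<subseteq> V 1 \<and> (\<forall>w\<in>set vs. norm (isom w) \<le> L' / real k) \<and> gprod vs = x"
      using \<open>length us \<le> k\<close> us_V1 us_le \<open>gprod us = x\<close> subspace_0[OF subspace_V1]
      by (auto simp: vs_def gprod_replicate linear_0[OF isom(1)])
    then show ?thesis by blast
  qed
  then show ?thesis by blast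
qed

end

section \<open>Absolutely continuous paths\<close>

lemma sum_division_le_measure:
  fixes d :: "real set set"
  assumes "d division_of \<Union>d" "\<Union>d \<subseteq> T" "T \<in> lmeasurable"
  shows "(\<Sum>k\<in>d. Sup k - Inf k) \<le> measure lebesgue T"
proof -
  have k: "((\<lambda>x. 1::real) has_integral (Sup k - Inf k)) k" if kd: "k \<in> d" for k
  proof -
    obtain u v where "k = cbox u v" "k \<noteq> {}" using division_ofD(3,4)[OF assms(1) kd] by blast
    then show ?thesis using has_integral_const_real[of "1::real" u v] by simp
  qed
  have "((\<lambda>x. 1::real) has_integral (\<Sum>k\<in>d. Sup k - Inf k)) (\<Union>d)"
    by (rule has_integral_combine_division[OF assms(1) k])
  moreover have "((\<lambda>x. 1::real) has_integral measure lebesgue T) T"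
    using assms(3) lmeasurable_iff_integrable_on[of T] lmeasure_integral[of T]
    by (simp add: has_integral_integrable_integral)
  ultimately show ?thesis
    using has_integral_subset_le[OF assms(2)] by fastforce
qed

text \<open>The fundamental theorem in gauge form. It delivers the integrability of \<open>g\<close>
  together with the value, and through it the measurability of the Maurer-Cartan form later.\<close>

lemma absolutely_continuous_path_has_integral:
  fixes \<gamma> :: "real \<Rightarrow> 'a::euclidean_space"
  assumes ac: "absolutely_continuous_path \<gamma>" and N: "negligible N"
    and der: "\<And>t. t \<in> {0..1} - N \<Longrightarrow> (\<gamma> has_vector_derivative g t) (at t within {0..1})"
    and ab: "0 \<le> a" "a \<le> b" "b \<le> 1"
  shows "(g has_integral (\<gamma> b - \<gamma> a)) {a..b}"
proof -
  define h where "h t = (if t \<in> N then 0 else g t)" for t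
  have "(h has_integral (\<gamma> b - \<gamma> a)) (cbox a b)"
    unfolding has_integral
  proof (intro allI impI)
    fix e :: real assume "e > 0"
    define e1 where "e1 = e / (2 * (b - a + 1))"
    have e1: "e1 > 0" "e1 * (b - a) < e / 2" using \<open>e > 0\<close> ab by (auto simp: e1_def field_simps)
    from ac \<open>e > 0\<close> obtain \<delta> where \<delta>: "\<delta> > 0" "\<And>d. d division_of \<Union>d \<Longrightarrow> \<Union>d \<subseteq> {0..1} \<Longrightarrow>
        (\<Sum>k\<in>d. Sup k - Inf k) < \<delta> \<Longrightarrow> (\<Sum>k\<in>d. norm (\<gamma> (Sup k) - \<gamma> (Inf k))) < e / 2"
      unfolding absolutely_continuous_path_def by (meson half_gt_zero)
    have Nl: "N \<in> sets lebesgue" using N negligible_imp_sets by blast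
    obtain T where T: "open T" "N \<subseteq> T" "T - N \<in> lmeasurable" "emeasure lebesgue (T - N) < ennreal \<delta>"
      using sets_lebesgue_outer_open[OF Nl \<delta>(1)] by blast
    have "T = (T - N) \<union> N" using T(2) by auto
    then have Tm: "T \<in> lmeasurable" using T(3) negligible_imp_measurable[OF N] fmeasurable.Un by metis
    have Tle: "measure lebesgue T < \<delta>"
    proof -
      have "measure lebesgue T \<le> measure lebesgue (T - N) + measure lebesgue N"
        using measure_Un_le[of "T - N" lebesgue N] T(3) Nl \<open>T = (T - N) \<union> N\<close> by (simp add: fmeasurableD)
      also have "measure lebesgue N = 0" using N by (simp add: negligible_imp_measure0)
      also have "measure lebesgue (T - N) < \<delta>"
        using T(3,4) \<delta>(1) by (simp add: emeasure_eq_measure2 fmeasurableD ennreal_less_iff)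
      finally show ?thesis by simp
    qed
    have "\<exists>r>0. t \<in> {0..1} - N \<longrightarrow> (\<forall>y\<in>{0..1}. \<bar>y - t\<bar> < r \<longrightarrow>
        norm (\<gamma> y - \<gamma> t - (y - t) *\<^sub>R g t) \<le> e1 * \<bar>y - t\<bar>)" for t
    proof (cases "t \<in> {0..1} - N")
      case True
      from der[OF True] show ?thesis
        unfolding has_vector_derivative_def has_derivative_within_alt
        using e1(1) by (auto simp: norm_minus_commute) 
    qed (auto intro: exI[of _ 1])
    then obtain r where r: "\<And>t. r t > 0" "\<And>t y. t \<in> {0..1} - N \<Longrightarrow> y \<in> {0..1} \<Longrightarrow> \<bar>y - t\<bar> < r t \<Longrightarrow>
        norm (\<gamma> y - \<gamma> t - (y - t) *\<^sub>R g t) \<le> e1 * \<bar>y - t\<bar>" by metis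
    \<comment> \<open>At a tag in the exceptional set the cell is forced into \<open>T\<close>, an
      open set of measure below \<open>\<delta>\<close>, so that absolute continuity bounds the
      increments there. Elsewhere the gauge is the radius on which the derivative approximates the
      path with slope error \<open>e1\<close>.\<close>
    define G where "G t = (if t \<in> N then T else ball t (r t))" for t
    have gauge_G: "gauge G" using T(1,2) r(1) by (auto simp: gauge_def G_def)
    have fine_G: "norm ((\<Sum>(x, k)\<in>D. measure lborel k *\<^sub>R h x) - (\<gamma> b - \<gamma> a)) < e"
      if D: "D tagged_division_of cbox a b" "G fine D" for D
    proof -
      note Dd = tagged_division_ofD[OF D(1)]
      have K: "\<exists>u v. k = {u..v} \<and> u \<le> x \<and> x \<le> v \<and> 0 \<le> u \<and> v \<le> 1 \<and> Sup k = v \<and> Inf k = u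
          \<and> measure lborel k = v - u \<and> k \<subseteq> G x" if xk: "(x, k) \<in> D" for x k
      proof -
        obtain u v where uv: "k = cbox u v" using Dd(4)[OF xk] by blast
        have x: "x \<in> k" and sub: "k \<subseteq> cbox a b" using Dd(2,3)[OF xk] by auto
        then have "u \<in> cbox a b" "v \<in> cbox a b" using uv by auto
        moreover have "k \<subseteq> G x" using D(2) xk by (auto simp: fine_def)
        ultimately show ?thesis using x uv ab by (intro exI[of _ u] exI[of _ v]) auto
      qed
      define F where "F x k = measure lborel k *\<^sub>R h x - (\<gamma> (Sup k) - \<gamma> (Inf k))" for x k
      define D1 where "D1 = {p \<in> D. fst p \<notin> N}"
      define D2 where "D2 = {p \<in> D. fst p \<in> N}"
      have fin: "finite D" "finite D1" "finite D2" using Dd(1) by (auto simp: D1_def D2_def)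
      have D12: "D = D1 \<union> D2" "D1 \<inter> D2 = {}" by (auto simp: D1_def D2_def)
      have "(\<Sum>(x, k)\<in>D. measure lborel k *\<^sub>R h x) - (\<gamma> b - \<gamma> a) = (\<Sum>(x, k)\<in>D. F x k)"
        using additive_tagged_division_1[of a b D \<gamma>] D(1) ab(2)
        by (simp add: F_def sum_subtractf case_prod_unfold)
      also have "\<dots> = (\<Sum>(x, k)\<in>D1. F x k) + (\<Sum>(x, k)\<in>D2. F x k)"
        unfolding D12(1) by (rule sum.union_disjoint[OF fin(2,3) D12(2)])
      finally have split: "norm ((\<Sum>(x, k)\<in>D. measure lborel k *\<^sub>R h x) - (\<gamma> b - \<gamma> a))
          \<le> norm (\<Sum>(x, k)\<in>D1. F x k) + norm (\<Sum>(x, k)\<in>D2. F x k)"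
        by (metis norm_triangle_ineq)
      have "norm (\<Sum>(x, k)\<in>D1. F x k) \<le> (\<Sum>(x, k)\<in>D1. e1 * measure lborel k)"
      proof (rule sum_norm_le, clarify)
        fix x k assume xk: "(x, k) \<in> D1"
        then have xk': "(x, k) \<in> D" "x \<notin> N" by (auto simp: D1_def)
        obtain u v where uv: "k = {u..v}" "u \<le> x" "x \<le> v" "0 \<le> u" "v \<le> 1" "Sup k = v" "Inf k = u"
          "measure lborel k = v - u" "k \<subseteq> G x" using K[OF xk'(1)] by blast
        have x01: "x \<in> {0..1} - N" using uv xk' by auto
        have "u \<in> G x" "v \<in> G x" using uv by auto
        then have "\<bar>u - x\<bar> < r x" "\<bar>v - x\<bar> < r x" using xk'(2) by (auto simp: G_def dist_real_def)
        then have 1: "norm (\<gamma> u - \<gamma> x - (u - x) *\<^sub>R g x) \<le> e1 * \<bar>u - x\<bar>"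
          and 2: "norm (\<gamma> v - \<gamma> x - (v - x) *\<^sub>R g x) \<le> e1 * \<bar>v - x\<bar>"
          using uv by (intro r(2)[OF x01]; simp)+
        have F: "F x k = (\<gamma> u - \<gamma> x - (u - x) *\<^sub>R g x) - (\<gamma> v - \<gamma> x - (v - x) *\<^sub>R g x)"
          using xk'(2) uv by (simp add: F_def h_def algebra_simps)
        have "norm (F x k) \<le> e1 * \<bar>u - x\<bar> + e1 * \<bar>v - x\<bar>"
          unfolding F by (intro order_trans[OF norm_triangle_ineq4] add_mono 1 2)
        also have "\<dots> = e1 * measure lborel k" using uv by (simp add: algebra_simps)
        finally show "norm (F x k) \<le> e1 * measure lborel k" .
      qed
      also have "\<dots> \<le> (\<Sum>(x, k)\<in>D. e1 * measure lborel k)"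
        using fin e1(1) by (intro sum_mono2) (auto simp: D1_def)
      also have "\<dots> = e1 * (b - a)"
        using additive_content_tagged_division[OF D(1)] ab(2)
        by (simp add: sum_distrib_left[symmetric] case_prod_unfold)
      finally have n1: "norm (\<Sum>(x, k)\<in>D1. F x k) \<le> e1 * (b - a)" .
      have part: "D2 tagged_partial_division_of cbox a b"
        using D(1) tagged_partial_division_subset[of D "cbox a b" D2]
        by (auto simp: D2_def tagged_division_of_def)
      note tag = tagged_partial_division_of_Union_self[OF part]
      let ?d = "snd ` D2"
      have div: "?d division_of \<Union>?d" by (rule division_of_tagged_division[OF tag])
      have sub: "\<Union>?d \<subseteq> T" "\<Union>?d \<subseteq> {0..1}"
      proof -
        have "k \<subseteq> T \<inter> {0..1}" if "(x, k) \<in> D2" for x k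
        proof -
          have "(x, k) \<in> D" "x \<in> N" using that by (auto simp: D2_def)
          then obtain u v where "k = {u..v}" "0 \<le> u" "v \<le> 1" "k \<subseteq> T"
            using K[of x k] unfolding G_def by auto
          then show ?thesis by auto
        qed
        then show "\<Union>?d \<subseteq> T" "\<Union>?d \<subseteq> {0..1}" by fastforce+
      qed
      have "(\<Sum>k\<in>?d. Sup k - Inf k) < \<delta>"
        using sum_division_le_measure[OF div sub(1) Tm] Tle by linarith
      then have "(\<Sum>k\<in>?d. norm (\<gamma> (Sup k) - \<gamma> (Inf k))) < e / 2" by (rule \<delta>(2)[OF div sub(2)])
      \<comment> \<open>Two tags can share a cell only if it is degenerate, and then its increment
        is 0. \<open>J\<close> is 0 on the empty set, where \<open>Sup\<close> and
        \<open>Inf\<close> carry no meaning.\<close>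
      moreover have "(\<Sum>(x, k)\<in>D2. norm (\<gamma> (Sup k) - \<gamma> (Inf k))) = (\<Sum>k\<in>?d. norm (\<gamma> (Sup k) - \<gamma> (Inf k)))"
      proof -
        define J where "J k = (if k = {} then 0 else norm (\<gamma> (Sup k) - \<gamma> (Inf k)))" for k
        have J: "J k = norm (\<gamma> (Sup k) - \<gamma> (Inf k))" if "(x, k) \<in> D2" for x k
          using that K[of x k] by (auto simp: J_def D2_def)
        have "(\<Sum>(x, k)\<in>D2. J k) = sum J ?d"
        proof (rule sum.over_tagged_division_lemma[OF tag])
          fix u v :: real assume "box u v = {}"
          then show "J (cbox u v) = 0" by (cases "u = v") (auto simp: box_real J_def)
        qed
        moreover have "(\<Sum>(x, k)\<in>D2. J k) = (\<Sum>(x, k)\<in>D2. norm (\<gamma> (Sup k) - \<gamma> (Inf k)))"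
          using J by (intro sum.cong) auto
        moreover have "sum J ?d = (\<Sum>k\<in>?d. norm (\<gamma> (Sup k) - \<gamma> (Inf k)))"
          using J by (intro sum.cong) auto
        ultimately show ?thesis by simp
      qed
      moreover have "norm (\<Sum>(x, k)\<in>D2. F x k) \<le> (\<Sum>(x, k)\<in>D2. norm (\<gamma> (Sup k) - \<gamma> (Inf k)))"
        by (rule sum_norm_le) (auto simp: D2_def F_def h_def norm_minus_commute)
      ultimately show ?thesis using split n1 e1(2) by linarith
    qed
    show "\<exists>\<gamma>'. gauge \<gamma>' \<and> (\<forall>\<D>. \<D> tagged_division_of cbox a b \<and> \<gamma>' fine \<D> \<longrightarrow>
        norm ((\<Sum>(x, k)\<in>\<D>. measure lborel k *\<^sub>R h x) - (\<gamma> b - \<gamma> a)) < e)"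
      by (rule exI[of _ G], intro conjI allI impI, rule gauge_G, elim conjE, rule fine_G)
  qed
  then show ?thesis
    using has_integral_spike[OF N, of "{a..b}" g h] by (simp add: h_def)
qed

lemma absolutely_continuous_path_uniform:
  assumes "absolutely_continuous_path \<gamma>" "e > 0"
  shows "\<exists>\<delta>>0. \<forall>s t. 0 \<le> s \<longrightarrow> s \<le> t \<longrightarrow> t \<le> 1 \<longrightarrow> t - s < \<delta> \<longrightarrow> norm (\<gamma> t - \<gamma> s) < e"
proof -
  obtain \<delta> where \<delta>: "\<delta> > 0" "\<And>d. d division_of \<Union>d \<Longrightarrow> \<Union>d \<subseteq> {0..1} \<Longrightarrow>
      (\<Sum>k\<in>d. Sup k - Inf k) < \<delta> \<Longrightarrow> (\<Sum>k\<in>d. norm (\<gamma> (Sup k) - \<gamma> (Inf k))) < e"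
    using assms unfolding absolutely_continuous_path_def by meson
  have "norm (\<gamma> t - \<gamma> s) < e" if "0 \<le> s" "s \<le> t" "t \<le> 1" "t - s < \<delta>" for s t
  proof -
    have "{{s..t}} division_of \<Union>{{s..t}}" using that division_of_self[of s t] by simp
    from \<delta>(2)[OF this] that show ?thesis by simp
  qed
  with \<delta>(1) show ?thesis by blast
qed

lemma absolutely_continuous_path_continuous:
  assumes "absolutely_continuous_path \<gamma>"
  shows "continuous_on {0..1} \<gamma>"
  unfolding continuous_on_iff
proof (intro ballI allI impI)
  fix x e :: real assume "x \<in> {0..1}" "e > 0"
  obtain \<delta> where \<delta>: "\<delta> > 0" "\<And>s t. 0 \<le> s \<Longrightarrow> s \<le> t \<Longrightarrow> t \<le> 1 \<Longrightarrow> t - s < \<delta> \<Longrightarrow> norm (\<gamma> t - \<gamma> s) < e"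
    using absolutely_continuous_path_uniform[OF assms \<open>e > 0\<close>] by blast
  have "dist (\<gamma> y) (\<gamma> x) < e" if "y \<in> {0..1}" "dist y x < \<delta>" for y
    using \<delta>(2)[of x y] \<delta>(2)[of y x] that \<open>x \<in> {0..1}\<close>
    by (cases "x \<le> y") (auto simp: dist_norm norm_minus_commute)
  then show "\<exists>d>0. \<forall>x'\<in>{0..1}. dist x' x < d \<longrightarrow> dist (\<gamma> x') (\<gamma> x) < e" using \<delta>(1) by blast
qed

lemma lipschitz_on_absolutely_continuous_path:
  fixes f :: "real \<Rightarrow> 'a::euclidean_space" and \<gamma> :: "real \<Rightarrow> 'b::euclidean_space"
  assumes ac: "absolutely_continuous_path \<gamma>"
    and f: "\<And>s t. s \<in> {0..1} \<Longrightarrow> t \<in> {0..1} \<Longrightarrow> norm (f t - f s) \<le> C * norm (\<gamma> t - \<gamma> s)" and "C \<ge> 0"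
  shows "absolutely_continuous_path f"
  unfolding absolutely_continuous_path_def
proof (intro allI impI)
  fix e :: real assume "e > 0"
  then have "e / (C + 1) > 0" using \<open>C \<ge> 0\<close> by simp
  then obtain \<delta> where \<delta>: "\<delta> > 0" "\<And>d. d division_of \<Union>d \<Longrightarrow> \<Union>d \<subseteq> {0..1} \<Longrightarrow>
      (\<Sum>k\<in>d. Sup k - Inf k) < \<delta> \<Longrightarrow> (\<Sum>k\<in>d. norm (\<gamma> (Sup k) - \<gamma> (Inf k))) < e / (C + 1)"
    using ac unfolding absolutely_continuous_path_def by meson
  have "(\<Sum>k\<in>d. norm (f (Sup k) - f (Inf k))) < e"
    if d: "d division_of \<Union>d" "\<Union>d \<subseteq> {0..1}" "(\<Sum>k\<in>d. Sup k - Inf k) < \<delta>" for d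
  proof -
    have "norm (f (Sup k) - f (Inf k)) \<le> C * norm (\<gamma> (Sup k) - \<gamma> (Inf k))" if k: "k \<in> d" for k
    proof -
      obtain u v where uv: "k = cbox u v" "k \<noteq> {}" using division_ofD(3,4)[OF d(1) k] by blast
      then have "u \<in> k" "v \<in> k" by auto
      then have "u \<in> {0..1}" "v \<in> {0..1}" using d(2) k by blast+
      then show ?thesis using f[of u v] uv by simp
    qed
    then have "(\<Sum>k\<in>d. norm (f (Sup k) - f (Inf k))) \<le> C * (\<Sum>k\<in>d. norm (\<gamma> (Sup k) - \<gamma> (Inf k)))"
      unfolding sum_distrib_left by (rule sum_mono)
    also have "\<dots> \<le> (C + 1) * (\<Sum>k\<in>d. norm (\<gamma> (Sup k) - \<gamma> (Inf k)))"
      by (intro mult_right_mono sum_nonneg) auto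
    also have "\<dots> < e" using \<delta>(2)[OF d] \<open>C \<ge> 0\<close> by (simp add: pos_less_divide_eq mult.commute)
    finally show ?thesis .
  qed
  with \<delta>(1) show "\<exists>\<delta>>0. \<forall>d. d division_of \<Union>d \<longrightarrow> \<Union>d \<subseteq> {0..1} \<longrightarrow> (\<Sum>k\<in>d. Sup k - Inf k) < \<delta> \<longrightarrow>
      (\<Sum>k\<in>d. norm (f (Sup k) - f (Inf k))) < e" by blast
qed

lemma absolutely_continuous_path_id: "absolutely_continuous_path (\<lambda>t. t)"
  unfolding absolutely_continuous_path_def
proof (intro allI impI)
  fix e :: real assume "e > 0"
  have *: "(\<Sum>k\<in>d. norm (Sup k - Inf k)) = (\<Sum>k\<in>d. Sup k - Inf k)" if d: "d division_of \<Union>d" for d :: "real set set"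
  proof (intro sum.cong refl)
    fix k assume k: "k \<in> d"
    obtain u v where "k = cbox u v" "k \<noteq> {}" using division_ofD(3,4)[OF d k] by blast
    then show "norm (Sup k - Inf k) = Sup k - Inf k" by simp
  qed
  show "\<exists>\<delta>>0. \<forall>d :: real set set. d division_of \<Union>d \<longrightarrow> \<Union>d \<subseteq> {0..1} \<longrightarrow> (\<Sum>k\<in>d. Sup k - Inf k) < \<delta> \<longrightarrow>
      (\<Sum>k\<in>d. norm (Sup k - Inf k)) < e"
  proof (rule exI[of _ e], intro conjI allI impI)
    fix d :: "real set set"
    assume "d division_of \<Union>d" "(\<Sum>k\<in>d. Sup k - Inf k) < e"
    then show "(\<Sum>k\<in>d. norm (Sup k - Inf k)) < e" by (simp only: *)
  qed fact
qed

lemma integral_in_subspace: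
  fixes f :: "'b::euclidean_space \<Rightarrow> 'a::euclidean_space"
  assumes "subspace W" "f integrable_on S" "\<And>x. x \<in> S \<Longrightarrow> f x \<in> W"
  shows "integral S f \<in> W"
proof -
  have "integral S f \<bullet> n = 0" if n: "n \<in> orthogonal_comp W" for n
  proof -
    have "integral S ((\<lambda>x. x \<bullet> n) \<circ> f) = integral S f \<bullet> n"
      by (rule integral_linear[OF assms(2) bounded_linear_inner_left])
    moreover have "integral S ((\<lambda>x. x \<bullet> n) \<circ> f) = integral S (\<lambda>x. 0)"
      using n assms(3) by (intro integral_cong) (auto simp: orthogonal_comp_def orthogonal_def)
    ultimately show ?thesis by simp
  qed
  then have "integral S f \<in> orthogonal_comp (orthogonal_comp W)"
    by (auto simp: orthogonal_comp_def orthogonal_def inner_commute)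
  then show ?thesis using orthogonal_comp_self[OF assms(1)] by simp
qed

lemma sum_integral_uniform_partition:
  fixes f :: "real \<Rightarrow> real"
  assumes "f integrable_on {0..1}" "k > 0" "m \<le> k"
  shows "(\<Sum>j<m. integral {real j / real k..real (Suc j) / real k} f) = integral {0..real m / real k} f"
  using assms(3)
proof (induction m)
  case (Suc m)
  have "real (Suc m) / real k \<le> 1" using Suc.prems assms(2) by simp
  then have "f integrable_on {0..real (Suc m) / real k}"
    by (intro integrable_on_subinterval[OF assms(1)]) auto
  then show ?case
    using Suc Henstock_Kurzweil_Integration.integral_combine[where a=0 and c="real m / real k" and b="real (Suc m) / real k" and f=f]
    by (simp add: divide_right_mono)
qed simp

section \<open>The Carnot-Caratheodory distance through products\<close>

context carnot_metric
begin

lemma vector_derivative_unit_interval: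
  fixes \<gamma> :: "real \<Rightarrow> 'a"
  assumes "t \<in> {0..1}" "(\<gamma> has_vector_derivative w) (at t within {0..1})"
  shows "vector_derivative \<gamma> (at t within {0..1}) = w"
  using vector_derivative_within_closed_interval[of 0 1 t \<gamma> w] assms by simp

lemma left_push_1: "left_push G x \<one> v = dm (x, 0) (0, v)"
  by (simp add: left_push_eq)

lemma maurer_cartan_eq:
  assumes "t \<in> {0..1}" "(\<gamma> has_vector_derivative dm (\<gamma> t, 0) (0, c)) (at t within {0..1})"
  shows "maurer_cartan G \<gamma> t = c"
  unfolding maurer_cartan_def
  by (simp add: vector_derivative_unit_interval[OF assms] left_push_eq dm_inverse)

text \<open>With a common bound on the factors, the path that spends time \<open>1 / k\<close> on
  each of them has speed at most \<open>L\<close> almost everywhere, which bounds its length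
  directly.\<close>

lemma cc_distance_le_equal_factors:
  assumes ws: "set ws \<subseteq> V 1" "length ws = k" "k > 0" "\<And>w. w \<in> set ws \<Longrightarrow> norm (isom w) \<le> L / real k"
    and x: "gprod ws = x"
  shows "cc_distance G (V 1) ip 0 x \<le> ennreal L"
proof -
  \<comment> \<open>The default 0 matters at \<open>t = 1\<close>, where the floor below equals
    \<open>k\<close>.\<close>
  define w where "w j = (if j < k then ws ! j else 0)" for j
  define P where "P j = gprod (take j ws)" for j
  \<comment> \<open>On the \<open>j\<close>-th interval it follows the one-parameter segment from
    \<open>P j\<close> to \<open>P (Suc j)\<close>.\<close>
  define \<gamma> where "\<gamma> t = P (nat \<lfloor>real k * t\<rfloor>) \<otimes> ((real k * t - real (nat \<lfloor>real k * t\<rfloor>)) *\<^sub>R w (nat \<lfloor>real k * t\<rfloor>))" for t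
  have w: "w j \<in> V 1" "norm (isom (w j)) \<le> L / real k" for j
  proof -
    have "norm (isom (hd ws)) \<le> L / real k" using ws by (intro ws(4)) auto
    then have "0 \<le> L / real k" using norm_ge_zero order_trans by blast
    then show "w j \<in> V 1" "norm (isom (w j)) \<le> L / real k"
      using ws subspace_0[OF subspace_V1] by (auto simp: w_def linear_0[OF isom(1)])
  qed
  have P_Suc: "P (Suc j) = P j \<otimes> w j" if "j < k" for j
    using that ws(2) by (simp add: P_def w_def take_Suc_conv_app_nth)
  have piece: "\<gamma> t = P j \<otimes> ((real k * t - real j) *\<^sub>R w j)"
    if "j < k" "t \<in> {real j / real k..real (Suc j) / real k}" for t j
  proof (cases "t = real (Suc j) / real k")
    case True
    then have kt: "real k * t = real (Suc j)" using \<open>k > 0\<close> by simp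
    then have floor: "nat \<lfloor>real k * t\<rfloor> = Suc j" by linarith
    show ?thesis unfolding \<gamma>_def floor using P_Suc[OF that(1)] kt by simp
  next
    case False
    then have "real j \<le> real k * t" "real k * t < real (Suc j)"
      using that \<open>k > 0\<close> by (auto simp: field_simps)
    then have "nat \<lfloor>real k * t\<rfloor> = j" by linarith
    then show ?thesis by (simp add: \<gamma>_def)
  qed
  have ends: "\<gamma> 0 = 0" "\<gamma> 1 = x"
    using x ws(2) by (simp_all add: \<gamma>_def P_def w_def)
  define R where "R = (\<Sum>j<k. norm (P j)) + (\<Sum>j<k. norm (w j))"
  have R: "norm (P j) \<le> R" "norm (w j) \<le> R" if "j < k" for j
    using that member_le_sum[of j "{..<k}" "\<lambda>j. norm (P j)"] member_le_sum[of j "{..<k}" "\<lambda>j. norm (w j)"]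
      sum_nonneg[of "{..<k}" "\<lambda>j. norm (P j)"] sum_nonneg[of "{..<k}" "\<lambda>j. norm (w j)"]
    by (auto simp: R_def)
  obtain C where C: "C \<ge> 0" "\<And>x x' y y'. norm x \<le> R \<Longrightarrow> norm x' \<le> R \<Longrightarrow> norm y \<le> R \<Longrightarrow> norm y' \<le> R \<Longrightarrow>
      norm (x \<otimes> y - x' \<otimes> y') \<le> C * (norm (x - x') + norm (y - y'))"
    using mult_lipschitz[of R] by blast
  have R0: "R \<ge> 0" unfolding R_def by (intro add_nonneg_nonneg sum_nonneg) auto
  define M where "M = C * (real k * R)"
  have M: "M \<ge> 0" using C R0 by (simp add: M_def)
  have "M-lipschitz_on {0..1} \<gamma>"
  proof (rule lipschitz_on_closed_Union[where I="{..<k}" and U="\<lambda>j. {real j / real k..real (Suc j) / real k}"])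
    fix j assume j: "j \<in> {..<k}"
    then have jk: "j < k" by simp
    show "M-lipschitz_on {real j / real k..real (Suc j) / real k} \<gamma>"
    proof (rule lipschitz_onI[OF _ M])
      fix s t assume st: "s \<in> {real j / real k..real (Suc j) / real k}" "t \<in> {real j / real k..real (Suc j) / real k}"
      have bd: "norm ((real k * s - real j) *\<^sub>R w j) \<le> R" if "s \<in> {real j / real k..real (Suc j) / real k}" for s
      proof -
        have "0 \<le> real k * s - real j" "real k * s - real j \<le> 1"
          using that \<open>k > 0\<close> by (auto simp: field_simps)
        then have "norm ((real k * s - real j) *\<^sub>R w j) \<le> 1 * norm (w j)"
          by (simp add: mult_left_le_one_le)
        then show ?thesis using R(2)[OF jk] by simp
      qed
      have "dist (\<gamma> s) (\<gamma> t) \<le> C * (norm (P j - P j) + norm ((real k * s - real j) *\<^sub>R w j - (real k * t - real j) *\<^sub>R w j))"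
        unfolding piece[OF jk st(1)] piece[OF jk st(2)] dist_norm
        using R(1)[OF jk] bd[OF st(1)] bd[OF st(2)] by (intro C(2))
      also have "(real k * s - real j) *\<^sub>R w j - (real k * t - real j) *\<^sub>R w j = (real k * (s - t)) *\<^sub>R w j"
        by (simp add: algebra_simps)
      also have "C * (norm (P j - P j) + norm ((real k * (s - t)) *\<^sub>R w j)) \<le> C * (real k * \<bar>s - t\<bar> * R)"
        using C(1) R(2)[OF jk] by (auto simp: abs_mult intro!: mult_left_mono)
      finally show "dist (\<gamma> s) (\<gamma> t) \<le> M * dist s t" by (simp add: M_def dist_real_def mult_ac)
    qed
  next
    show "{0..1} \<subseteq> (\<Union>j\<in>{..<k}. {real j / real k..real (Suc j) / real k})"
    proof
      fix t :: real assume t: "t \<in> {0..1}"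
      define j where "j = min (nat \<lfloor>real k * t\<rfloor>) (k - 1)"
      have kt: "0 \<le> real k * t" "real k * t \<le> real k" using t by (auto simp: mult_left_le)
      have "j < k" "real j \<le> real k * t" "real k * t \<le> real (Suc j)"
        using kt \<open>k > 0\<close> unfolding j_def by (simp_all add: min_def, linarith+)
      then show "t \<in> (\<Union>j\<in>{..<k}. {real j / real k..real (Suc j) / real k})"
        using \<open>k > 0\<close> by (auto simp: field_simps)
    qed
  qed (use M in auto)
  then have "norm (\<gamma> t - \<gamma> s) \<le> M * norm (t - s)" if "s \<in> {0..1}" "t \<in> {0..1}" for s t
    using that lipschitz_onD[of M "{0..1}" \<gamma> t s] by (simp add: dist_norm)
  then have ac: "absolutely_continuous_path \<gamma>"
    by (rule lipschitz_on_absolutely_continuous_path[OF absolutely_continuous_path_id _ M])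
  define E where "E = (\<lambda>j. real j / real k) ` {..k}"
  have der: "\<exists>j. (\<gamma> has_vector_derivative dm (\<gamma> t, 0) (0, real k *\<^sub>R w j)) (at t within {0..1})"
    if t: "t \<in> {0..1} - E" for t
  proof -
    define j where "j = nat \<lfloor>real k * t\<rfloor>"
    have kt: "0 \<le> real k * t" "real k * t \<le> real k" using t by (auto simp: mult_left_le)
    have ne: "real k * t \<noteq> real i" if "i \<le> k" for i
    proof
      assume "real k * t = real i"
      then have "t = real i / real k" using \<open>k > 0\<close> by (simp add: field_simps)
      then show False using t that by (auto simp: E_def)
    qed
    have j: "real j \<le> real k * t" "real k * t < real (Suc j)" using kt unfolding j_def by linarith+
    have "real k * t < real k" using kt(2) ne[OF order_refl] by linarith
    then have "j < k" using j(1) by linarith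
    then have "real j < real k * t" using j(1) ne[of j] by simp
    then have tj: "t \<in> {real j / real k<..<real (Suc j) / real k}"
      using j(2) \<open>k > 0\<close> by (auto simp: field_simps)
    have "((\<lambda>t. (real k * t - real j) *\<^sub>R w j) has_vector_derivative real k *\<^sub>R w j) (at t)"
      by (auto intro!: derivative_eq_intros)
    from has_vector_derivative_mult[OF has_vector_derivative_const this, of "P j"]
    have "((\<lambda>t. P j \<otimes> ((real k * t - real j) *\<^sub>R w j)) has_vector_derivative
        dm (P j, (real k * t - real j) *\<^sub>R w j) (0, real k *\<^sub>R w j)) (at t)" by simp
    \<comment> \<open>Left invariance (\<open>dm_chain\<close>) and the fact that a line follows its
      own left-invariant field (\<open>dm_self\<close>) show that the Maurer-Cartan form is constant
      on each segment.\<close>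
    also have "dm (P j, (real k * t - real j) *\<^sub>R w j) (0, real k *\<^sub>R w j) =
        dm (P j \<otimes> ((real k * t - real j) *\<^sub>R w j), 0) (0, real k *\<^sub>R w j)"
      using dm_chain[of "P j" "(real k * t - real j) *\<^sub>R w j" 0 "w j"] dm_scaleR[of _ "real k" 0 "w j"]
      by (simp add: dm_self)
    also have "P j \<otimes> ((real k * t - real j) *\<^sub>R w j) = \<gamma> t"
      using piece[OF \<open>j < k\<close>, of t] tj by simp
    finally have "((\<lambda>t. P j \<otimes> ((real k * t - real j) *\<^sub>R w j)) has_vector_derivative
        dm (\<gamma> t, 0) (0, real k *\<^sub>R w j)) (at t)" .
    then have "(\<gamma> has_vector_derivative dm (\<gamma> t, 0) (0, real k *\<^sub>R w j)) (at t)"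
      by (rule has_vector_derivative_transform_within_open[OF _ open_greaterThanLessThan tj])
        (use piece[OF \<open>j < k\<close>] in auto)
    then show ?thesis using has_vector_derivative_at_within by blast
  qed
  have "finite E" by (simp add: E_def)
  then have "AE t in lebesgue. t \<notin> E"
    by (intro AE_not_in) (simp add: negligible_finite negligible_iff_null_sets[symmetric])
  then have AE: "AE t in lebesgue_on {0..1}. t \<in> {0..1} - E"
    by (subst AE_restrict_space_iff) (auto elim: eventually_mono)
  have "horizontal_path G (V 1) \<gamma>"
    unfolding horizontal_path_def
  proof (intro conjI ac)
    show "AE t in lebesgue_on {0..1}. \<exists>w\<in>left_push G (\<gamma> t) \<one> ` V 1. (\<gamma> has_vector_derivative w) (at t within {0..1})"
      using AE
    proof eventually_elim
      case (elim t)
      then obtain j where "(\<gamma> has_vector_derivative dm (\<gamma> t, 0) (0, real k *\<^sub>R w j)) (at t within {0..1})"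
        using der by blast
      moreover have "real k *\<^sub>R w j \<in> V 1" using w subspace_scale[OF subspace_V1] by blast
      ultimately show ?case unfolding left_push_1 by blast
    qed
  qed
  moreover have "horizontal_length G ip \<gamma> \<le> ennreal L"
  proof -
    have "horizontal_length G ip \<gamma> \<le> (\<integral>\<^sup>+ t. ennreal L \<partial>lebesgue_on {0..1::real})"
      unfolding horizontal_length_def
    proof (rule nn_integral_mono_AE)
      show "AE t in lebesgue_on {0..1}. ennreal (sqrt (ip (maurer_cartan G \<gamma> t) (maurer_cartan G \<gamma> t))) \<le> ennreal L"
        using AE
      proof eventually_elim
        case (elim t)
        then obtain j where "(\<gamma> has_vector_derivative dm (\<gamma> t, 0) (0, real k *\<^sub>R w j)) (at t within {0..1})"
          using der by blast
        then have mc: "maurer_cartan G \<gamma> t = real k *\<^sub>R w j" using elim by (intro maurer_cartan_eq) auto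
        have "real k *\<^sub>R w j \<in> V 1" using w subspace_scale[OF subspace_V1] by blast
        then have "sqrt (ip (maurer_cartan G \<gamma> t) (maurer_cartan G \<gamma> t)) = real k * norm (isom (w j))"
          unfolding mc by (simp add: norm_isom_eq)
        also have "\<dots> \<le> real k * (L / real k)" using w(2) by (intro mult_left_mono) auto
        finally show ?case using \<open>k > 0\<close> by (intro ennreal_leI) simp
      qed
    qed
    also have "\<dots> = ennreal L"
      by (simp add: emeasure_restrict_space)
    finally show ?thesis .
  qed
  ultimately show ?thesis
    unfolding cc_distance_def using ends by (intro INF_lower2[of \<gamma>]) auto
qed

lemma cc_distance_le:
  assumes "reach L x"
  shows "cc_distance G (V 1) ip 0 x \<le> ennreal L"
proof (rule ennreal_le_epsilon)
  fix e :: real assume "e > 0"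
  then have "L < L + e" by simp
  from reach_equal_factors[OF assms this] obtain K0 where
    K0: "\<And>k. k \<ge> K0 \<Longrightarrow> \<exists>ws. length ws = k \<and> set ws \<subseteq> V 1 \<and> (\<forall>w\<in>set ws. norm (isom w) \<le> (L + e) / real k) \<and> gprod ws = x"
    by blast
  obtain ws where "length ws = Suc K0" "set ws \<subseteq> V 1" "\<forall>w\<in>set ws. norm (isom w) \<le> (L + e) / real (Suc K0)" "gprod ws = x"
    using K0[of "Suc K0"] by auto
  then have "cc_distance G (V 1) ip 0 x \<le> ennreal (L + e)"
    by (intro cc_distance_le_equal_factors[of ws "Suc K0"]) auto
  then show "cc_distance G (V 1) ip 0 x \<le> ennreal L + ennreal e"
    using \<open>e > 0\<close> reach_nonneg[OF assms] by simp
qed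

lemma gprod_increments:
  "gprod (map (\<lambda>j. - p j \<otimes> p (Suc j)) [i..<i + m]) = - p i \<otimes> p (i + m)"
proof (induction m)
  case (Suc m)
  have "p (i + m) \<otimes> (- p (i + m) \<otimes> p (Suc (i + m))) = p (Suc (i + m))" by simp
  then show ?case using Suc by (simp add: mult_assoc)
qed simp

text \<open>The group increments of \<open>\<gamma>\<close> over a partition multiply exactly to
  \<open>x\<close>. Each differs from the integral of the Maurer-Cartan form over its cell by a
  small multiple of the length of that cell, so the total error is a small multiple of the whole
  length, however many cells there are.\<close>

lemma horizontal_path_approx:
  assumes hor: "horizontal_path G (V 1) \<gamma>" "\<gamma> 0 = 0" "\<gamma> 1 = x"
    and len: "horizontal_length G ip \<gamma> < ennreal L" and "\<epsilon> > 0"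
  shows "\<exists>ws. set ws \<subseteq> V 1 \<and> ennreal (len ws) \<le> horizontal_length G ip \<gamma> \<and> norm (x - gprod ws) < \<epsilon>"
proof -
  have ac: "absolutely_continuous_path \<gamma>" using hor(1) by (simp add: horizontal_path_def)
  note cont = absolutely_continuous_path_continuous[OF ac]
  have "AE t in lebesgue_on {0..1}. \<exists>w\<in>left_push G (\<gamma> t) \<one> ` V 1. (\<gamma> has_vector_derivative w) (at t within {0..1})"
    using hor(1) by (simp add: horizontal_path_def)
  then obtain N where N: "{t \<in> space (lebesgue_on {0..1}). \<not> (\<exists>w\<in>left_push G (\<gamma> t) \<one> ` V 1. (\<gamma> has_vector_derivative w) (at t within {0..1}))} \<subseteq> N"
    "emeasure (lebesgue_on {0..1}) N = 0" "N \<in> sets (lebesgue_on {0..1})"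
    by (rule AE_E)
  have "N \<in> null_sets (lebesgue_on {0..1})" using N(2,3) by auto
  then have negN: "negligible N"
    by (simp add: null_sets_restrict_space negligible_iff_null_sets)
  \<comment> \<open>The value 0 on the exceptional set makes \<open>c\<close> horizontal at every
    time in the unit interval, so that its integrals are horizontal.\<close>
  define c where "c t = (if t \<in> N then 0 else maurer_cartan G \<gamma> t)" for t
  define g where "g t = dm (\<gamma> t, 0) (0, c t)" for t
  have c: "c t \<in> V 1 \<and> (\<gamma> has_vector_derivative g t) (at t within {0..1})" if t: "t \<in> {0..1} - N" for t
  proof -
    obtain v where v: "v \<in> V 1" "(\<gamma> has_vector_derivative dm (\<gamma> t, 0) (0, v)) (at t within {0..1})"
      using N(1) t unfolding left_push_1 by auto
    moreover have "maurer_cartan G \<gamma> t = v" using t by (intro maurer_cartan_eq v) auto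
    ultimately show ?thesis using t by (simp add: c_def g_def)
  qed
  have c_V1: "c t \<in> V 1" if "t \<in> {0..1}" for t
    using c[of t] that subspace_0[OF subspace_V1] by (cases "t \<in> N") (auto simp: c_def)
  have c_eq: "c t = dm (- \<gamma> t, \<gamma> t) (0, g t)" for t
    by (simp add: g_def dm_inverse)
  have ftc: "(g has_integral \<gamma> b - \<gamma> a) {a..b}" if "0 \<le> a" "a \<le> b" "b \<le> 1" for a b
    using absolutely_continuous_path_has_integral[OF ac negN] c that by blast
  have "g integrable_on {0..1}" using ftc[of 0 1] by auto
  then have gm: "g \<in> borel_measurable (lebesgue_on {0..1})" by (rule integrable_imp_measurable)
  \<comment> \<open>\<open>g\<close> is measurable because the fundamental theorem makes it
    integrable, and \<open>c\<close> is recovered from \<open>g\<close> by a differential that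
    depends continuously on \<open>\<gamma>\<close>.\<close>
  have cm: "c \<in> borel_measurable (lebesgue_on {0..1})"
  proof -
    have dm_b: "(\<lambda>t. dm (- \<gamma> t, \<gamma> t) (0, b)) \<in> borel_measurable (lebesgue_on {0..1})" for b
      by (intro continuous_imp_measurable_on_sets_lebesgue continuous_intros cont) auto
    have dm_sum: "dm p (0, v) = (\<Sum>b\<in>Basis. (v \<bullet> b) *\<^sub>R dm p (0, b))" for p v
    proof -
      have lin: "linear (\<lambda>v. dm p (0, v))"
        using dm_add[of p 0 0] dm_scaleR[of p _ 0] by (intro linearI) auto
      show ?thesis by (subst euclidean_representation[of v, symmetric])
        (simp add: linear_sum[OF lin] linear_scale[OF lin] del: euclidean_representation)
    qed
    have "c = (\<lambda>t. \<Sum>b\<in>Basis. (g t \<bullet> b) *\<^sub>R dm (- \<gamma> t, \<gamma> t) (0, b))"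
      by (rule ext, subst c_eq, rule dm_sum)
    moreover have "(\<lambda>t. \<Sum>b\<in>Basis. (g t \<bullet> b) *\<^sub>R dm (- \<gamma> t, \<gamma> t) (0, b)) \<in> borel_measurable (lebesgue_on {0..1})"
      using gm dm_b by (intro borel_measurable_sum borel_measurable_scaleR borel_measurable_inner) auto
    ultimately show ?thesis by (simp only:)
  qed
  let ?n = "\<lambda>t. norm (isom (c t))"
  have bl: "bounded_linear isom" using isom(1) linear_conv_bounded_linear by blast
  have isom_m: "isom \<in> borel_measurable borel"
    by (intro borel_measurable_continuous_onI linear_continuous_on bl)
  have nm: "(\<lambda>t. isom (c t)) \<in> borel_measurable (lebesgue_on {0..1})"
    using measurable_compose[OF cm isom_m] .
  have "AE t in lebesgue_on {0..1}. t \<notin> N" using N(2,3) by (intro AE_not_in) auto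
  moreover have "AE t in lebesgue_on {0..1}. t \<in> {0..1}" by (rule AE_I2) simp
  ultimately have AE: "AE t in lebesgue_on {0..1}. ennreal (sqrt (ip (maurer_cartan G \<gamma> t) (maurer_cartan G \<gamma> t))) = ennreal (?n t)"
  proof eventually_elim
    case (elim t)
    then show ?case using c_V1[of t] norm_isom_eq[of "c t"] by (simp add: c_def)
  qed
  have hl: "horizontal_length G ip \<gamma> = (\<integral>\<^sup>+ t. ennreal (?n t) \<partial>lebesgue_on {0..1})"
    unfolding horizontal_length_def by (rule nn_integral_cong_AE[OF AE])
  have "(\<integral>\<^sup>+ t. ennreal (norm (?n t)) \<partial>lebesgue_on {0..1}) < \<infinity>"
    using order.strict_trans[OF len ennreal_less_top] unfolding hl by simp
  then have int_n: "integrable (lebesgue_on {0..1}) ?n"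
    using nm by (intro integrableI_bounded) auto
  define l where "l = integral {0..1} ?n"
  have n_on: "?n integrable_on {0..1}"
    using int_n integrable_on_lebesgue_on by (simp add: integrable_on_lebesgue_on)
  have hl_eq: "horizontal_length G ip \<gamma> = ennreal l"
    unfolding hl l_def using nn_integral_eq_integral[OF int_n] lebesgue_integral_eq_integral[OF int_n] by simp
  have n_ge: "norm (c t) \<le> lc * ?n t" if "t \<in> {0..1}" for t using lc(2) c_V1[OF that] .
  have n_sub: "?n integrable_on {a..b}" if "0 \<le> a" "b \<le> 1" for a b
    using that by (intro integrable_on_subinterval[OF n_on]) auto
  have c_abs: "c absolutely_integrable_on {0..1}"
    using n_ge by (intro measurable_bounded_by_integrable_imp_absolutely_integrable[OF cm _ integrable_on_cmult_left[OF n_on, of lc]]) auto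
  then have c_on: "c integrable_on {0..1}" by (simp add: absolutely_integrable_on_def)
  have c_sub: "c integrable_on {a..b}" if "0 \<le> a" "b \<le> 1" for a b
    using that by (intro integrable_on_subinterval[OF c_on]) auto
  have "l \<ge> 0" unfolding l_def by (intro integral_nonneg n_on) auto
  have "bounded (\<gamma> ` {0..1})"
    by (intro compact_imp_bounded compact_continuous_image cont) simp
  then obtain R1 where R1: "\<And>t. t \<in> {0..1} \<Longrightarrow> norm (\<gamma> t) \<le> R1"
    unfolding bounded_iff by blast
  have R1_0: "R1 \<ge> 0" using R1[of 0] norm_ge_zero[of "\<gamma> 0"] by (simp add: hor(2))
  obtain C1 where C1: "C1 \<ge> 0" "\<And>x x' y y'. norm x \<le> R1 \<Longrightarrow> norm x' \<le> R1 \<Longrightarrow> norm y \<le> R1 \<Longrightarrow> norm y' \<le> R1 \<Longrightarrow>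
      norm (x \<otimes> y - x' \<otimes> y') \<le> C1 * (norm (x - x') + norm (y - y'))"
    using mult_lipschitz[of R1] by blast
  define R2 where "R2 = C1 * (R1 + R1)"
  have C1': "norm (- \<gamma> s \<otimes> \<gamma> t - - \<gamma> s \<otimes> \<gamma> u) \<le> C1 * norm (\<gamma> t - \<gamma> u)" if "s \<in> {0..1}" "t \<in> {0..1}" "u \<in> {0..1}" for s t u
    using C1(2)[of "- \<gamma> s" "- \<gamma> s" "\<gamma> t" "\<gamma> u"] R1 that by simp
  have R2: "norm (- \<gamma> s \<otimes> \<gamma> t) \<le> R2" if "s \<in> {0..1}" "t \<in> {0..1}" for s t
  proof -
    have "norm (- \<gamma> s \<otimes> \<gamma> t) \<le> C1 * norm (\<gamma> t - \<gamma> s)" using C1'[OF that(1,2,1)] by simp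
    also have "\<dots> \<le> R2" unfolding R2_def
      using norm_triangle_ineq4[of "\<gamma> t" "\<gamma> s"] R1[OF that(1)] R1[OF that(2)] C1(1) by (intro mult_left_mono) linarith+
    finally show ?thesis .
  qed
  obtain D where D: "D \<ge> 0" "\<And>x y v. norm x \<le> R2 \<Longrightarrow> norm y \<le> R2 \<Longrightarrow> norm (dm (x, y) (0, v) - v) \<le> D * norm x * norm v"
    using dm_snd_near_id[of R2] by blast
  obtain B where B: "B \<ge> 0" "\<And>ws. set ws \<subseteq> V 1 \<Longrightarrow> (\<Sum>w\<leftarrow>ws. norm w) \<le> lc * l \<Longrightarrow> norm (gprod ws) \<le> B"
    using gprod_bounded[of "lc * l"] by blast
  define R3 where "R3 = max R2 (max B (lc * l))"
  obtain C3 where C3: "C3 \<ge> 0" "\<And>gs hs. length gs = length hs \<Longrightarrow> (\<forall>g\<in>set gs. norm g \<le> R3) \<Longrightarrow> (\<forall>h\<in>set hs. norm h \<le> R3) \<Longrightarrow>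
    (\<forall>i. norm (gprod (take i hs)) \<le> R3) \<Longrightarrow> (\<forall>i. norm (gprod (drop i gs)) \<le> R3) \<Longrightarrow>
    norm (gprod gs - gprod hs) \<le> C3 * (\<Sum>(g, h)\<leftarrow>zip gs hs. norm (g - h))"
    using gprod_replace[of R3] by blast
  \<comment> \<open>Makes the final error \<open>C3 * D * C1 * lc * l * \<eta>\<close> smaller than
    \<open>\<epsilon>\<close>; the summand 1 keeps the denominator positive.\<close>
  define \<eta> where "\<eta> = \<epsilon> / (C3 * D * C1 * lc * l + 1)"
  have den: "C3 * D * C1 * lc * l \<ge> 0" using C3(1) D(1) C1(1) lc(1) \<open>l \<ge> 0\<close> by simp
  have \<eta>: "\<eta> > 0" using \<open>\<epsilon> > 0\<close> den by (simp add: \<eta>_def)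
  obtain \<delta> where \<delta>: "\<delta> > 0" "\<And>s t. 0 \<le> s \<Longrightarrow> s \<le> t \<Longrightarrow> t \<le> 1 \<Longrightarrow> t - s < \<delta> \<Longrightarrow> norm (\<gamma> t - \<gamma> s) < \<eta>"
    using absolutely_continuous_path_uniform[OF ac \<eta>] by blast
  obtain k0 where k0: "1 / \<delta> < real k0" using reals_Archimedean2 by blast
  define k where "k = Suc k0"
  have k: "k > 0" "1 / real k < \<delta>"
    using k0 \<delta>(1) by (auto simp: k_def field_simps)
  define p where "p j = real j / real k" for j
  have p: "p j \<in> {0..1}" if "j \<le> k" for j using that k(1) by (simp add: p_def)
  have p_less: "p j \<le> p (Suc j)" "p (Suc j) - p j < \<delta>" for j
    using k by (auto simp: p_def diff_divide_distrib[symmetric] divide_right_mono)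
  define w where "w j = integral {p j..p (Suc j)} c" for j
  define e where "e j = integral {p j..p (Suc j)} ?n" for j
  have w_V1: "w j \<in> V 1" if "j < k" for j
    unfolding w_def using that p[of j] p[of "Suc j"]
    by (intro integral_in_subspace[OF subspace_V1] c_sub c_V1) auto
  have w_le: "norm (isom (w j)) \<le> e j" if "j < k" for j
  proof -
    have cs: "c integrable_on {p j..p (Suc j)}" and ns: "?n integrable_on {p j..p (Suc j)}"
      using that p[of j] p[of "Suc j"] by (auto intro!: c_sub n_sub)
    have "isom (w j) = integral {p j..p (Suc j)} (isom \<circ> c)"
      unfolding w_def using integral_linear[OF cs bl] by simp
    also have "norm \<dots> \<le> e j" unfolding e_def
      by (rule Henstock_Kurzweil_Integration.integral_norm_bound_integral[OF integrable_linear[OF cs bl] ns]) simp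
    finally show ?thesis .
  qed
  have sum_e: "(\<Sum>j<k. e j) = l"
    unfolding e_def l_def p_def using sum_integral_uniform_partition[OF n_on k(1), of k] k(1) by simp
  have g_near: "norm (- \<gamma> (p j) \<otimes> \<gamma> (p (Suc j)) - w j) \<le> D * C1 * \<eta> * lc * e j" if j: "j < k" for j
  proof -
    define s where "s = p j"
    have s: "s \<in> {0..1}" and t1: "p (Suc j) \<le> 1" using p[of j] p[of "Suc j"] j by (auto simp: s_def)
    \<comment> \<open>The path seen from the left end of the cell. It starts at the identity and
      stays within \<open>C1 * \<eta>\<close> of it, where the differential of left translation is
      almost the identity, so its derivative is close to \<open>c\<close>.\<close>
    define h where "h t = - \<gamma> s \<otimes> \<gamma> t" for t
    have ach: "absolutely_continuous_path h"
      unfolding h_def using C1' s C1(1) by (intro lipschitz_on_absolutely_continuous_path[OF ac, of _ C1]) auto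
    have derh: "(h has_vector_derivative dm (h t, 0) (0, c t)) (at t within {0..1})" if "t \<in> {0..1} - N" for t
    proof -
      have "(h has_vector_derivative dm (- \<gamma> s, \<gamma> t) (0, g t)) (at t within {0..1})"
        unfolding h_def using has_vector_derivative_mult[OF has_vector_derivative_const] c[OF that] by blast
      then show ?thesis using dm_chain[of "- \<gamma> s" "\<gamma> t" 0 "c t"] by (simp add: g_def h_def)
    qed
    have "((\<lambda>t. dm (h t, 0) (0, c t)) has_integral h (p (Suc j)) - h s) {s..p (Suc j)}"
      using absolutely_continuous_path_has_integral[OF ach negN derh] s t1 p_less(1)[of j] by (simp add: s_def)
    moreover have "(c has_integral w j) {s..p (Suc j)}"
      unfolding w_def s_def[symmetric] using s t1 by (intro integrable_integral c_sub) auto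
    ultimately have hi: "((\<lambda>t. dm (h t, 0) (0, c t) - c t) has_integral (h (p (Suc j)) - h s - w j)) {s..p (Suc j)}"
      by (rule has_integral_diff)
    have "norm (h (p (Suc j)) - h s - w j) \<le> integral {s..p (Suc j)} (\<lambda>t. D * (C1 * \<eta>) * lc * ?n t)"
    proof (subst integral_unique[OF hi, symmetric], rule Henstock_Kurzweil_Integration.integral_norm_bound_integral)
      show "(\<lambda>t. D * (C1 * \<eta>) * lc * ?n t) integrable_on {s..p (Suc j)}"
        using integrable_on_cmult_left[OF n_sub[of s "p (Suc j)"], of "D * (C1 * \<eta>) * lc"] s t1 by simp
      fix t assume t: "t \<in> {s..p (Suc j)}"
      then have t01: "t \<in> {0..1}" using s t1 by auto
      have "norm (\<gamma> t - \<gamma> s) \<le> \<eta>" using \<delta>(2)[of s t] t s t01 p_less(2)[of j] by (simp add: s_def less_imp_le)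
      then have "norm (h t) \<le> C1 * \<eta>"
        using C1'[OF s t01 s] mult_left_mono[OF _ C1(1)] by (simp add: h_def) (meson order_trans)
      moreover have "norm (dm (h t, 0) (0, c t) - c t) \<le> D * norm (h t) * norm (c t)"
        using R2[OF s t01] R2[OF s s] by (intro D(2)) (auto simp: h_def)
      moreover have "D * norm (h t) * norm (c t) \<le> D * (C1 * \<eta>) * (lc * ?n t)"
        using calculation(1) n_ge[OF t01] D(1) C1(1) \<eta> by (intro mult_mono mult_left_mono) auto
      ultimately show "norm (dm (h t, 0) (0, c t) - c t) \<le> D * (C1 * \<eta>) * lc * ?n t" by (simp add: mult.assoc)
    qed (use hi in auto)
    then show ?thesis by (simp add: h_def s_def e_def mult_ac)
  qed
  define gs where "gs = map (\<lambda>j. - \<gamma> (p j) \<otimes> \<gamma> (p (Suc j))) [0..<k]"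
  define hs where "hs = map w [0..<k]"
  have gs_gprod: "gprod (drop i gs) = - \<gamma> (p i) \<otimes> \<gamma> (p k)" if "i \<le> k" for i
    using gprod_increments[of "\<lambda>j. \<gamma> (p j)" i "k - i"] that by (simp add: gs_def drop_map)
  have "gprod gs = x" using gs_gprod[of 0] k(1) hor by (simp add: p_def)
  have hs_V1: "set hs \<subseteq> V 1" using w_V1 by (auto simp: hs_def)
  have len_take: "len (take i hs) \<le> l" for i
  proof -
    have "len (take i hs) \<le> len (take i hs) + len (drop i hs)" using len_nonneg[of "drop i hs"] by simp
    also have "\<dots> = len hs" by (simp flip: len_simps(3))
    also have "\<dots> = (\<Sum>j<k. norm (isom (w j)))"
      by (simp add: len_def hs_def o_def interv_sum_list_conv_sum_set_nat atLeast0LessThan)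
    also have "\<dots> \<le> l" unfolding sum_e[symmetric] using w_le by (intro sum_mono) auto
    finally show ?thesis .
  qed
  have norm_take: "(\<Sum>w\<leftarrow>take i hs. norm w) \<le> lc * l" for i
  proof -
    have "set (take i hs) \<subseteq> V 1" using hs_V1 set_take_subset by fast
    then show ?thesis using sum_norm_le_len[of "take i hs"] mult_left_mono[OF len_take[of i], of lc] lc(1) by linarith
  qed
  have "norm (gprod gs - gprod hs) \<le> C3 * (\<Sum>(g, h)\<leftarrow>zip gs hs. norm (g - h))"
  proof (rule C3(2))
    show "length gs = length hs" by (simp add: gs_def hs_def)
    show "\<forall>g\<in>set gs. norm g \<le> R3"
      using R2 p by (auto simp: gs_def R3_def intro!: max.coboundedI1)
    show "\<forall>h\<in>set hs. norm h \<le> R3"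
    proof
      fix h assume "h \<in> set hs"
      then have "norm h \<le> (\<Sum>w\<leftarrow>hs. norm w)" by (intro member_le_sum_list) auto
      then show "norm h \<le> R3" using norm_take[of k] by (simp add: R3_def hs_def)
    qed
    show "\<forall>i. norm (gprod (take i hs)) \<le> R3"
    proof
      fix i have "set (take i hs) \<subseteq> V 1" using hs_V1 set_take_subset by fast
      then show "norm (gprod (take i hs)) \<le> R3" using B(2) norm_take by (simp add: R3_def le_max_iff_disj)
    qed
    show "\<forall>i. norm (gprod (drop i gs)) \<le> R3"
    proof
      fix i show "norm (gprod (drop i gs)) \<le> R3"
      proof (cases "i \<le> k")
        case True
        then show ?thesis using gs_gprod[OF True] R2[OF p[OF True] p[of k]] by (simp add: R3_def)
      next
        case False
        then show ?thesis using B(1) by (simp add: gs_def R3_def le_max_iff_disj)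
      qed
    qed
  qed
  also have "(\<Sum>(g, h)\<leftarrow>zip gs hs. norm (g - h)) = (\<Sum>j<k. norm (- \<gamma> (p j) \<otimes> \<gamma> (p (Suc j)) - w j))"
    by (simp add: gs_def hs_def zip_map_map zip_same_conv_map o_def interv_sum_list_conv_sum_set_nat atLeast0LessThan)
  also have "\<dots> \<le> (\<Sum>j<k. D * C1 * \<eta> * lc * e j)" using g_near by (intro sum_mono) auto
  also have "\<dots> = D * C1 * \<eta> * lc * l" by (simp add: sum_distrib_left[symmetric] sum_e)
  finally have "norm (x - gprod hs) \<le> C3 * (D * C1 * \<eta> * lc * l)"
    using C3(1) \<open>gprod gs = x\<close> by (simp add: mult_left_mono)
  also have "\<dots> = \<epsilon> * ((C3 * D * C1 * lc * l) / (C3 * D * C1 * lc * l + 1))"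
    by (simp add: \<eta>_def)
  also have "\<dots> < \<epsilon> * 1" using \<open>\<epsilon> > 0\<close> den by (intro mult_strict_left_mono) auto
  finally have "norm (x - gprod hs) < \<epsilon>" by simp
  moreover have "len hs \<le> l" using len_take[of k] by (simp add: hs_def)
  ultimately show ?thesis using hs_V1 hl_eq by (intro exI[of _ hs]) (auto intro: ennreal_leI)
qed

text \<open>The strict inequality leaves a length \<open>L - l\<close>, which pays for the
  correction from the approximating product to \<open>x\<close> itself.\<close>

lemma reach_of_cc_distance:
  assumes "cc_distance G (V 1) ip 0 x < ennreal L"
  shows "reach L x"
proof -
  obtain \<gamma> where \<gamma>: "horizontal_path G (V 1) \<gamma>" "\<gamma> 0 = 0" "\<gamma> 1 = x" "horizontal_length G ip \<gamma> < ennreal L"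
    using assms unfolding cc_distance_def INF_less_iff by auto
  obtain l where l: "horizontal_length G ip \<gamma> = ennreal l" "l \<ge> 0"
    using \<gamma>(4) by (cases "horizontal_length G ip \<gamma>") auto
  have "l < L" using \<gamma>(4) l by (simp add: ennreal_less_iff)
  obtain C where C: "C \<ge> 0" "\<And>x. reach l x \<Longrightarrow> norm x \<le> C" using reach_bounded[of l] by blast
  obtain \<eta> where \<eta>: "\<eta> > 0" "\<And>y z. norm y \<le> max C (norm x) \<Longrightarrow> norm z \<le> max C (norm x) \<Longrightarrow> norm (y - z) < \<eta> \<Longrightarrow> reach (L - l) (- y \<otimes> z)"
    using reach_close[of "L - l" "max C (norm x)"] \<open>l < L\<close> by auto
  obtain ws where ws: "set ws \<subseteq> V 1" "ennreal (len ws) \<le> ennreal l" "norm (x - gprod ws) < \<eta>"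
    using horizontal_path_approx[OF \<gamma> \<eta>(1)] l(1) by auto
  have "reach l (gprod ws)" using reach_gprod[OF ws(1)] ws(2) l(2) by (auto simp: ennreal_le_iff intro: reach_mono)
  moreover have "reach (L - l) (- gprod ws \<otimes> x)"
    using C(2)[OF calculation] ws(3) by (intro \<eta>(2)) (auto simp: norm_minus_commute)
  ultimately show ?thesis using reach_mult[of l "gprod ws" "L - l" "- gprod ws \<otimes> x"] by simp
qed

end

section \<open>Gaussian estimates\<close>

context prob_space
begin

text \<open>A condition on all coordinates of one \<open>X i\<close> is a condition on
  \<open>X i\<close> alone. Its probability factors first over \<open>i\<close>, by independence of
  the vectors, and then over the coordinates.\<close>

lemma indep_vars_pairs:
  fixes X :: "'i \<Rightarrow> 'a \<Rightarrow> 'b::topological_space" and f :: "'j \<Rightarrow> 'b \<Rightarrow> 'c::topological_space"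
  assumes X: "indep_vars (\<lambda>_. borel) X I" and fin: "finite B"
    and f: "\<And>b. b \<in> B \<Longrightarrow> f b \<in> borel_measurable borel"
    and ind: "\<And>i. i \<in> I \<Longrightarrow> indep_vars (\<lambda>_. borel) (\<lambda>b \<omega>. f b (X i \<omega>)) B"
  shows "indep_vars (\<lambda>_. borel) (\<lambda>(i, b) \<omega>. f b (X i \<omega>)) (I \<times> B)"
  unfolding indep_vars_def2
proof (intro conjI ballI)
  have Xm: "X i \<in> borel_measurable M" if "i \<in> I" for i
    using X that by (simp add: indep_vars_def2)
  have Zm: "(\<lambda>\<omega>. f b (X i \<omega>)) \<in> borel_measurable M" if "i \<in> I" "b \<in> B" for i b
    using measurable_compose[OF Xm[OF that(1)] f[OF that(2)]] .
  show "random_variable borel ((\<lambda>(i, b) \<omega>. f b (X i \<omega>)) ib)" if "ib \<in> I \<times> B" for ib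
    using that Zm by auto
  let ?Z = "\<lambda>(i, b) \<omega>. f b (X i \<omega>)"
  show "indep_sets (\<lambda>ib. {?Z ib -` A \<inter> space M |A. A \<in> sets borel}) (I \<times> B)"
    unfolding indep_sets_def
  proof (intro conjI ballI allI impI)
    show "{?Z ib -` A \<inter> space M |A. A \<in> sets borel} \<subseteq> events" if "ib \<in> I \<times> B" for ib
      using that measurable_sets[OF Zm] by auto
    fix J A assume J: "J \<subseteq> I \<times> B" "J \<noteq> {}" "finite J"
      and A: "A \<in> Pi J (\<lambda>ib. {?Z ib -` A \<inter> space M |A. A \<in> sets borel})"
    have "\<exists>S. \<forall>ib\<in>J. S ib \<in> sets borel \<and> A ib = ?Z ib -` S ib \<inter> space M"
      using A by (intro bchoice) (auto simp: Pi_iff)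
    then obtain S where "\<forall>ib\<in>J. S ib \<in> sets borel \<and> A ib = ?Z ib -` S ib \<inter> space M" ..
    then have S: "\<And>ib. ib \<in> J \<Longrightarrow> S ib \<in> sets borel" "\<And>ib. ib \<in> J \<Longrightarrow> A ib = ?Z ib -` S ib \<inter> space M"
      by blast+
    \<comment> \<open>Pairs outside \<open>J\<close> get the trivial condition, which fills the
      index set up to the rectangle \<open>K \<times> B\<close> without changing any
      probability.\<close>
    define T where "T ib = (if ib \<in> J then S ib else UNIV)" for ib
    have T: "T ib \<in> sets borel" for ib using S(1) by (simp add: T_def)
    define K where "K = fst ` J"
    have K: "K \<subseteq> I" "K \<noteq> {}" "finite K" using J by (auto simp: K_def)
    have B0: "B \<noteq> {}" using J by auto
    define C where "C i = (\<Inter>b\<in>B. f b -` T (i, b))" for i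
    have C: "C i \<in> sets borel" for i
      unfolding C_def using B0 fin measurable_sets[OF f T] by (intro sets.finite_INT) auto
    have "(\<Inter>ib\<in>J. A ib) = (\<Inter>i\<in>K. X i -` C i \<inter> space M)"
    proof -
      have "(\<Inter>ib\<in>J. A ib) = (\<Inter>ib\<in>J. ?Z ib -` S ib \<inter> space M)" using S(2) by (intro INF_cong) auto
      also have "\<dots> = (\<Inter>i\<in>K. X i -` C i \<inter> space M)"
        using J B0 unfolding K_def C_def T_def by (fastforce simp: split_beta split: if_splits)
      finally show ?thesis .
    qed
    then have "prob (\<Inter>ib\<in>J. A ib) = (\<Prod>i\<in>K. prob (X i -` C i \<inter> space M))"
      using indep_varsD[OF X K(2,3,1), of C] C by simp
    also have "\<dots> = (\<Prod>i\<in>K. \<Prod>b\<in>B. prob (?Z (i, b) -` T (i, b) \<inter> space M))"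
    proof (intro prod.cong refl)
      fix i assume "i \<in> K"
      then have i: "i \<in> I" using K by auto
      have "X i -` C i \<inter> space M = (\<Inter>b\<in>B. (\<lambda>\<omega>. f b (X i \<omega>)) -` T (i, b) \<inter> space M)"
        using B0 unfolding C_def by auto
      then show "prob (X i -` C i \<inter> space M) = (\<Prod>b\<in>B. prob (?Z (i, b) -` T (i, b) \<inter> space M))"
        using indep_varsD[OF ind[OF i] B0 fin subset_refl, of "\<lambda>b. T (i, b)"] T by simp
    qed
    also have "\<dots> = (\<Prod>ib\<in>K \<times> B. prob (?Z ib -` T ib \<inter> space M))"
      by (simp add: prod.cartesian_product case_prod_unfold)
    also have "\<dots> = (\<Prod>ib\<in>J. prob (?Z ib -` T ib \<inter> space M))"
    proof (rule prod.mono_neutral_right)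
      show "J \<subseteq> K \<times> B" using J by (force simp: K_def)
      show "\<forall>ib\<in>K \<times> B - J. prob (?Z ib -` T ib \<inter> space M) = 1"
        by (auto simp: T_def prob_space)
    qed (use K fin in auto)
    also have "\<dots> = (\<Prod>ib\<in>J. prob (A ib))"
      by (intro prod.cong refl) (simp add: S(2) T_def)
    finally show "prob (\<Inter>ib\<in>J. A ib) = (\<Prod>ib\<in>J. prob (A ib))" .
  qed
qed

lemma nn_integral_normal_density: "0 < \<sigma> \<Longrightarrow> (\<integral>\<^sup>+x. ennreal (normal_density \<mu> \<sigma> x) \<partial>lborel) = 1"
  using nn_integral_eq_integral[OF integrable_normal_density[of \<sigma> \<mu>]] integral_normal_density[of \<sigma> \<mu>] by simp

lemma std_normal_exp_square:
  assumes Y: "distributed M lborel Y std_normal_density" and s: "s < 1"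
  shows "(\<integral>\<^sup>+\<omega>. ennreal (exp (s * (Y \<omega>)\<^sup>2 / 2)) \<partial>M) = ennreal (1 / sqrt (1 - s))"
proof -
  \<comment> \<open>Multiplying the standard density by the exponential weight gives
    \<open>\<sigma>\<close> times a centred normal density of variance
    \<open>1 / (1 - s)\<close>.\<close>
  define \<sigma> where "\<sigma> = 1 / sqrt (1 - s)"
  have \<sigma>: "\<sigma> > 0" "\<sigma>\<^sup>2 = 1 / (1 - s)" using s by (auto simp: \<sigma>_def power_divide)
  have eq: "std_normal_density x * exp (s * x\<^sup>2 / 2) = \<sigma> * normal_density 0 \<sigma> x" for x
  proof -
    have "sqrt (2 * pi * \<sigma>\<^sup>2) = sqrt (2 * pi) * \<sigma>" using \<sigma>(1) by (simp add: real_sqrt_mult)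
    moreover have "- x\<^sup>2 / 2 + s * x\<^sup>2 / 2 = - x\<^sup>2 / (2 * \<sigma>\<^sup>2)"
      using s by (simp add: \<sigma>(2) field_simps)
    ultimately show ?thesis
      using \<sigma>(1) by (simp add: std_normal_density_def normal_density_def exp_add[symmetric] mult_exp_exp)
  qed
  have "(\<integral>\<^sup>+\<omega>. ennreal (exp (s * (Y \<omega>)\<^sup>2 / 2)) \<partial>M)
      = (\<integral>\<^sup>+x. ennreal (std_normal_density x) * ennreal (exp (s * x\<^sup>2 / 2)) \<partial>lborel)"
    by (rule distributed_nn_integral[OF Y, symmetric]) simp
  also have "\<dots> = (\<integral>\<^sup>+x. ennreal \<sigma> * ennreal (normal_density 0 \<sigma> x) \<partial>lborel)"
    using \<sigma>(1) by (intro nn_integral_cong) (simp add: ennreal_mult[symmetric] eq)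
  also have "\<dots> = ennreal \<sigma>"
    using \<sigma>(1) by (simp add: nn_integral_cmult nn_integral_normal_density)
  finally show ?thesis by (simp add: \<sigma>_def)
qed

text \<open>As \<open>s\<close> approaches 1 the exponent approaches \<open>- y\<close>, which is
  the rate needed. The price is a prefactor that depends only on \<open>s\<close> and the number of
  coordinates.\<close>

lemma std_normal_sum_squares_tail:
  assumes "finite A" and ind: "indep_vars (\<lambda>_. borel) Y A"
    and Y: "\<And>a. a \<in> A \<Longrightarrow> distributed M lborel (Y a) std_normal_density" and s: "0 < s" "s < 1"
  shows "prob {\<omega> \<in> space M. 2 * y \<le> (\<Sum>a\<in>A. (Y a \<omega>)\<^sup>2)} \<le> exp (- s * y) * (1 / sqrt (1 - s)) ^ card A"
proof -
  have Ym [measurable]: "Y a \<in> borel_measurable M" if "a \<in> A" for a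
    using ind that by (simp add: indep_vars_def2)
  let ?E = "{\<omega> \<in> space M. 2 * y \<le> (\<Sum>a\<in>A. (Y a \<omega>)\<^sup>2)}"
  have E: "?E \<in> events" by measurable
  have "emeasure M ?E = (\<integral>\<^sup>+\<omega>. indicator ?E \<omega> \<partial>M)" using E by simp
  also have "\<dots> \<le> (\<integral>\<^sup>+\<omega>. ennreal (exp (- s * y)) * (\<Prod>a\<in>A. ennreal (exp (s * (Y a \<omega>)\<^sup>2 / 2))) \<partial>M)"
  proof (rule nn_integral_mono)
    fix \<omega> assume "\<omega> \<in> space M"
    show "indicator ?E \<omega> \<le> ennreal (exp (- s * y)) * (\<Prod>a\<in>A. ennreal (exp (s * (Y a \<omega>)\<^sup>2 / 2)))"
    proof (cases "\<omega> \<in> ?E")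
      case True
      then have "s * (2 * y) \<le> s * (\<Sum>a\<in>A. (Y a \<omega>)\<^sup>2)" using s by (intro mult_left_mono) auto
      then have "0 \<le> - s * y + (\<Sum>a\<in>A. s * (Y a \<omega>)\<^sup>2 / 2)"
        by (simp add: sum_divide_distrib[symmetric] sum_distrib_left[symmetric])
      then have "1 \<le> exp (- s * y) * (\<Prod>a\<in>A. exp (s * (Y a \<omega>)\<^sup>2 / 2))"
        by (simp add: exp_sum[OF \<open>finite A\<close>, symmetric] mult_exp_exp)
      then have "ennreal 1 \<le> ennreal (exp (- s * y) * (\<Prod>a\<in>A. exp (s * (Y a \<omega>)\<^sup>2 / 2)))"
        by (rule ennreal_leI)
      then show ?thesis using True by (simp add: ennreal_mult prod_ennreal prod_nonneg)
    qed simp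
  qed
  also have "\<dots> = ennreal (exp (- s * y)) * (\<integral>\<^sup>+\<omega>. (\<Prod>a\<in>A. ennreal (exp (s * (Y a \<omega>)\<^sup>2 / 2))) \<partial>M)"
    by (rule nn_integral_cmult) measurable
  also have "(\<integral>\<^sup>+\<omega>. (\<Prod>a\<in>A. ennreal (exp (s * (Y a \<omega>)\<^sup>2 / 2))) \<partial>M)
      = (\<Prod>a\<in>A. \<integral>\<^sup>+\<omega>. ennreal (exp (s * (Y a \<omega>)\<^sup>2 / 2)) \<partial>M)"
    by (rule indep_vars_nn_integral[OF \<open>finite A\<close>])
      (auto intro!: indep_vars_compose2[OF ind, where Y="\<lambda>_ x. ennreal (exp (s * x\<^sup>2 / 2))"])
  also have "\<dots> = (\<Prod>a\<in>A. ennreal (1 / sqrt (1 - s)))"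
    by (intro prod.cong refl std_normal_exp_square Y s)
  also have "ennreal (exp (- s * y)) * \<dots> = ennreal (exp (- s * y) * (1 / sqrt (1 - s)) ^ card A)"
    using s by (simp add: ennreal_power ennreal_mult)
  finally show ?thesis using s by (simp add: emeasure_eq_measure)
qed

lemma std_normal_near:
  assumes Y: "distributed M lborel Y std_normal_density"
  shows "2 / sqrt (2 * pi) * exp (- (\<bar>y\<bar> + 1)\<^sup>2 / 2) \<le> prob (Y -` {y - 1..y + 1} \<inter> space M)"
proof -
  let ?c = "1 / sqrt (2 * pi) * exp (- (\<bar>y\<bar> + 1)\<^sup>2 / 2)"
  have "ennreal (?c * 2) = ennreal ?c * ennreal 2" by (rule ennreal_mult'') simp
  also have "ennreal 2 = emeasure lborel {y - 1..y + 1}" by simp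
  also have "ennreal ?c * \<dots> = (\<integral>\<^sup>+x. ennreal ?c * indicator {y - 1..y + 1} x \<partial>lborel)"
    by (rule nn_integral_cmult_indicator[symmetric]) simp
  also have "\<dots> \<le> (\<integral>\<^sup>+x. ennreal (std_normal_density x) * indicator {y - 1..y + 1} x \<partial>lborel)"
  proof (intro nn_integral_mono)
    fix x :: real
    show "ennreal ?c * indicator {y - 1..y + 1} x \<le> ennreal (std_normal_density x) * indicator {y - 1..y + 1} x"
    proof (cases "x \<in> {y - 1..y + 1}")
      case True
      then have "\<bar>x\<bar> \<le> \<bar>y\<bar> + 1" by auto
      then have "x\<^sup>2 \<le> (\<bar>y\<bar> + 1)\<^sup>2" by (metis abs_le_square_iff abs_of_nonneg abs_ge_zero add_nonneg_nonneg zero_le_one)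
      then show ?thesis using True by (auto simp: std_normal_density_def intro!: ennreal_leI divide_right_mono)
    qed simp
  qed
  also have "\<dots> = emeasure M (Y -` {y - 1..y + 1} \<inter> space M)"
    by (rule distributed_emeasure[OF Y, symmetric]) simp
  finally show ?thesis by (simp add: emeasure_eq_measure mult.commute)
qed

lemma std_normal_near_all:
  assumes "finite A" and ind: "indep_vars (\<lambda>_. borel) Y A"
    and Y: "\<And>a. a \<in> A \<Longrightarrow> distributed M lborel (Y a) std_normal_density"
  shows "(\<Prod>a\<in>A. 2 / sqrt (2 * pi) * exp (- (\<bar>y a\<bar> + 1)\<^sup>2 / 2)) \<le> prob {\<omega> \<in> space M. \<forall>a\<in>A. \<bar>Y a \<omega> - y a\<bar> \<le> 1}"
proof (cases "A = {}")
  case False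
  have eq: "{\<omega> \<in> space M. \<forall>a\<in>A. \<bar>Y a \<omega> - y a\<bar> \<le> 1} = (\<Inter>a\<in>A. Y a -` {y a - 1..y a + 1} \<inter> space M)"
    using False by (auto simp: abs_le_iff algebra_simps)
  have "(\<Prod>a\<in>A. 2 / sqrt (2 * pi) * exp (- (\<bar>y a\<bar> + 1)\<^sup>2 / 2)) \<le> (\<Prod>a\<in>A. prob (Y a -` {y a - 1..y a + 1} \<inter> space M))"
    using std_normal_near Y by (intro prod_mono) auto
  also have "\<dots> = prob (\<Inter>a\<in>A. Y a -` {y a - 1..y a + 1} \<inter> space M)"
    using False \<open>finite A\<close> by (intro indep_varsD[OF ind, symmetric]) auto
  finally show ?thesis by (simp only: eq)
qed (simp add: prob_space)

text \<open>Disjoint index sets turn joint independence of the entries into independence of the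
  block sums, and \<open>sqrt m\<close> normalizes the variance \<open>m\<close> of a sum.\<close>

lemma std_normal_block_sums:
  assumes ind: "indep_vars (\<lambda>_. borel) (\<lambda>(i, b). Z i b) (I \<times> B)"
    and Z: "\<And>i b. i \<in> I \<Longrightarrow> b \<in> B \<Longrightarrow> distributed M lborel (Z i b) std_normal_density"
    and K: "\<And>j. j \<in> J \<Longrightarrow> K j \<subseteq> I" "disjoint_family_on K J" "\<And>j. j \<in> J \<Longrightarrow> finite (K j)" "\<And>j. j \<in> J \<Longrightarrow> card (K j) = m" "m > 0"
  shows "indep_vars (\<lambda>_. borel) (\<lambda>(j, b) \<omega>. (\<Sum>i\<in>K j. Z i b \<omega>) / sqrt (real m)) (J \<times> B)"
    and "j \<in> J \<Longrightarrow> b \<in> B \<Longrightarrow> distributed M lborel (\<lambda>\<omega>. (\<Sum>i\<in>K j. Z i b \<omega>) / sqrt (real m)) std_normal_density"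
proof -
  let ?K = "\<lambda>jb. K (fst jb) \<times> {snd jb}"
  have "indep_vars (\<lambda>jb. PiM (?K jb) (\<lambda>_. borel)) (\<lambda>jb \<omega>. restrict (\<lambda>ib. (\<lambda>(i, b). Z i b) ib \<omega>) (?K jb)) (J \<times> B)"
  proof (rule indep_vars_restrict[OF ind])
    show "disjoint_family_on ?K (J \<times> B)"
      using K(2) unfolding disjoint_family_on_def by fastforce
    show "?K jb \<subseteq> I \<times> B" if "jb \<in> J \<times> B" for jb
      using K(1)[of "fst jb"] that by auto
  qed
  from indep_vars_compose2[OF this, where Y="\<lambda>jb h. (\<Sum>i\<in>K (fst jb). h (i, snd jb)) / sqrt (real m)" and N="\<lambda>_. borel"]
  have "indep_vars (\<lambda>_. borel) (\<lambda>jb \<omega>. (\<Sum>i\<in>K (fst jb). restrict (\<lambda>ib. (\<lambda>(i, b). Z i b) ib \<omega>) (?K jb) (i, snd jb)) / sqrt (real m)) (J \<times> B)"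
    by (simp add: borel_measurable_sum)
  moreover have "(\<lambda>jb \<omega>. (\<Sum>i\<in>K (fst jb). restrict (\<lambda>ib. (\<lambda>(i, b). Z i b) ib \<omega>) (?K jb) (i, snd jb)) / sqrt (real m))
      = (\<lambda>(j, b) \<omega>. (\<Sum>i\<in>K j. Z i b \<omega>) / sqrt (real m))"
    by (auto simp: fun_eq_iff)
  ultimately show "indep_vars (\<lambda>_. borel) (\<lambda>(j, b) \<omega>. (\<Sum>i\<in>K j. Z i b \<omega>) / sqrt (real m)) (J \<times> B)"
    by simp
  assume jb: "j \<in> J" "b \<in> B"
  have "indep_vars (\<lambda>_. borel) (\<lambda>i. Z i b) (K j)"
  proof -
    have "indep_vars (\<lambda>i. PiM {(i, b)} (\<lambda>_. borel)) (\<lambda>i \<omega>. restrict (\<lambda>ib. (\<lambda>(i, b). Z i b) ib \<omega>) {(i, b)}) (K j)"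
    proof (rule indep_vars_restrict[OF ind])
      show "disjoint_family_on (\<lambda>i. {(i, b)}) (K j)" by (auto simp: disjoint_family_on_def)
      show "{(i, b)} \<subseteq> I \<times> B" if "i \<in> K j" for i using K(1)[OF jb(1)] jb(2) that by auto
    qed
    from indep_vars_compose2[OF this, where Y="\<lambda>i h. h (i, b)" and N="\<lambda>_. borel"]
    show ?thesis by simp
  qed
  moreover have "K j \<noteq> {}" using K(4)[OF jb(1)] K(5) by auto
  ultimately have "distributed M lborel (\<lambda>\<omega>. \<Sum>i\<in>K j. Z i b \<omega>) (normal_density (\<Sum>i\<in>K j. 0) (sqrt (\<Sum>i\<in>K j. 1\<^sup>2)))"
    using K(1,3)[OF jb(1)] Z jb by (intro sum_indep_normal) auto
  then have "distributed M lborel (\<lambda>\<omega>. \<Sum>i\<in>K j. Z i b \<omega>) (normal_density 0 (sqrt (real m)))"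
    using K(4)[OF jb(1)] by simp
  then show "distributed M lborel (\<lambda>\<omega>. (\<Sum>i\<in>K j. Z i b \<omega>) / sqrt (real m)) std_normal_density"
    using normal_standard_normal_convert[of "sqrt (real m)" "\<lambda>\<omega>. \<Sum>i\<in>K j. Z i b \<omega>" 0] K(5) by simp
qed

end

section \<open>Block averages of the walk\<close>

context exp_group
begin

lemma gprod_blocks:
  "gprod (map (\<lambda>j. gprod (map v [Suc (j * m)..<Suc (Suc j * m)])) [i..<i + l]) = gprod (map v [Suc (i * m)..<Suc ((i + l) * m)])"
proof (induction l)
  case (Suc l)
  have "[Suc (i * m)..<Suc ((i + Suc l) * m)] = [Suc (i * m)..<Suc ((i + l) * m)] @ [Suc ((i + l) * m)..<Suc (Suc (i + l) * m)]"
    using upt_add_eq_append[of "Suc (i * m)" "Suc ((i + l) * m)" m] by (simp add: add_mult_distrib ac_simps)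
  then show ?case using Suc by simp
qed simp

end

context carnot_metric
begin

lemma len_map_upt: "len (map v [a..<b]) = (\<Sum>i=a..<b. norm (isom (v i)))"
  by (simp add: len_def o_def interv_sum_list_conv_sum_set_nat)

text \<open>On the event that the empirical energy is at most \<open>R\<^sup>2\<close>, replacing the walk by the product of its
  block averages costs an error which is small uniformly in \<open>n\<close>: this is where the superexponential
  approximation of the usual proofs becomes deterministic.\<close>

lemma block_approximation:
  assumes "R \<ge> 0"
  shows "\<exists>C\<ge>0. \<forall>n k m v. k > 0 \<longrightarrow> k\<^sup>2 \<le> n \<longrightarrow> m = n div k \<longrightarrow> (\<forall>i\<in>{1..n}. v i \<in> V 1) \<longrightarrow>
    (\<Sum>i=1..n. (norm (isom (v i)))\<^sup>2) \<le> R\<^sup>2 / real n \<longrightarrow>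
    norm (gprod (map v [1..<Suc n]) - gprod (map (\<lambda>j. \<Sum>i=Suc (j * m)..<Suc (Suc j * m). v i) [0..<k])) \<le> C / sqrt (real k)
    \<and> norm (gprod (map v [1..<Suc n])) \<le> C
    \<and> norm (gprod (map (\<lambda>j. \<Sum>i=Suc (j * m)..<Suc (Suc j * m). v i) [0..<k])) \<le> C"
proof -
  obtain B where B: "B \<ge> 0" "\<And>ws. set ws \<subseteq> V 1 \<Longrightarrow> (\<Sum>w\<leftarrow>ws. norm w) \<le> lc * R \<Longrightarrow> norm (gprod ws) \<le> B"
    using gprod_bounded[of "lc * R"] by blast
  obtain C1 where C1: "C1 \<ge> 0" "\<And>ws. set ws \<subseteq> V 1 \<Longrightarrow> (\<Sum>w\<leftarrow>ws. norm w) \<le> lc * R \<Longrightarrow> norm (gprod ws) \<le> C1 * (\<Sum>w\<leftarrow>ws. norm w)"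
    using gprod_norm_le[of "lc * R"] by blast
  obtain C2 where C2: "C2 \<ge> 0" "\<And>ws. set ws \<subseteq> V 1 \<Longrightarrow> (\<Sum>w\<leftarrow>ws. norm w) \<le> lc * R \<Longrightarrow>
      norm (gprod ws - sum_list ws) \<le> C2 * (\<Sum>w\<leftarrow>ws. norm w)\<^sup>2"
    using gprod_second_order[of "lc * R"] by blast
  define S where "S = max B (lc * R)"
  obtain C3 where C3: "C3 \<ge> 0" "\<And>gs hs. length gs = length hs \<Longrightarrow> (\<forall>g\<in>set gs. norm g \<le> S) \<Longrightarrow> (\<forall>h\<in>set hs. norm h \<le> S) \<Longrightarrow>
    (\<forall>i. norm (gprod (take i hs)) \<le> S) \<Longrightarrow> (\<forall>i. norm (gprod (drop i gs)) \<le> S) \<Longrightarrow>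
    norm (gprod gs - gprod hs) \<le> C3 * (\<Sum>(g, h)\<leftarrow>zip gs hs. norm (g - h))"
    using gprod_replace[of S] by blast
  obtain C4 where C4: "C4 \<ge> 0" "\<And>x x' y y'. norm x \<le> B \<Longrightarrow> norm x' \<le> B \<Longrightarrow> norm y \<le> B \<Longrightarrow> norm y' \<le> B \<Longrightarrow>
      norm (x \<otimes> y - x' \<otimes> y') \<le> C4 * (norm (x - x') + norm (y - y'))"
    using mult_lipschitz[of B] by blast
  \<comment> \<open>The first summand comes from replacing each block by its sum, the second from
    the indices beyond \<open>k * m\<close>.\<close>
  define D where "D = C3 * (C2 * lc\<^sup>2 * R) * R + C4 * (C1 * (lc * R))"
  have D0: "D \<ge> 0" using C3 C2 C4 C1 lc(1) assms by (simp add: D_def)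
  let ?T = "\<lambda>v m j. \<Sum>i=Suc (j * m)..<Suc (Suc j * m). v i"
  have main: "norm (gprod (map v [1..<Suc n]) - gprod (map (?T v m) [0..<k])) \<le> D / sqrt (real k)
    \<and> norm (gprod (map v [1..<Suc n])) \<le> B \<and> norm (gprod (map (?T v m) [0..<k])) \<le> B"
    if k: "k > 0" and kn: "k\<^sup>2 \<le> n" and m: "m = n div k" and v: "\<And>i. i \<in> {1..n} \<Longrightarrow> v i \<in> V 1"
      and E: "(\<Sum>i=1..n. (norm (isom (v i)))\<^sup>2) \<le> R\<^sup>2 / real n" for n k m v
  proof -
    define a where "a i = norm (isom (v i))" for i
    have a0: "a i \<ge> 0" for i by (simp add: a_def)
    have n: "n > 0" using k kn by (cases n) auto
    have km: "k * m \<le> n" "n < k * m + k"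
      using times_div_less_eq_dividend[of k n] dividend_less_times_div[OF k, of n] by (simp_all add: m)
    have sq: "(\<Sum>i\<in>A. a i)\<^sup>2 \<le> real (card A) * (R\<^sup>2 / real n)" if A: "A \<subseteq> {1..n}" for A
    proof -
      have 1: "(\<Sum>i\<in>A. a i)\<^sup>2 \<le> (\<Sum>i\<in>A. (a i)\<^sup>2) * real (card A)" by (rule sum_squared_le_sum_of_squares)
      have "(\<Sum>i\<in>A. (a i)\<^sup>2) \<le> (\<Sum>i=1..n. (a i)\<^sup>2)" using A by (intro sum_mono2) auto
      also have "\<dots> \<le> R\<^sup>2 / real n" using E by (simp add: a_def)
      finally have 2: "(\<Sum>i\<in>A. (a i)\<^sup>2) * real (card A) \<le> R\<^sup>2 / real n * real (card A)"
        by (rule mult_right_mono) simp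
      show ?thesis using order_trans[OF 1 2] by (simp add: mult.commute)
    qed
    \<comment> \<open>Cauchy-Schwarz: at most \<open>n / k\<close> indices, with total energy at
      most \<open>R\<^sup>2 / n\<close>.\<close>
    have sumle: "(\<Sum>i\<in>A. a i) \<le> R / sqrt (real k)" if A: "A \<subseteq> {1..n}" "card A * k \<le> n" for A
    proof (rule power2_le_imp_le)
      have "real (card A) * real k \<le> real n" using A(2) by (metis of_nat_le_iff of_nat_mult)
      then have "real (card A) * (R\<^sup>2 / real n) \<le> R\<^sup>2 / real k"
        using k n mult_right_mono[of "real (card A) * real k" "real n" "R\<^sup>2"] by (simp add: field_simps)
      then show "(\<Sum>i\<in>A. a i)\<^sup>2 \<le> (R / sqrt (real k))\<^sup>2" using sq[OF A(1)] by (simp add: power_divide)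
    qed (use assms in auto)
    have sumR: "(\<Sum>i\<in>A. a i) \<le> R" if A: "A \<subseteq> {1..n}" for A
    proof -
      have "(\<Sum>i\<in>A. a i) \<le> (\<Sum>i\<in>{1..n}. a i)" using A a0 by (intro sum_mono2) auto
      also have "\<dots> \<le> R"
      proof (rule power2_le_imp_le)
        show "(\<Sum>i\<in>{1..n}. a i)\<^sup>2 \<le> R\<^sup>2" using sq[of "{1..n}"] n by simp
      qed (rule assms)
      finally show ?thesis .
    qed
    have vl: "set (map v [p..<q]) \<subseteq> V 1" if "1 \<le> p" "q \<le> Suc n" for p q using that v by auto
    have nl: "(\<Sum>w\<leftarrow>map v [p..<q]. norm w) \<le> lc * (\<Sum>i=p..<q. a i)" if "1 \<le> p" "q \<le> Suc n" for p q
      using sum_norm_le_len[OF vl[OF that]] unfolding len_map_upt a_def .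
    have nlR: "(\<Sum>w\<leftarrow>map v [p..<q]. norm w) \<le> lc * R" if "1 \<le> p" "q \<le> Suc n" for p q
    proof -
      have "(\<Sum>i=p..<q. a i) \<le> R" using that by (intro sumR) auto
      then show ?thesis using nl[OF that] lc(1) by (meson mult_left_mono order_trans less_imp_le)
    qed
    have Bpq: "norm (gprod (map v [p..<q])) \<le> B" if "1 \<le> p" "q \<le> Suc n" for p q
      using B(2)[OF vl[OF that] nlR[OF that]] .
    have jm: "Suc (Suc j * m) \<le> Suc n" if "j < k" for j
    proof -
      have "Suc j * m \<le> k * m" using that by (intro mult_right_mono) auto
      then show ?thesis using km by simp
    qed
    define bl where "bl j = {Suc (j * m)..<Suc (Suc j * m)}" for j
    have bl: "bl j \<subseteq> {1..n}" "card (bl j) * k \<le> n" if "j < k" for j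
      using jm[OF that] km by (auto simp: bl_def mult.commute)
    have blsum: "(\<Sum>j<k. \<Sum>i\<in>bl j. a i) \<le> R"
    proof -
      have "(\<Sum>j<k. \<Sum>i\<in>bl j. a i) = (\<Sum>i\<in>(\<Union>j<k. bl j). a i)"
      proof (rule sum.UNION_disjoint[symmetric])
        show "\<forall>i\<in>{..<k}. \<forall>j\<in>{..<k}. i \<noteq> j \<longrightarrow> bl i \<inter> bl j = {}"
        proof (intro ballI impI)
          fix i j :: nat assume "i \<noteq> j"
          have "bl p \<inter> bl q = {}" if "p < q" for p q
          proof -
            have "Suc p * m \<le> q * m" using that by (intro mult_right_mono) auto
            then show ?thesis by (auto simp: bl_def)
          qed
          then show "bl i \<inter> bl j = {}" using \<open>i \<noteq> j\<close> by (metis Int_commute linorder_neqE_nat)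
        qed
      qed (auto simp: bl_def)
      also have "\<dots> \<le> R" using bl(1) by (intro sumR) auto
      finally show ?thesis .
    qed
    define gs where "gs = map (\<lambda>j. gprod (map v [Suc (j * m)..<Suc (Suc j * m)])) [0..<k]"
    define hs where "hs = map (?T v m) [0..<k]"
    have T_V1: "?T v m j \<in> V 1" if "j < k" for j
      using v bl(1)[OF that] by (intro subspace_sum[OF subspace_V1]) (auto simp: bl_def)
    have T_le: "norm (isom (?T v m j)) \<le> (\<Sum>i\<in>bl j. a i)" for j
      unfolding a_def bl_def by (simp only: linear_sum[OF isom(1)] norm_sum)
    have hs_V1: "set hs \<subseteq> V 1" using T_V1 by (auto simp: hs_def)
    have len_hs: "len hs \<le> R"
    proof -
      have "len hs = (\<Sum>j<k. norm (isom (?T v m j)))"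
        by (simp only: hs_def len_map_upt atLeast0LessThan)
      also have "\<dots> \<le> (\<Sum>j<k. \<Sum>i\<in>bl j. a i)" by (intro sum_mono T_le)
      finally show ?thesis using blsum by linarith
    qed
    have take_hs: "(\<Sum>w\<leftarrow>take i hs. norm w) \<le> lc * R" for i
    proof -
      have "len (take i hs) \<le> len (take i hs) + len (drop i hs)" using len_nonneg[of "drop i hs"] by simp
      also have "\<dots> = len hs" by (simp flip: len_simps(3))
      finally have "lc * len (take i hs) \<le> lc * R" using len_hs lc(1) by (intro mult_left_mono) auto
      moreover have "set (take i hs) \<subseteq> V 1" using hs_V1 set_take_subset by fast
      ultimately show ?thesis using sum_norm_le_len by fastforce
    qed
    have take_hs_B: "norm (gprod (take i hs)) \<le> B" for i
    proof -
      have "set (take i hs) \<subseteq> V 1" using hs_V1 set_take_subset by fast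
      then show ?thesis using B(2) take_hs by blast
    qed
    have drop_gs: "gprod (drop i gs) = gprod (map v [Suc (i * m)..<Suc (k * m)])" if "i \<le> k" for i
      using gprod_blocks[of v m i "k - i"] that by (simp add: gs_def drop_map)
    \<comment> \<open>The second-order error is the square of the block length. One factor is
      bounded by \<open>R / sqrt k\<close>; the other is kept, since the block lengths sum to at
      most \<open>R\<close>.\<close>
    have near: "norm (gprod (map v [Suc (j * m)..<Suc (Suc j * m)]) - ?T v m j) \<le> C2 * lc\<^sup>2 * (R / sqrt (real k)) * (\<Sum>i\<in>bl j. a i)" if j: "j < k" for j
    proof -
      let ?l = "map v [Suc (j * m)..<Suc (Suc j * m)]"
      have "sum_list ?l = ?T v m j" by (simp only: interv_sum_list_conv_sum_set_nat set_upt)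
      moreover have p1: "1 \<le> Suc (j * m)" by simp
      note C2(2)[OF vl[OF p1 jm[OF j]] nlR[OF p1 jm[OF j]]]
      ultimately have "norm (gprod ?l - ?T v m j) \<le> C2 * (\<Sum>w\<leftarrow>?l. norm w)\<^sup>2" by (simp only:)
      also have "\<dots> \<le> C2 * (lc * (\<Sum>i\<in>bl j. a i))\<^sup>2"
      proof (intro mult_left_mono power_mono)
        show "(\<Sum>w\<leftarrow>?l. norm w) \<le> lc * (\<Sum>i\<in>bl j. a i)" unfolding bl_def by (rule nl[OF p1 jm[OF j]])
        show "0 \<le> (\<Sum>w\<leftarrow>?l. norm w)" by (rule sum_list_nonneg) (auto simp del: upt_Suc)
      qed (rule C2(1))
      also have "\<dots> = C2 * lc\<^sup>2 * ((\<Sum>i\<in>bl j. a i) * (\<Sum>i\<in>bl j. a i))"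
        by (simp add: power_mult_distrib power2_eq_square)
      also have "\<dots> \<le> C2 * lc\<^sup>2 * ((R / sqrt (real k)) * (\<Sum>i\<in>bl j. a i))"
        using sumle[OF bl[OF j]] C2(1) a0 by (intro mult_left_mono mult_right_mono sum_nonneg) auto
      finally show ?thesis by (simp add: mult.assoc)
    qed
    have "norm (gprod gs - gprod hs) \<le> C3 * (\<Sum>(g, h)\<leftarrow>zip gs hs. norm (g - h))"
    proof (rule C3(2))
      show "length gs = length hs" by (simp add: gs_def hs_def)
      show "\<forall>g\<in>set gs. norm g \<le> S"
        using Bpq jm by (auto simp: gs_def S_def intro!: max.coboundedI1 simp del: upt_Suc)
      show "\<forall>h\<in>set hs. norm h \<le> S"
      proof
        fix h assume "h \<in> set hs"
        then have "norm h \<le> (\<Sum>w\<leftarrow>hs. norm w)" by (intro member_le_sum_list) auto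
        then show "norm h \<le> S" using take_hs[of k] by (simp add: S_def hs_def del: upt_Suc)
      qed
      show "\<forall>i. norm (gprod (take i hs)) \<le> S" using take_hs_B by (auto simp: S_def le_max_iff_disj)
      show "\<forall>i. norm (gprod (drop i gs)) \<le> S"
      proof
        fix i show "norm (gprod (drop i gs)) \<le> S"
        proof (cases "i \<le> k")
          case True
          have "norm (gprod (map v [Suc (i * m)..<Suc (k * m)])) \<le> B" using km by (intro Bpq) auto
          then show ?thesis unfolding drop_gs[OF True] by (simp add: S_def)
        next
          case False
          then show ?thesis using B(1) by (simp add: gs_def S_def le_max_iff_disj)
        qed
      qed
    qed
    also have "(\<Sum>(g, h)\<leftarrow>zip gs hs. norm (g - h)) = (\<Sum>j<k. norm (gprod (map v [Suc (j * m)..<Suc (Suc j * m)]) - ?T v m j))"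
      by (simp add: gs_def hs_def zip_map_map zip_same_conv_map o_def interv_sum_list_conv_sum_set_nat atLeast0LessThan del: upt_Suc)
    also have "\<dots> \<le> (\<Sum>j<k. C2 * lc\<^sup>2 * (R / sqrt (real k)) * (\<Sum>i\<in>bl j. a i))" using near by (intro sum_mono) auto
    also have "\<dots> = C2 * lc\<^sup>2 * (R / sqrt (real k)) * (\<Sum>j<k. \<Sum>i\<in>bl j. a i)" by (simp add: sum_distrib_left)
    also have "\<dots> \<le> C2 * lc\<^sup>2 * (R / sqrt (real k)) * R"
      using blsum C2(1) assms by (intro mult_left_mono) auto
    finally have 1: "norm (gprod gs - gprod hs) \<le> C3 * (C2 * lc\<^sup>2 * (R / sqrt (real k)) * R)"
      using C3(1) by (simp add: mult_left_mono)
    let ?rem = "map v [Suc (k * m)..<Suc n]"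
    \<comment> \<open>Fewer than \<open>k\<close> steps are left over, and
      \<open>k\<^sup>2 \<le> n\<close> makes their total length subject to the same bound as that of
      a block.\<close>
    have rem: "norm (gprod ?rem) \<le> C1 * (lc * (R / sqrt (real k)))"
    proof -
      have "norm (gprod ?rem) \<le> C1 * (\<Sum>w\<leftarrow>?rem. norm w)"
        using vl nlR by (intro C1(2)) (auto simp del: upt_Suc)
      also have "\<dots> \<le> C1 * (lc * (\<Sum>i=Suc (k * m)..<Suc n. a i))"
        using nl[of "Suc (k * m)" "Suc n"] C1(1) by (intro mult_left_mono) auto
      also have "\<dots> \<le> C1 * (lc * (R / sqrt (real k)))"
      proof (intro mult_left_mono sumle)
        have "card {Suc (k * m)..<Suc n} \<le> k" using km by simp
        then have "card {Suc (k * m)..<Suc n} * k \<le> k * k" by (intro mult_right_mono) auto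
        also have "k * k \<le> n" using kn by (simp add: power2_eq_square)
        finally show "card {Suc (k * m)..<Suc n} * k \<le> n" .
      qed (use C1(1) lc(1) in auto)
      finally show ?thesis .
    qed
    have decomp: "gprod (map v [1..<Suc n]) = gprod gs \<otimes> gprod ?rem"
    proof -
      have "[1..<Suc n] = [1..<Suc (k * m)] @ [Suc (k * m)..<Suc n]"
        using upt_add_eq_append[of 1 "Suc (k * m)" "n - k * m"] km by (simp del: upt_Suc)
      moreover have "gprod (map v [1..<Suc (k * m)]) = gprod gs"
        using drop_gs[of 0] by (simp del: upt_Suc)
      ultimately show ?thesis by (simp del: upt_Suc)
    qed
    have "norm (gprod gs \<otimes> gprod ?rem - gprod gs \<otimes> 0) \<le> C4 * (norm (gprod gs - gprod gs) + norm (gprod ?rem - 0))"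
    proof (rule C4(2))
      show "norm (gprod gs) \<le> B" "norm (gprod gs) \<le> B"
        using drop_gs[of 0] Bpq[of 1 "Suc (k * m)"] km by (simp_all del: upt_Suc)
      show "norm (gprod ?rem) \<le> B" by (rule Bpq) auto
    qed (use B(1) in simp)
    then have "norm (gprod (map v [1..<Suc n]) - gprod gs) \<le> C4 * norm (gprod ?rem)"
      unfolding decomp by (simp del: upt_Suc)
    also have "\<dots> \<le> C4 * (C1 * (lc * (R / sqrt (real k))))" using rem C4(1) by (intro mult_left_mono)
    finally have 2: "norm (gprod (map v [1..<Suc n]) - gprod gs) \<le> C4 * (C1 * (lc * (R / sqrt (real k))))" .
    have "norm (gprod (map v [1..<Suc n]) - gprod hs)
        \<le> C4 * (C1 * (lc * (R / sqrt (real k)))) + C3 * (C2 * lc\<^sup>2 * (R / sqrt (real k)) * R)"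
      using norm_triangle_mono[OF 2 1] by simp
    also have "\<dots> = D / sqrt (real k)" by (simp add: D_def add_divide_distrib)
    finally show ?thesis
      using Bpq[of 1 "Suc n"] take_hs_B[of k] by (simp add: hs_def del: upt_Suc)
  qed
  define C where "C = max D B"
  have "D / sqrt (real k) \<le> C / sqrt (real k)" "B \<le> C" for k by (auto simp: C_def divide_right_mono)
  then have "norm (gprod (map v [1..<Suc n]) - gprod (map (?T v m) [0..<k])) \<le> C / sqrt (real k)
    \<and> norm (gprod (map v [1..<Suc n])) \<le> C \<and> norm (gprod (map (?T v m) [0..<k])) \<le> C"
    if "k > 0" "k\<^sup>2 \<le> n" "m = n div k" "\<forall>i\<in>{1..n}. v i \<in> V 1"
      "(\<Sum>i=1..n. (norm (isom (v i)))\<^sup>2) \<le> R\<^sup>2 / real n" for n k m v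
    using main[of k n m v] that by (meson order_trans)
  moreover have "C \<ge> 0" using D0 by (simp add: C_def)
  ultimately show ?thesis by blast
qed

end

section \<open>Large deviations\<close>

text \<open>For passing from \<open>ip\<close> to \<open>coord\<close>, which agree where the
  vectors are horizontal, that is, on the sample space.\<close>

lemma (in prob_space) indep_vars_cong_space:
  assumes "indep_vars M' X I" "\<And>i \<omega>. i \<in> I \<Longrightarrow> \<omega> \<in> space M \<Longrightarrow> X i \<omega> = Y i \<omega>"
  shows "indep_vars M' Y I"
proof -
  have pre: "X i -` A \<inter> space M = Y i -` A \<inter> space M" if "i \<in> I" for i A
    using assms(2)[OF that] by auto
  have "random_variable (M' i) (Y i)" if "i \<in> I" for i
    using assms that measurable_cong[of M "X i" "Y i" "M' i"] by (auto simp: indep_vars_def2)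
  moreover have "indep_sets (\<lambda>i. {Y i -` A \<inter> space M |A. A \<in> sets (M' i)}) I"
    using assms(1) indep_sets_cong[OF refl, of I "\<lambda>i. {X i -` A \<inter> space M |A. A \<in> sets (M' i)}" "\<lambda>i. {Y i -` A \<inter> space M |A. A \<in> sets (M' i)}"] pre
    by (simp add: indep_vars_def2)
  ultimately show ?thesis by (simp add: indep_vars_def2)
qed

section \<open>Comparison of exponential rates\<close>

lemma eventually_exp_upper:
  assumes "b > a" "a' > a"
  shows "\<forall>\<^sub>F n in sequentially. exp (- real n * b) + exp (- real n * a') * c \<le> exp (- real n * a)"
proof -
  have lim: "(\<lambda>n. exp (- real n * d)) \<longlonglongrightarrow> 0" if "d > 0" for d
    using LIMSEQ_realpow_zero[of "exp (- d)"] that by (simp add: exp_of_nat_mult[symmetric] mult.commute)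
  have "(\<lambda>n. exp (- real n * (b - a)) + exp (- real n * (a' - a)) * c) \<longlonglongrightarrow> 0 + 0 * c"
    using assms by (intro tendsto_intros lim) auto
  then have "\<forall>\<^sub>F n in sequentially. exp (- real n * (b - a)) + exp (- real n * (a' - a)) * c < 1"
    by (intro order_tendstoD(2)) auto
  then show ?thesis
  proof eventually_elim
    case (elim n)
    have "exp (- real n * b) + exp (- real n * a') * c
        = exp (- real n * a) * (exp (- real n * (b - a)) + exp (- real n * (a' - a)) * c)"
      by (simp add: distrib_left exp_add[symmetric] mult.assoc[symmetric] algebra_simps)
    also have "\<dots> \<le> exp (- real n * a) * 1" using elim by (intro mult_left_mono) auto
    finally show ?case by simp
  qed
qed

lemma eventually_exp_lower:
  assumes "a' < a" "b > a" "c > 0"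
  shows "\<forall>\<^sub>F n in sequentially. exp (- real n * a) \<le> c * exp (- real n * a') - exp (- real n * b)"
proof -
  \<comment> \<open>The midpoint of \<open>a\<close> and \<open>a'\<close> separates two tasks: it
    first dominates both small exponentials, and then its gap to \<open>a'\<close> absorbs the
    constant \<open>c\<close>.\<close>
  have "\<forall>\<^sub>F n in sequentially. exp (- real n * b) + exp (- real n * a) * 1 \<le> exp (- real n * ((a + a') / 2))"
    using assms by (intro eventually_exp_upper) auto
  moreover have "\<forall>\<^sub>F n in sequentially. exp (- real n * a) + exp (- real n * ((a + a') / 2)) * (1 / c) \<le> exp (- real n * a')"
    using assms by (intro eventually_exp_upper) auto
  ultimately show ?thesis
  proof eventually_elim
    case (elim n)
    have "exp (- real n * ((a + a') / 2)) * (1 / c) \<le> exp (- real n * a')"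
      using elim(2) exp_ge_zero[of "- real n * a"] by linarith
    then have "exp (- real n * ((a + a') / 2)) \<le> c * exp (- real n * a')"
      using assms(3) by (simp add: field_simps)
    then show ?case using elim(1) by linarith
  qed
qed

lemma limsup_ext_ln_le:
  assumes "\<forall>\<^sub>F n in sequentially. p n \<le> exp (- real n * a)" "\<And>n. 0 \<le> p n"
  shows "limsup (\<lambda>n. ereal (1 / real n) * ext_ln (p n)) \<le> ereal (- a)"
proof (rule Limsup_bounded)
  show "\<forall>\<^sub>F n in sequentially. ereal (1 / real n) * ext_ln (p n) \<le> ereal (- a)"
    using assms(1) eventually_gt_at_top[of 0]
  proof eventually_elim
    case (elim n)
    show ?case
    proof (cases "p n = 0")
      case False
      then have "p n > 0" using assms(2)[of n] by simp
      then have "ln (p n) \<le> - real n * a" using elim(1) by (metis ln_exp ln_le_cancel_iff exp_gt_zero)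
      then show ?thesis using False elim(2) by (simp add: ext_ln_def field_simps)
    qed (use elim in \<open>simp add: ext_ln_def\<close>)
  qed
qed

lemma liminf_ext_ln_ge:
  assumes "\<forall>\<^sub>F n in sequentially. exp (- real n * a) \<le> p n"
  shows "ereal (- a) \<le> liminf (\<lambda>n. ereal (1 / real n) * ext_ln (p n))"
proof (rule Liminf_bounded)
  show "\<forall>\<^sub>F n in sequentially. ereal (- a) \<le> ereal (1 / real n) * ext_ln (p n)"
    using assms eventually_gt_at_top[of 0]
  proof eventually_elim
    case (elim n)
    have pos: "0 < p n" using elim(1) exp_gt_zero[of "- real n * a"] by linarith
    then have "- real n * a \<le> ln (p n)" using elim(1) by (metis ln_exp ln_le_cancel_iff exp_gt_zero)
    then show ?case using pos elim(2) by (simp add: ext_ln_def field_simps)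
  qed
qed

context exp_group
begin

lemma gprod_continuous:
  assumes "\<epsilon> > 0"
  shows "\<exists>\<delta>>0. \<forall>us. list_all2 (\<lambda>u w. norm (u - w) < \<delta>) us ws \<longrightarrow> norm (gprod us - gprod ws) < \<epsilon>"
  using assms
proof (induction ws arbitrary: \<epsilon>)
  case (Cons w ws)
  have "continuous_on UNIV (\<lambda>p. fst p \<otimes> snd p)" by (rule smooth_continuous[OF smooth_mult])
  then have "isCont (\<lambda>p. fst p \<otimes> snd p) (w, gprod ws)" by (simp add: continuous_on_eq_continuous_at)
  then obtain d where d: "d > 0" "\<And>p. dist p (w, gprod ws) < d \<Longrightarrow> dist (fst p \<otimes> snd p) (w \<otimes> gprod ws) < \<epsilon>"
    using Cons.prems unfolding continuous_at_eps_delta by fastforce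
  obtain \<delta> where \<delta>: "\<delta> > 0" "\<And>us. list_all2 (\<lambda>u w. norm (u - w) < \<delta>) us ws \<Longrightarrow> norm (gprod us - gprod ws) < d / 2"
    using Cons.IH[of "d / 2"] d(1) by auto
  have "norm (gprod us - gprod (w # ws)) < \<epsilon>"
    if us: "list_all2 (\<lambda>u w. norm (u - w) < min \<delta> (d / 2)) us (w # ws)" for us
  proof -
    obtain u us' where u: "us = u # us'" "norm (u - w) < min \<delta> (d / 2)" "list_all2 (\<lambda>u w. norm (u - w) < min \<delta> (d / 2)) us' ws"
      using us by (cases us) auto
    then have "list_all2 (\<lambda>u w. norm (u - w) < \<delta>) us' ws" by (auto elim: list_all2_mono)
    then have "norm (gprod us' - gprod ws) < d / 2" by (rule \<delta>(2))
    then have "norm (u - w, gprod us' - gprod ws) < d"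
      using u(2) norm_Pair_le[of "u - w" "gprod us' - gprod ws"] by simp
    then show ?thesis using d(2)[of "(u, gprod us')"] u(1) by (simp add: dist_norm)
  qed
  then show ?case using \<delta>(1) d(1) by (intro exI[of _ "min \<delta> (d / 2)"]) auto
qed (auto intro: exI[of _ 1])

lemma borel_measurable_gprod:
  assumes "\<And>i. i \<in> set is \<Longrightarrow> f i \<in> borel_measurable N"
  shows "(\<lambda>\<omega>. gprod (map (\<lambda>i. f i \<omega>) is)) \<in> borel_measurable N"
  using assms
proof (induction "is")
  case (Cons i "is")
  have m: "(\<lambda>p. fst p \<otimes> snd p) \<in> borel_measurable borel"
    by (intro borel_measurable_continuous_onI smooth_continuous smooth_mult)
  have "(\<lambda>\<omega>. (f i \<omega>, gprod (map (\<lambda>i. f i \<omega>) is))) \<in> borel_measurable N"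
    using Cons by (intro borel_measurable_Pair) auto
  from measurable_compose[OF this m] show ?case by simp
qed simp

end

section \<open>The rescaled walk, its blocks and their Gaussian coordinates\<close>

locale carnot_walk = carnot_metric + prob_space M for M :: "'w measure" +
  fixes X :: "nat \<Rightarrow> 'w \<Rightarrow> 'a"
  assumes indep_X: "prob_space.indep_vars M (\<lambda>_. borel) X {1..}"
    and normal_X: "\<And>n. n \<ge> 1 \<Longrightarrow> standard_normal_on M (V 1) ip (X n)"
begin

definition walk :: "nat \<Rightarrow> 'w \<Rightarrow> 'a" where
  "walk n \<omega> = gprod (map (\<lambda>i. (1 / real n) *\<^sub>R X i \<omega>) [1..<Suc n])"

definition block :: "nat \<Rightarrow> nat \<Rightarrow> nat \<Rightarrow> 'w \<Rightarrow> 'a" where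
  "block n k j \<omega> = (\<Sum>i=Suc (j * (n div k))..<Suc (Suc j * (n div k)). (1 / real n) *\<^sub>R X i \<omega>)"

text \<open>Written with \<open>isom\<close> because \<open>ip\<close> is specified only on
  horizontal vectors, while this expression is continuous, hence measurable, on the whole
  space.\<close>

definition coord :: "nat \<Rightarrow> 'a \<Rightarrow> 'w \<Rightarrow> real" where
  "coord i b \<omega> = isom (X i \<omega>) \<bullet> isom b"

text \<open>Scaled to be standard normal; \<open>isom_block\<close> gives the factor
  \<open>sqrt m / n\<close>, with \<open>m = n div k\<close>, that leads back to the coordinates of
  the block.\<close>

definition block_coord :: "nat \<Rightarrow> nat \<Rightarrow> nat \<times> 'a \<Rightarrow> 'w \<Rightarrow> real" where
  "block_coord n k = (\<lambda>(j, b) \<omega>. (\<Sum>i=Suc (j * (n div k))..<Suc (Suc j * (n div k)). coord i b \<omega>) / sqrt (real (n div k)))"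

lemma X_V1: "n \<ge> 1 \<Longrightarrow> \<omega> \<in> space M \<Longrightarrow> X n \<omega> \<in> V 1"
  and X_measurable: "n \<ge> 1 \<Longrightarrow> X n \<in> borel_measurable M"
  using normal_X unfolding standard_normal_on_def by blast+

lemma onb_V1: "b \<in> onb \<Longrightarrow> b \<in> V 1"
  using onb(2) by (auto simp: orthonormal_basis_def)

lemma coord_eq: "n \<ge> 1 \<Longrightarrow> \<omega> \<in> space M \<Longrightarrow> b \<in> onb \<Longrightarrow> coord n b \<omega> = ip (X n \<omega>) b"
  by (simp add: coord_def isom(2)[OF X_V1 onb_V1])

lemma norm_isom_coords:
  assumes x: "x \<in> V 1"
  shows "(norm (isom x))\<^sup>2 = (\<Sum>b\<in>onb. (isom x \<bullet> isom b)\<^sup>2)"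
proof -
  have "ip x b = isom x \<bullet> isom b" if "b \<in> onb" for b
    using isom(2)[OF x onb_V1[OF that]] .
  then show ?thesis by (simp add: norm_isom[OF x])
qed

lemma borel_measurable_isom: "isom \<in> borel_measurable borel"
  by (intro borel_measurable_continuous_onI linear_continuous_on) (use isom(1) linear_conv_bounded_linear in blast)

lemma borel_measurable_coord: "n \<ge> 1 \<Longrightarrow> coord n b \<in> borel_measurable M"
  unfolding coord_def using measurable_compose[OF X_measurable borel_measurable_isom]
  by (intro borel_measurable_inner) auto

lemma distributed_coord:
  assumes "n \<ge> 1" "b \<in> onb"
  shows "distributed M lborel (coord n b) std_normal_density"
proof -
  have "distributed M lborel (\<lambda>\<omega>. ip (X n \<omega>) b) std_normal_density"
    using normal_X[OF assms(1)] onb(2) assms(2) unfolding standard_normal_on_def by blast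
  moreover have "distr M lborel (\<lambda>\<omega>. ip (X n \<omega>) b) = distr M lborel (coord n b)"
    using coord_eq assms by (intro distr_cong) auto
  ultimately show ?thesis
    using borel_measurable_coord[OF assms(1)] by (simp add: distributed_def)
qed

lemma indep_coord: "indep_vars (\<lambda>_. borel) (\<lambda>(i, b). coord i b) ({1..n} \<times> onb)"
proof -
  have "indep_vars (\<lambda>_. borel) (\<lambda>(i, b) \<omega>. isom (X i \<omega>) \<bullet> isom b) ({1..n} \<times> onb)"
  proof (rule indep_vars_pairs[where X=X and f="\<lambda>b x. isom x \<bullet> isom b"])
    show "indep_vars (\<lambda>_. borel) X {1..n}" by (rule indep_vars_subset[OF indep_X]) auto
    show "(\<lambda>x. isom x \<bullet> isom b) \<in> borel_measurable borel" for b
      using borel_measurable_isom by (intro borel_measurable_inner) auto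
    show "indep_vars (\<lambda>_. borel) (\<lambda>b \<omega>. isom (X i \<omega>) \<bullet> isom b) onb" if "i \<in> {1..n}" for i
    proof (rule indep_vars_cong_space)
      show "indep_vars (\<lambda>_. borel) (\<lambda>b \<omega>. ip (X i \<omega>) b) onb"
        using normal_X[of i] onb(2) that unfolding standard_normal_on_def by auto
    qed (use that coord_eq in \<open>auto simp: coord_def\<close>)
  qed (rule onb)
  then show ?thesis by (simp add: coord_def[abs_def])
qed

lemma block_indices:
  assumes "k > 0" "j < k"
  shows "{Suc (j * (n div k))..<Suc (Suc j * (n div k))} \<subseteq> {1..n}"
proof -
  have "Suc j * (n div k) \<le> k * (n div k)" using assms by (intro mult_right_mono) auto
  then have "Suc j * (n div k) \<le> n" using times_div_less_eq_dividend[of k n] by linarith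
  then show ?thesis by auto
qed

lemma block_coord_normal:
  assumes "k > 0" "k \<le> n"
  shows "indep_vars (\<lambda>_. borel) (block_coord n k) ({..<k} \<times> onb)"
    and "jb \<in> {..<k} \<times> onb \<Longrightarrow> distributed M lborel (block_coord n k jb) std_normal_density"
proof -
  let ?m = "n div k" and ?K = "\<lambda>j. {Suc (j * (n div k))..<Suc (Suc j * (n div k))}"
  have m: "?m > 0" using assms by (simp add: div_greater_zero_iff)
  have sub: "?K j \<subseteq> {1..n}" if "j \<in> {..<k}" for j using block_indices[OF assms(1)] that by auto
  have disj: "disjoint_family_on ?K {..<k}"
    unfolding disjoint_family_on_def
  proof (intro ballI impI)
    fix i j :: nat assume "i \<noteq> j"
    have "?K p \<inter> ?K q = {}" if "p < q" for p q
    proof -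
      have "Suc p * ?m \<le> q * ?m" using that by (intro mult_right_mono) auto
      then show ?thesis by auto
    qed
    then show "?K i \<inter> ?K j = {}" using \<open>i \<noteq> j\<close> by (metis Int_commute linorder_neqE_nat)
  qed
  note bs = std_normal_block_sums[where K="?K" and J="{..<k}" and I="{1..n}" and B=onb and m="?m" and Z=coord,
      OF indep_coord distributed_coord sub disj _ _ m]
  show "indep_vars (\<lambda>_. borel) (block_coord n k) ({..<k} \<times> onb)"
    unfolding block_coord_def by (rule bs(1)) auto
  show "distributed M lborel (block_coord n k jb) std_normal_density" if "jb \<in> {..<k} \<times> onb"
    using that bs(2)[of "fst jb" "snd jb"] by (auto simp: block_coord_def case_prod_unfold)
qed

lemma block_V1:
  assumes "\<omega> \<in> space M" 
  shows "block n k j \<omega> \<in> V 1"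
  unfolding block_def using assms X_V1
  by (intro subspace_sum[OF subspace_V1] subspace_scale[OF subspace_V1]) auto

lemma isom_block:
  assumes "k > 0" "k \<le> n"
  shows "isom (block n k j \<omega>) \<bullet> isom b = sqrt (real (n div k)) / real n * block_coord n k (j, b) \<omega>"
proof -
  have "n div k > 0" using assms by (simp add: div_greater_zero_iff)
  then show ?thesis
    by (simp add: block_def block_coord_def coord_def linear_sum[OF isom(1)] linear_scale[OF isom(1)]
        inner_sum_left sum_distrib_left[symmetric] sum_divide_distrib[symmetric] del: sum.op_ivl_Suc)
qed

lemma norm_isom_block:
  assumes "k > 0" "k \<le> n" "\<omega> \<in> space M"
  shows "(norm (isom (block n k j \<omega>)))\<^sup>2 = real (n div k) / (real n)\<^sup>2 * (\<Sum>b\<in>onb. (block_coord n k (j, b) \<omega>)\<^sup>2)"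
  by (simp add: norm_isom_coords[OF block_V1[OF assms(3)]] isom_block[OF assms(1,2)]
      power_mult_distrib power_divide sum_distrib_left)

text \<open>The Chebyshev bound at \<open>s = 1/2\<close> over all coordinates of the first
  \<open>n\<close> steps. The prefactor is \<open>exp (n * D)\<close>, so \<open>R\<close>, chosen
  independently of \<open>n\<close>, has to outweigh \<open>D\<close> as well as
  \<open>K\<close>.\<close>

lemma energy_tail:
  "\<exists>R\<ge>0. \<forall>n. prob {\<omega> \<in> space M. real n * R\<^sup>2 \<le> (\<Sum>i=1..n. (norm (isom (X i \<omega>)))\<^sup>2)} \<le> exp (- real n * K)"
proof -
  define D where "D = real (card onb) * ln (sqrt 2)"
  \<comment> \<open>The factor 4 comes from the exponent, which at \<open>s = 1/2\<close> is
    \<open>- n * R\<^sup>2 / 4\<close>.\<close>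
  define R where "R = sqrt (4 * (\<bar>K\<bar> + D))"
  have D: "D \<ge> 0" by (simp add: D_def)
  have R: "R \<ge> 0" "R\<^sup>2 = 4 * (\<bar>K\<bar> + D)" using D by (auto simp: R_def)
  have "prob {\<omega> \<in> space M. real n * R\<^sup>2 \<le> (\<Sum>i=1..n. (norm (isom (X i \<omega>)))\<^sup>2)} \<le> exp (- real n * K)" for n
  proof -
    let ?A = "{1..n} \<times> onb"
    have fin: "finite ?A" using onb by simp
    have "prob {\<omega> \<in> space M. 2 * (real n * R\<^sup>2 / 2) \<le> (\<Sum>a\<in>?A. ((\<lambda>(i, b). coord i b) a \<omega>)\<^sup>2)}
        \<le> exp (- (1/2) * (real n * R\<^sup>2 / 2)) * (1 / sqrt (1 - 1/2)) ^ card ?A"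
      by (rule std_normal_sum_squares_tail[OF fin indep_coord]) (auto intro: distributed_coord)
    also have "(1 / sqrt (1 - 1/2)) ^ card ?A = exp (real n * D)"
    proof -
      have "1 / sqrt (1 - 1/2) = sqrt 2" by (simp add: real_sqrt_divide)
      moreover have "sqrt 2 ^ card ?A = exp (real (card ?A) * ln (sqrt 2))"
        by (subst exp_of_nat_mult) simp
      moreover have "real (card ?A) = real n * real (card onb)" by (simp add: card_cartesian_product)
      ultimately show ?thesis by (simp add: D_def mult.assoc)
    qed
    also have "exp (- (1/2) * (real n * R\<^sup>2 / 2)) * exp (real n * D) = exp (- real n * \<bar>K\<bar>)"
    proof -
      have "- (1/2) * (real n * R\<^sup>2 / 2) + real n * D = - real n * \<bar>K\<bar>"
        by (simp add: R(2)) (simp add: field_simps)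
      then show ?thesis by (simp only: mult_exp_exp)
    qed
    also have "\<dots> \<le> exp (- real n * K)" by (simp add: mult_left_mono)
    also have "{\<omega> \<in> space M. 2 * (real n * R\<^sup>2 / 2) \<le> (\<Sum>a\<in>?A. ((\<lambda>(i, b). coord i b) a \<omega>)\<^sup>2)}
        = {\<omega> \<in> space M. real n * R\<^sup>2 \<le> (\<Sum>i=1..n. (norm (isom (X i \<omega>)))\<^sup>2)}"
    proof -
      have "(\<Sum>a\<in>?A. ((\<lambda>(i, b). coord i b) a \<omega>)\<^sup>2) = (\<Sum>i=1..n. (norm (isom (X i \<omega>)))\<^sup>2)" if "\<omega> \<in> space M" for \<omega>
      proof -
        have "(\<Sum>a\<in>?A. ((\<lambda>(i, b). coord i b) a \<omega>)\<^sup>2) = (\<Sum>i=1..n. \<Sum>b\<in>onb. (coord i b \<omega>)\<^sup>2)"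
          by (simp add: sum.cartesian_product case_prod_unfold)
        also have "\<dots> = (\<Sum>i=1..n. (norm (isom (X i \<omega>)))\<^sup>2)"
          using X_V1 that by (intro sum.cong refl) (simp add: norm_isom_coords coord_def)
        finally show ?thesis .
      qed
      then show ?thesis by auto
    qed
    finally show ?thesis .
  qed
  with R(1) show ?thesis by blast
qed

lemma walk_measurable: "walk n \<in> borel_measurable M"
  unfolding walk_def using X_measurable by (intro borel_measurable_gprod borel_measurable_scaleR) auto

lemma walk_block_approximation:
  assumes "R \<ge> 0"
  shows "\<exists>C\<ge>0. \<forall>n k \<omega>. k > 0 \<longrightarrow> k\<^sup>2 \<le> n \<longrightarrow> \<omega> \<in> space M \<longrightarrow>
    (\<Sum>i=1..n. (norm (isom (X i \<omega>)))\<^sup>2) \<le> real n * R\<^sup>2 \<longrightarrow>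
    norm (walk n \<omega> - gprod (map (\<lambda>j. block n k j \<omega>) [0..<k])) \<le> C / sqrt (real k)
    \<and> norm (walk n \<omega>) \<le> C \<and> norm (gprod (map (\<lambda>j. block n k j \<omega>) [0..<k])) \<le> C"
proof -
  obtain C where C: "C \<ge> 0" "\<And>n k m v. k > 0 \<Longrightarrow> k\<^sup>2 \<le> n \<Longrightarrow> m = n div k \<Longrightarrow> (\<forall>i\<in>{1..n}. v i \<in> V 1) \<Longrightarrow>
    (\<Sum>i=1..n. (norm (isom (v i)))\<^sup>2) \<le> R\<^sup>2 / real n \<Longrightarrow>
    norm (gprod (map v [1..<Suc n]) - gprod (map (\<lambda>j. \<Sum>i=Suc (j * m)..<Suc (Suc j * m). v i) [0..<k])) \<le> C / sqrt (real k)
    \<and> norm (gprod (map v [1..<Suc n])) \<le> C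
    \<and> norm (gprod (map (\<lambda>j. \<Sum>i=Suc (j * m)..<Suc (Suc j * m). v i) [0..<k])) \<le> C"
    using block_approximation[OF assms] by blast
  have "norm (walk n \<omega> - gprod (map (\<lambda>j. block n k j \<omega>) [0..<k])) \<le> C / sqrt (real k)
    \<and> norm (walk n \<omega>) \<le> C \<and> norm (gprod (map (\<lambda>j. block n k j \<omega>) [0..<k])) \<le> C"
    if k: "k > 0" "k\<^sup>2 \<le> n" and \<omega>: "\<omega> \<in> space M" and E: "(\<Sum>i=1..n. (norm (isom (X i \<omega>)))\<^sup>2) \<le> real n * R\<^sup>2" for n k \<omega>
    unfolding walk_def block_def
  proof (rule C(2)[OF k refl])
    have n: "n > 0" using k by (cases n) auto
    show "\<forall>i\<in>{1..n}. (1 / real n) *\<^sub>R X i \<omega> \<in> V 1"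
      using X_V1 \<omega> subspace_scale[OF subspace_V1] by auto
    have "(\<Sum>i=1..n. (norm (isom ((1 / real n) *\<^sub>R X i \<omega>)))\<^sup>2) = (\<Sum>i=1..n. (norm (isom (X i \<omega>)))\<^sup>2) / (real n)\<^sup>2"
      by (simp add: power_divide sum_divide_distrib)
    also have "\<dots> \<le> (real n * R\<^sup>2) / (real n)\<^sup>2" using E by (intro divide_right_mono) auto
    also have "\<dots> = R\<^sup>2 / real n" using n by (simp add: power2_eq_square)
    finally show "(\<Sum>i=1..n. (norm (isom ((1 / real n) *\<^sub>R X i \<omega>)))\<^sup>2) \<le> R\<^sup>2 / real n" .
  qed
  with C(1) show ?thesis by blast
qed

lemma block_product_reach:
  assumes "\<omega> \<in> space M"
  shows "reach (\<Sum>j<k. norm (isom (block n k j \<omega>))) (gprod (map (\<lambda>j. block n k j \<omega>) [0..<k]))"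
proof -
  have "set (map (\<lambda>j. block n k j \<omega>) [0..<k]) \<subseteq> V 1" using block_V1[OF assms] by auto
  from reach_gprod[OF this] show ?thesis by (simp only: len_map_upt atLeast0LessThan)
qed

text \<open>If the walk lies in \<open>F\<close> and the energy is moderate, the block product
  becomes a point of \<open>F\<close> after a correction of length \<open>L - L0\<close>. So the
  blocks have total length at least \<open>L0\<close>, and a sum of squared standard normals must be
  large.\<close>

lemma upper_bound:
  assumes F: "F \<in> sets borel" and L: "\<And>x l. x \<in> F \<Longrightarrow> reach l x \<Longrightarrow> L \<le> l" "L \<ge> 0" and a: "0 \<le> a" "a < L\<^sup>2 / 2"
  shows "\<forall>\<^sub>F n in sequentially. prob {\<omega> \<in> space M. walk n \<omega> \<in> F} \<le> exp (- real n * a)"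
proof -
  define a' where "a' = (a + L\<^sup>2 / 2) / 2"
  have a': "a < a'" "a' < L\<^sup>2 / 2" "a' > 0" using a by (auto simp: a'_def)
  define L0 where "L0 = sqrt (2 * a')"
  have L0: "L0 \<ge> 0" "L0\<^sup>2 = 2 * a'" using a' by (auto simp: L0_def)
  have "L0\<^sup>2 < L\<^sup>2" using L0(2) a'(2) by linarith
  then have "L0 < L" using L(2) by (rule power2_less_imp_less)
  \<comment> \<open>The midpoint of \<open>a / a'\<close> and 1, so that \<open>s * a'\<close> still
    exceeds \<open>a\<close>.\<close>
  define s where "s = (a / a' + 1) / 2"
  have s: "0 < s" "s < 1" "s * a' > a" using a a' by (auto simp: s_def field_simps)
  obtain R where R: "R \<ge> 0" "\<And>n. prob {\<omega> \<in> space M. real n * R\<^sup>2 \<le> (\<Sum>i=1..n. (norm (isom (X i \<omega>)))\<^sup>2)} \<le> exp (- real n * (a + 1))"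
    using energy_tail[of "a + 1"] by blast
  obtain C where C: "C \<ge> 0" "\<And>n k \<omega>. k > 0 \<Longrightarrow> k\<^sup>2 \<le> n \<Longrightarrow> \<omega> \<in> space M \<Longrightarrow>
    (\<Sum>i=1..n. (norm (isom (X i \<omega>)))\<^sup>2) \<le> real n * R\<^sup>2 \<Longrightarrow>
    norm (walk n \<omega> - gprod (map (\<lambda>j. block n k j \<omega>) [0..<k])) \<le> C / sqrt (real k)
    \<and> norm (walk n \<omega>) \<le> C \<and> norm (gprod (map (\<lambda>j. block n k j \<omega>) [0..<k])) \<le> C"
    using walk_block_approximation[OF R(1)] by blast
  obtain \<eta> where \<eta>: "\<eta> > 0" "\<And>x y. norm x \<le> C \<Longrightarrow> norm y \<le> C \<Longrightarrow> norm (x - y) < \<eta> \<Longrightarrow> reach (L - L0) (- x \<otimes> y)"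
    using reach_close[of "L - L0" C] \<open>L0 < L\<close> by auto
  obtain k0 where k0: "(C / \<eta>)\<^sup>2 < real k0" using reals_Archimedean2 by blast
  \<comment> \<open>Makes the block approximation finer than \<open>\<eta>\<close>. It does not
    depend on \<open>n\<close>, so the prefactor of the tail bound is a constant.\<close>
  define k where "k = Suc k0"
  have k: "k > 0" "C / sqrt (real k) < \<eta>"
  proof -
    have "sqrt ((C / \<eta>)\<^sup>2) < sqrt (real k)" using k0 by (intro real_sqrt_less_mono) (simp add: k_def)
    then have "C / \<eta> < sqrt (real k)" using C(1) \<eta>(1) by simp
    then show "k > 0" "C / sqrt (real k) < \<eta>" using \<eta>(1) by (auto simp: k_def field_simps)
  qed
  let ?A = "{..<k} \<times> onb"
  have "\<forall>\<^sub>F n in sequentially. exp (- real n * (a + 1)) + exp (- real n * (s * a')) * (1 / sqrt (1 - s)) ^ card ?A \<le> exp (- real n * a)"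
    using s by (intro eventually_exp_upper) auto
  moreover have "\<forall>\<^sub>F n in sequentially. k\<^sup>2 \<le> n" by (rule eventually_ge_at_top)
  ultimately show ?thesis
  proof eventually_elim
    case (elim n)
    have "k * k \<le> n" using elim(2) by (simp only: power2_eq_square)
    then have kn: "k \<le> n" "n > 0" using le_square[of k] k(1) by linarith+
    let ?E1 = "{\<omega> \<in> space M. real n * R\<^sup>2 \<le> (\<Sum>i=1..n. (norm (isom (X i \<omega>)))\<^sup>2)}"
    let ?E2 = "{\<omega> \<in> space M. 2 * (real n * a') \<le> (\<Sum>jb\<in>?A. (block_coord n k jb \<omega>)\<^sup>2)}"
    have bm: "block_coord n k jb \<in> borel_measurable M" if "jb \<in> ?A" for jb
      using block_coord_normal(1)[OF k(1) kn(1)] that unfolding indep_vars_def2 by blast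
    have E1: "?E1 \<in> events"
    proof -
      have "(\<lambda>\<omega>. \<Sum>i=1..n. (norm (isom (X i \<omega>)))\<^sup>2) \<in> borel_measurable M"
        using measurable_compose[OF X_measurable borel_measurable_isom]
        by (intro borel_measurable_sum borel_measurable_power borel_measurable_norm) auto
      then show ?thesis by measurable
    qed
    have E2: "?E2 \<in> events"
    proof -
      have "(\<lambda>\<omega>. \<Sum>jb\<in>?A. (block_coord n k jb \<omega>)\<^sup>2) \<in> borel_measurable M"
        using bm by (intro borel_measurable_sum borel_measurable_power) auto
      then show ?thesis by measurable
    qed
    have "{\<omega> \<in> space M. walk n \<omega> \<in> F} \<subseteq> ?E1 \<union> ?E2"
    proof
      fix \<omega> assume "\<omega> \<in> {\<omega> \<in> space M. walk n \<omega> \<in> F}"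
      then have \<omega>: "\<omega> \<in> space M" "walk n \<omega> \<in> F" by auto
      show "\<omega> \<in> ?E1 \<union> ?E2"
      proof (cases "\<omega> \<in> ?E1")
        case False
        let ?q = "gprod (map (\<lambda>j. block n k j \<omega>) [0..<k])"
        let ?l = "\<lambda>j. norm (isom (block n k j \<omega>))"
        have ap: "norm (walk n \<omega> - ?q) \<le> C / sqrt (real k)" "norm (walk n \<omega>) \<le> C" "norm ?q \<le> C"
          using C(2)[OF k(1) elim(2) \<omega>(1)] False \<omega>(1) by auto
        then have "reach (L - L0) (- ?q \<otimes> walk n \<omega>)"
          using k(2) by (intro \<eta>(2)) (auto simp: norm_minus_commute)
        from reach_mult[OF block_product_reach[OF \<omega>(1), where n=n and k=k] this]
        have "reach ((\<Sum>j<k. ?l j) + (L - L0)) (walk n \<omega>)" by simp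
        then have "L0 \<le> (\<Sum>j<k. ?l j)" using L(1)[OF \<omega>(2)] by fastforce
        then have "2 * a' \<le> (\<Sum>j<k. ?l j)\<^sup>2" using L0 by (metis power_mono)
        also have "\<dots> \<le> (\<Sum>j<k. (?l j)\<^sup>2) * real k"
          using sum_squared_le_sum_of_squares[of ?l "{..<k}"] by simp
        also have "(\<Sum>j<k. (?l j)\<^sup>2) = real (n div k) / (real n)\<^sup>2 * (\<Sum>jb\<in>?A. (block_coord n k jb \<omega>)\<^sup>2)"
        proof -
          have "(\<Sum>j<k. \<Sum>b\<in>onb. (block_coord n k (j, b) \<omega>)\<^sup>2) = (\<Sum>jb\<in>?A. (block_coord n k jb \<omega>)\<^sup>2)"
            by (simp add: sum.cartesian_product case_prod_unfold)
          then show ?thesis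
            by (simp only: norm_isom_block[OF k(1) kn(1) \<omega>(1)] sum_distrib_left[symmetric])
        qed
        also have "\<dots> * real k = (real (n div k) * real k) / (real n)\<^sup>2 * (\<Sum>jb\<in>?A. (block_coord n k jb \<omega>)\<^sup>2)"
          by simp
        \<comment> \<open>The factor \<open>k\<close> came from Cauchy-Schwarz over the blocks;
          \<open>(n div k) * k \<le> n\<close> shows that rounding the block length works in the
          right direction.\<close>
        also have "\<dots> \<le> real n / (real n)\<^sup>2 * (\<Sum>jb\<in>?A. (block_coord n k jb \<omega>)\<^sup>2)"
        proof (intro mult_right_mono divide_right_mono sum_nonneg)
          have "n div k * k \<le> n" by simp
          then show "real (n div k) * real k \<le> real n" by (metis of_nat_le_iff of_nat_mult)
        qed auto
        finally have "2 * a' * real n \<le> (\<Sum>jb\<in>?A. (block_coord n k jb \<omega>)\<^sup>2)"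
          using kn(2) by (simp add: power2_eq_square field_simps)
        then show ?thesis using \<omega>(1) by (simp add: mult_ac)
      qed simp
    qed
    then have "prob {\<omega> \<in> space M. walk n \<omega> \<in> F} \<le> prob (?E1 \<union> ?E2)"
      using E1 E2 by (intro finite_measure_mono) auto
    also have "\<dots> \<le> prob ?E1 + prob ?E2" by (rule measure_Un_le[OF E1 E2])
    also have "\<dots> \<le> exp (- real n * (a + 1)) + exp (- s * (real n * a')) * (1 / sqrt (1 - s)) ^ card ?A"
      using block_coord_normal[OF k(1) kn(1)] onb(1)
      by (intro add_mono R(2) std_normal_sum_squares_tail s) auto
    also have "- s * (real n * a') = - real n * (s * a')" by simp
    finally show ?case using elim(1) by linarith
  qed
qed

text \<open>The point \<open>x\<close> is written as a product of \<open>k\<close> short factors of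
  nearly minimal total length, and the blocks are forced to be close to these factors. The energy
  event is then removed at a cost of smaller exponential order.\<close>

lemma lower_bound:
  assumes U: "open U" "x \<in> U" and L: "reach L x" "L\<^sup>2 / 2 < a"
  shows "\<forall>\<^sub>F n in sequentially. exp (- real n * a) \<le> prob {\<omega> \<in> space M. walk n \<omega> \<in> U}"
proof -
  have L_0: "L \<ge> 0" using L(1) by (rule reach_nonneg)
  \<comment> \<open>\<open>L'\<^sup>2 / 2\<close> is the midpoint \<open>a1\<close> of
    \<open>L\<^sup>2 / 2\<close> and \<open>a\<close>.\<close>
  define L' where "L' = sqrt (L\<^sup>2 / 2 + a)"
  define a1 where "a1 = (L\<^sup>2 / 2 + a) / 2"
  have a_pos: "a > 0" using L(2) zero_le_power2[of L] by linarith
  have L': "L' \<ge> 0" "L'\<^sup>2 = 2 * a1" "a1 < a" "a1 > 0" using L(2) a_pos by (auto simp: L'_def a1_def add_nonneg_pos)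
  have "L\<^sup>2 < L'\<^sup>2" unfolding L'(2) a1_def using L(2) by simp
  then have "L < L'" using L'(1) by (rule power2_less_imp_less)
  obtain \<epsilon> where \<epsilon>: "\<epsilon> > 0" "ball x \<epsilon> \<subseteq> U" using U open_contains_ball by blast
  obtain R where R: "R \<ge> 0" "\<And>n. prob {\<omega> \<in> space M. real n * R\<^sup>2 \<le> (\<Sum>i=1..n. (norm (isom (X i \<omega>)))\<^sup>2)} \<le> exp (- real n * (a + 1))"
    using energy_tail[of "a + 1"] by blast
  obtain C where C: "C \<ge> 0" "\<And>n k \<omega>. k > 0 \<Longrightarrow> k\<^sup>2 \<le> n \<Longrightarrow> \<omega> \<in> space M \<Longrightarrow>
    (\<Sum>i=1..n. (norm (isom (X i \<omega>)))\<^sup>2) \<le> real n * R\<^sup>2 \<Longrightarrow>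
    norm (walk n \<omega> - gprod (map (\<lambda>j. block n k j \<omega>) [0..<k])) \<le> C / sqrt (real k)
    \<and> norm (walk n \<omega>) \<le> C \<and> norm (gprod (map (\<lambda>j. block n k j \<omega>) [0..<k])) \<le> C"
    using walk_block_approximation[OF R(1)] by blast
  obtain K0 where K0: "\<And>k. k \<ge> K0 \<Longrightarrow> \<exists>ws. length ws = k \<and> set ws \<subseteq> V 1 \<and> (\<forall>w\<in>set ws. norm (isom w) \<le> L' / real k) \<and> gprod ws = x"
    using reach_equal_factors[OF L(1) \<open>L < L'\<close>] by blast
  obtain k0 where k0: "(2 * C / \<epsilon>)\<^sup>2 < real k0" using reals_Archimedean2 by blast
  define k where "k = Suc (k0 + K0)"
  have k: "k > 0" "k \<ge> K0" "C / sqrt (real k) < \<epsilon> / 2"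
  proof -
    have "sqrt ((2 * C / \<epsilon>)\<^sup>2) < sqrt (real k)" using k0 by (intro real_sqrt_less_mono) (simp add: k_def)
    then have "2 * C / \<epsilon> < sqrt (real k)" using C(1) \<epsilon>(1) by simp
    then show "k > 0" "k \<ge> K0" "C / sqrt (real k) < \<epsilon> / 2" using \<epsilon>(1) by (auto simp: k_def field_simps)
  qed
  obtain ws where ws: "length ws = k" "set ws \<subseteq> V 1" "\<And>w. w \<in> set ws \<Longrightarrow> norm (isom w) \<le> L' / real k" "gprod ws = x"
    using K0[OF k(2)] by blast
  obtain \<delta> where \<delta>: "\<delta> > 0" "\<And>us. list_all2 (\<lambda>u w. norm (u - w) < \<delta>) us ws \<Longrightarrow> norm (gprod us - gprod ws) < \<epsilon> / 2"
    using gprod_continuous[of "\<epsilon> / 2" ws] \<epsilon>(1) by auto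
  define d where "d = real (card onb)"
  \<comment> \<open>Chosen so that \<open>a2\<close> is the midpoint of \<open>a1\<close> and
    \<open>a\<close>. The factor \<open>1 + \<theta>\<close> is what it costs to replace
    \<open>\<bar>y\<bar> + 1\<close> by \<open>\<bar>y\<bar>\<close> in the Gaussian
    exponent.\<close>
  define \<theta> where "\<theta> = (a / a1 - 1) / 2"
  define a2 where "a2 = (1 + \<theta>) * a1"
  have \<theta>: "\<theta> > 0" "a2 < a" using L' by (auto simp: \<theta>_def a2_def field_simps)
  let ?A = "{..<k} \<times> onb"
  have finA: "finite ?A" using onb(1) by simp
  \<comment> \<open>Everything that does not grow with \<open>n\<close>: the normalizations, the
    excess \<open>2 * k\<close> from rounding the block length, and the additive constants of the
    estimate \<open>sq\<close> below.\<close>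
  define c where "c = (2 / sqrt (2 * pi)) ^ card ?A * exp (- ((1 + \<theta>) * (real k * L'\<^sup>2) + real (card ?A) * (1 + 1 / \<theta>) / 2))"
  have c: "c > 0" by (simp add: c_def)
  have "(\<lambda>n. lc * sqrt (d / real n)) \<longlonglongrightarrow> lc * sqrt 0"
    by (intro tendsto_intros lim_const_over_n)
  then have "\<forall>\<^sub>F n in sequentially. lc * sqrt (d / real n) < \<delta>"
    using \<delta>(1) by (intro order_tendstoD(2)) auto
  moreover have "\<forall>\<^sub>F n in sequentially. exp (- real n * a) \<le> c * exp (- real n * a2) - exp (- real n * (a + 1))"
    using \<theta> c by (intro eventually_exp_lower) auto
  moreover have "\<forall>\<^sub>F n in sequentially. k\<^sup>2 \<le> n" by (rule eventually_ge_at_top)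
  ultimately show ?thesis
  proof eventually_elim
    case (elim n)
    have "k * k \<le> n" using elim(3) by (simp only: power2_eq_square)
    then have kn: "k \<le> n" "n > 0" using le_square[of k] k(1) by linarith+
    define m where "m = n div k"
    have m: "m > 0" using kn(1) k(1) by (simp add: m_def div_greater_zero_iff)
    have mk: "real m * real k \<le> real n" "real n \<le> real m * real k + real k"
    proof -
      have "m * k \<le> n" "n \<le> m * k + k"
        using dividend_less_times_div[OF k(1), of n] by (simp_all add: m_def mult.commute)
      then show "real m * real k \<le> real n" "real n \<le> real m * real k + real k"
        by (metis of_nat_le_iff of_nat_mult, metis of_nat_le_iff of_nat_mult of_nat_add)
    qed
    \<comment> \<open>The value of \<open>block_coord\<close> for which the \<open>j\<close>-th
      block equals \<open>ws ! j\<close>. An error of at most 1 per coordinate moves the block by at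
      most \<open>lc * sqrt (d / n)\<close>, which tends to 0.\<close>
    define y where "y = (\<lambda>(j, b). real n / sqrt (real m) * (isom (ws ! j) \<bullet> isom b))"
    let ?N = "{\<omega> \<in> space M. \<forall>jb\<in>?A. \<bar>block_coord n k jb \<omega> - y jb\<bar> \<le> 1}"
    let ?E1 = "{\<omega> \<in> space M. real n * R\<^sup>2 \<le> (\<Sum>i=1..n. (norm (isom (X i \<omega>)))\<^sup>2)}"
    let ?W = "{\<omega> \<in> space M. walk n \<omega> \<in> U}"
    have E1: "?E1 \<in> events"
    proof -
      have "(\<lambda>\<omega>. \<Sum>i=1..n. (norm (isom (X i \<omega>)))\<^sup>2) \<in> borel_measurable M"
        using measurable_compose[OF X_measurable borel_measurable_isom]
        by (intro borel_measurable_sum borel_measurable_power borel_measurable_norm) auto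
      then show ?thesis by measurable
    qed
    have W: "?W \<in> events"
      using measurable_sets[OF walk_measurable, of U n] U(1) by (simp add: vimage_def Int_def conj_commute)
    have "?N \<subseteq> ?W \<union> ?E1"
    proof
      fix \<omega> assume "\<omega> \<in> ?N"
      then have \<omega>: "\<omega> \<in> space M" "\<And>j b. j < k \<Longrightarrow> b \<in> onb \<Longrightarrow> \<bar>block_coord n k (j, b) \<omega> - y (j, b)\<bar> \<le> 1" by auto
      show "\<omega> \<in> ?W \<union> ?E1"
      proof (cases "\<omega> \<in> ?E1")
        case False
        let ?q = "gprod (map (\<lambda>j. block n k j \<omega>) [0..<k])"
        have "norm (block n k j \<omega> - ws ! j) < \<delta>" if j: "j < k" for j
        proof -
          have wj: "ws ! j \<in> V 1" using ws(1,2) j by auto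
          have dV: "block n k j \<omega> - ws ! j \<in> V 1" by (intro subspace_diff subspace_V1 block_V1 \<omega>(1) wj)
          have "(norm (isom (block n k j \<omega> - ws ! j)))\<^sup>2 = (\<Sum>b\<in>onb. (isom (block n k j \<omega> - ws ! j) \<bullet> isom b)\<^sup>2)"
            by (rule norm_isom_coords[OF dV])
          also have "\<dots> \<le> (\<Sum>b\<in>onb. 1 / real n)"
          proof (rule sum_mono)
            fix b assume b: "b \<in> onb"
            have "isom (block n k j \<omega> - ws ! j) \<bullet> isom b = sqrt (real m) / real n * (block_coord n k (j, b) \<omega> - y (j, b))"
              using m kn(2) by (simp add: linear_diff[OF isom(1)] inner_diff_left isom_block[OF k(1) kn(1)] m_def[symmetric] y_def right_diff_distrib)
            then have "(isom (block n k j \<omega> - ws ! j) \<bullet> isom b)\<^sup>2 = real m / (real n)\<^sup>2 * (block_coord n k (j, b) \<omega> - y (j, b))\<^sup>2"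
              by (simp add: power_mult_distrib power_divide)
            also have "\<dots> \<le> real n / (real n)\<^sup>2 * 1"
            proof (intro mult_mono divide_right_mono)
              show "real m \<le> real n" by (simp add: m_def)
              show "(block_coord n k (j, b) \<omega> - y (j, b))\<^sup>2 \<le> 1" using \<omega>(2)[OF j b] by (simp add: abs_square_le_1)
            qed auto
            finally show "(isom (block n k j \<omega> - ws ! j) \<bullet> isom b)\<^sup>2 \<le> 1 / real n" using kn(2) by (simp add: power2_eq_square)
          qed
          also have "\<dots> = d / real n" by (simp add: d_def)
          finally have "norm (isom (block n k j \<omega> - ws ! j)) \<le> sqrt (d / real n)" by (rule real_le_rsqrt)
          then have "lc * norm (isom (block n k j \<omega> - ws ! j)) \<le> lc * sqrt (d / real n)" using lc(1) by (intro mult_left_mono) auto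
          then show ?thesis using lc(2)[OF dV] elim(1) by linarith
        qed
        then have "list_all2 (\<lambda>u w. norm (u - w) < \<delta>) (map (\<lambda>j. block n k j \<omega>) [0..<k]) ws"
          using ws(1) by (simp add: list_all2_conv_all_nth)
        then have "norm (?q - x) < \<epsilon> / 2" using \<delta>(2) ws(4) by blast
        moreover have "norm (walk n \<omega> - ?q) \<le> C / sqrt (real k)"
          using C(2)[OF k(1) elim(3) \<omega>(1)] False \<omega>(1) by auto
        then have "norm (walk n \<omega> - ?q) < \<epsilon> / 2" using k(3) by linarith
        ultimately have "norm (walk n \<omega> - x) < \<epsilon>"
          using norm_triangle_ineq[of "walk n \<omega> - ?q" "?q - x"] by simp
        then have "walk n \<omega> \<in> ball x \<epsilon>" by (simp add: dist_norm norm_minus_commute)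
        then show ?thesis using \<epsilon>(2) \<omega>(1) by auto
      qed simp
    qed
    then have "prob ?N \<le> prob (?W \<union> ?E1)" using E1 W by (intro finite_measure_mono) auto
    also have "\<dots> \<le> prob ?W + prob ?E1" by (rule measure_Un_le[OF W E1])
    finally have N_le: "prob ?N \<le> prob ?W + exp (- real n * (a + 1))" using R(2)[of n] by linarith
    \<comment> \<open>The blocks cover only \<open>m * k\<close> of the \<open>n\<close> steps and
      must make up for the rest. This turns \<open>n\<close> into
      \<open>n\<^sup>2 / (m * k)\<close>, which exceeds it by at most \<open>2 * k\<close>.\<close>
    have sum_y: "(\<Sum>jb\<in>?A. (y jb)\<^sup>2) \<le> real n * L'\<^sup>2 + 2 * (real k * L'\<^sup>2)"
    proof -
      have "(\<Sum>jb\<in>?A. (y jb)\<^sup>2) = (\<Sum>j<k. \<Sum>b\<in>onb. (real n)\<^sup>2 / real m * (isom (ws ! j) \<bullet> isom b)\<^sup>2)"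
        using m by (simp add: sum.cartesian_product y_def case_prod_unfold power_mult_distrib power_divide)
      also have "\<dots> = (\<Sum>j<k. (real n)\<^sup>2 / real m * (norm (isom (ws ! j)))\<^sup>2)"
      proof (intro sum.cong refl)
        fix j assume "j \<in> {..<k}"
        then have "ws ! j \<in> V 1" using ws(1,2) by auto
        then show "(\<Sum>b\<in>onb. (real n)\<^sup>2 / real m * (isom (ws ! j) \<bullet> isom b)\<^sup>2) = (real n)\<^sup>2 / real m * (norm (isom (ws ! j)))\<^sup>2"
          by (simp only: sum_distrib_left[symmetric] norm_isom_coords)
      qed
      also have "\<dots> \<le> (\<Sum>j<k. (real n)\<^sup>2 / real m * (L' / real k)\<^sup>2)"
        using ws(1,3) by (intro sum_mono mult_left_mono power_mono) auto
      also have "\<dots> = (real n)\<^sup>2 / (real m * real k) * L'\<^sup>2"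
        using k(1) by (simp add: power_divide power2_eq_square)
      also have "\<dots> \<le> (real n + 2 * real k) * L'\<^sup>2"
      proof (rule mult_right_mono)
        have m1: "1 \<le> real m" using m by simp
        have "real n * real n \<le> real n * (real m * real k) + real n * real k"
          using mult_left_mono[OF mk(2), of "real n"] by (simp add: distrib_left)
        moreover have "real n * real k \<le> (2 * (real m * real k)) * real k"
          using mk(2) mult_right_mono[OF m1, of "real k"] by (intro mult_right_mono) auto
        ultimately have "(real n)\<^sup>2 \<le> (real n + 2 * real k) * (real m * real k)"
          by (simp add: power2_eq_square algebra_simps)
        then show "(real n)\<^sup>2 / (real m * real k) \<le> real n + 2 * real k"
          using m k(1) by (simp add: pos_divide_le_eq)
      qed simp
      finally show ?thesis by (simp add: distrib_right)
    qed
    have "c * exp (- real n * a2) \<le> (\<Prod>jb\<in>?A. 2 / sqrt (2 * pi) * exp (- (\<bar>y jb\<bar> + 1)\<^sup>2 / 2))"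
    proof -
      \<comment> \<open>Weighted Young inequality for the mixed term
        \<open>2 * \<bar>u\<bar>\<close>.\<close>
      have sq: "(\<bar>u\<bar> + 1)\<^sup>2 \<le> (1 + \<theta>) * u\<^sup>2 + (1 + 1 / \<theta>)" for u :: real
      proof -
        have "0 \<le> (\<theta> * \<bar>u\<bar> - 1)\<^sup>2 / \<theta>" using \<theta>(1) by simp
        also have "(\<theta> * \<bar>u\<bar> - 1)\<^sup>2 / \<theta> = \<theta> * u\<^sup>2 - 2 * \<bar>u\<bar> + 1 / \<theta>"
          using \<theta>(1) by (simp add: power2_eq_square field_simps)
        finally show ?thesis by (simp add: power2_eq_square algebra_simps)
      qed
      have "(\<Sum>jb\<in>?A. (\<bar>y jb\<bar> + 1)\<^sup>2) \<le> (\<Sum>jb\<in>?A. (1 + \<theta>) * (y jb)\<^sup>2 + (1 + 1 / \<theta>))" by (intro sum_mono sq)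
      also have "\<dots> = (1 + \<theta>) * (\<Sum>jb\<in>?A. (y jb)\<^sup>2) + real (card ?A) * (1 + 1 / \<theta>)"
        by (simp only: sum.distrib sum_distrib_left sum_constant distrib_left)
      also have "\<dots> \<le> (1 + \<theta>) * (real n * L'\<^sup>2 + 2 * (real k * L'\<^sup>2)) + real (card ?A) * (1 + 1 / \<theta>)"
        using sum_y \<theta>(1) by (intro add_right_mono mult_left_mono) auto
      finally have S0: "(\<Sum>jb\<in>?A. (\<bar>y jb\<bar> + 1)\<^sup>2) \<le> (1 + \<theta>) * (real n * L'\<^sup>2 + 2 * (real k * L'\<^sup>2)) + real (card ?A) * (1 + 1 / \<theta>)" .
      have S: "(\<Sum>jb\<in>?A. (\<bar>y jb\<bar> + 1)\<^sup>2) / 2 \<le> real n * a2 + ((1 + \<theta>) * (real k * L'\<^sup>2) + real (card ?A) * (1 + 1 / \<theta>) / 2)"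
      proof -
        have key: "((1 + \<theta>) * (real n * (2 * a1) + 2 * (real k * (2 * a1))) + q) / 2
            = real n * ((1 + \<theta>) * a1) + ((1 + \<theta>) * (real k * (2 * a1)) + q / 2)" for q
          by (simp add: algebra_simps add_divide_distrib)
        show ?thesis
          unfolding a2_def L'(2) key[symmetric] using S0[unfolded L'(2)] by (intro divide_right_mono) auto
      qed
      have "c * exp (- real n * a2) = (2 / sqrt (2 * pi)) ^ card ?A *
          exp (- (real n * a2 + ((1 + \<theta>) * (real k * L'\<^sup>2) + real (card ?A) * (1 + 1 / \<theta>) / 2)))"
        unfolding c_def by (simp only: mult.assoc mult_exp_exp) (simp add: algebra_simps)
      also have "\<dots> \<le> (2 / sqrt (2 * pi)) ^ card ?A * exp (- ((\<Sum>jb\<in>?A. (\<bar>y jb\<bar> + 1)\<^sup>2) / 2))"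
        by (intro mult_left_mono iffD2[OF exp_le_cancel_iff] le_imp_neg_le S) simp
      also have "exp (- ((\<Sum>jb\<in>?A. (\<bar>y jb\<bar> + 1)\<^sup>2) / 2)) = (\<Prod>jb\<in>?A. exp (- (\<bar>y jb\<bar> + 1)\<^sup>2 / 2))"
        by (simp only: exp_sum[OF finA, symmetric] sum_divide_distrib sum_negf[symmetric] minus_divide_left)
      also have "(2 / sqrt (2 * pi)) ^ card ?A * \<dots> = (\<Prod>jb\<in>?A. 2 / sqrt (2 * pi) * exp (- (\<bar>y jb\<bar> + 1)\<^sup>2 / 2))"
        by (simp only: prod.distrib prod_constant)
      finally show ?thesis .
    qed
    also have "\<dots> \<le> prob ?N"
      using block_coord_normal[OF k(1) kn(1)] by (intro std_normal_near_all[OF finA]) auto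
    finally show ?case using N_le elim(2) by linarith
  qed
qed

end

section \<open>The rate function and the assembly of the principle\<close>

context carnot_metric
begin

definition rate :: "'a \<Rightarrow> ennreal" where
  "rate x = (cc_distance G (V 1) ip \<one> x)\<^sup>2 / 2"

lemma ennreal_half_square: "0 \<le> l \<Longrightarrow> (ennreal l)\<^sup>2 / 2 = ennreal (l\<^sup>2 / 2)"
  by (simp add: ennreal_power divide_ennreal flip: ennreal_numeral)

lemma rate_le: "reach l x \<Longrightarrow> rate x \<le> ennreal (l\<^sup>2 / 2)"
proof -
  assume l: "reach l x"
  have "rate x \<le> (ennreal l)\<^sup>2 / 2"
    unfolding rate_def using cc_distance_le[OF l]
    by (intro divide_right_mono_ennreal power_mono) auto
  then show ?thesis using ennreal_half_square[OF reach_nonneg[OF l]] by simp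
qed

lemma reach_of_rate_less:
  assumes "rate x < ennreal a"
  shows "\<exists>L. reach L x \<and> L\<^sup>2 / 2 < a"
proof -
  have "cc_distance G (V 1) ip 0 x \<noteq> \<infinity>"
  proof
    assume "cc_distance G (V 1) ip 0 x = \<infinity>"
    then have "rate x = \<infinity>" by (simp add: rate_def ennreal_top_divide power2_eq_square)
    then show False using assms by simp
  qed
  then obtain l where l: "cc_distance G (V 1) ip 0 x = ennreal l" "l \<ge> 0"
    by (cases "cc_distance G (V 1) ip 0 x") auto
  then have "rate x = ennreal (l\<^sup>2 / 2)" using ennreal_half_square by (simp add: rate_def)
  then have la: "l\<^sup>2 / 2 < a" using assms by (simp add: ennreal_less_iff)
  \<comment> \<open>\<open>L\<^sup>2\<close> is the midpoint of \<open>l\<^sup>2\<close> and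
    \<open>2 * a\<close>. It has to exceed \<open>l\<^sup>2\<close> strictly, since
    \<open>reach_of_cc_distance\<close> asks for a strict inequality.\<close>
  define L where "L = sqrt (l\<^sup>2 / 2 + a)"
  have "a > 0" using la zero_le_power2[of l] by linarith
  then have L: "L\<^sup>2 = l\<^sup>2 / 2 + a" "L \<ge> 0" by (auto simp: L_def)
  have "l\<^sup>2 < L\<^sup>2" using L(1) la by linarith
  then have "l < L" using L(2) by (rule power2_less_imp_less)
  then have "reach L x" using l by (intro reach_of_cc_distance) (simp add: ennreal_less_iff)
  moreover have "L\<^sup>2 / 2 < a" using L(1) la by linarith
  ultimately show ?thesis by blast
qed

text \<open>Lower semicontinuity: a product ending at a nearby \<open>y\<close> is extended to
  \<open>x\<close> by a short correction, so a small rate at \<open>y\<close> would force too small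
  a rate at \<open>x\<close>.\<close>

lemma rate_function_rate: "rate_function rate"
  unfolding rate_function_def
proof (intro conjI allI impI)
  have "rate 0 \<le> ennreal (0\<^sup>2 / 2)" by (rule rate_le[OF reach_0]) simp
  then show "\<exists>x. rate x \<noteq> \<infinity>" by (intro exI[of _ 0]) auto
  fix x c assume "c < rate x"
  then obtain c2 where c2: "c < c2" "c2 < rate x" using dense by blast
  then obtain c1 where c1: "c < c1" "c1 < c2" using dense by blast
  obtain a2 where a2: "c2 = ennreal a2" "a2 \<ge> 0" using c2(2) by (cases c2) auto
  obtain a1 where a1: "c1 = ennreal a1" "a1 \<ge> 0" using c1(2) by (cases c1) auto
  have "a1 < a2" using c1(2) a1 a2 by (simp add: ennreal_less_iff)
  \<comment> \<open>Reaching \<open>y\<close> with length \<open>sqrt (2 * a1)\<close> and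
    correcting by \<open>\<epsilon>\<close> reaches \<open>x\<close> with length
    \<open>sqrt (2 * a2)\<close>.\<close>
  define \<epsilon> where "\<epsilon> = sqrt (2 * a2) - sqrt (2 * a1)"
  have "\<epsilon> > 0" using \<open>a1 < a2\<close> by (simp add: \<epsilon>_def)
  obtain \<eta> where \<eta>: "\<eta> > 0" "\<And>y z. norm y \<le> norm x + 1 \<Longrightarrow> norm z \<le> norm x + 1 \<Longrightarrow> norm (y - z) < \<eta> \<Longrightarrow> reach \<epsilon> (- y \<otimes> z)"
    using reach_close[OF \<open>\<epsilon> > 0\<close>, of "norm x + 1"] by blast
  have "c < rate y" if y: "dist y x < min \<eta> 1" for y
  proof (rule ccontr)
    assume "\<not> c < rate y"
    then have "rate y < ennreal a1" using c1(1) a1(1) by (simp add: not_less order.strict_trans1)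
    then obtain L where L: "reach L y" "L\<^sup>2 / 2 < a1" using reach_of_rate_less by blast
    have "norm (y - x) < \<eta>" "norm y \<le> norm x + 1"
      using y norm_triangle_sub[of y x] by (auto simp: dist_norm)
    then have "reach \<epsilon> (- y \<otimes> x)" by (intro \<eta>(2)) auto
    from reach_mult[OF L(1) this] have "reach (L + \<epsilon>) x" by simp
    then have "rate x \<le> ennreal ((L + \<epsilon>)\<^sup>2 / 2)" by (rule rate_le)
    also have "\<dots> \<le> ennreal a2"
    proof (rule ennreal_leI)
      have "L\<^sup>2 \<le> 2 * a1" using L(2) by simp
      then have "L \<le> sqrt (2 * a1)" by (rule real_le_rsqrt)
      then have "L + \<epsilon> \<le> sqrt (2 * a2)" by (simp add: \<epsilon>_def)
      then have "(L + \<epsilon>)\<^sup>2 \<le> (sqrt (2 * a2))\<^sup>2"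
        using reach_nonneg[OF L(1)] \<open>\<epsilon> > 0\<close> by (intro power_mono) auto
      then show "(L + \<epsilon>)\<^sup>2 / 2 \<le> a2" using a2(2) by simp
    qed
    finally show False using c2(2) a2(1) by simp
  qed
  then show "\<forall>\<^sub>F y in nhds x. c < rate y"
    unfolding eventually_nhds_metric using \<eta>(1) by (intro exI[of _ "min \<eta> 1"]) auto
qed

end

context carnot_walk
begin

lemma dil_partial_product:
  assumes "\<omega> \<in> space M"
  shows "group_dilation G V r (1 / real n) (partial_product G (\<lambda>i. lie_exp G (X i \<omega>)) n) = walk n \<omega>"
proof -
  have "map (dil (1 / real n)) (map (\<lambda>i. X i \<omega>) [1..<Suc n]) = map (\<lambda>i. (1 / real n) *\<^sub>R X i \<omega>) [1..<Suc n]"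
    using X_V1 assms by (auto simp: dil_V1 simp del: upt_Suc)
  then show ?thesis
    by (simp only: group_dilation_eq partial_product_eq_gprod lie_exp_eq id_apply dil_gprod walk_def)
qed

lemma liminf_walk:
  assumes "open U"
  shows "- enn2ereal (INF x\<in>U. rate x) \<le> liminf (\<lambda>n. ereal (1 / real n) * ext_ln (prob {\<omega> \<in> space M. walk n \<omega> \<in> U}))"
    (is "_ \<le> ?l")
proof (rule ccontr)
  assume "\<not> ?thesis"
  then have "?l < - enn2ereal (INF x\<in>U. rate x)" by simp
  then obtain z :: real where z: "?l < ereal z" "ereal z < - enn2ereal (INF x\<in>U. rate x)"
    using ereal_dense2 by blast
  have e: "enn2ereal (INF x\<in>U. rate x) < ereal (- z)"
    using z(2) ereal_minus_less_minus[of "- enn2ereal (INF x\<in>U. rate x)" "ereal z"] by simp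
  have "0 < ereal (- z)" by (rule order.strict_trans1[OF enn2ereal_nonneg e])
  then have "0 \<le> - z" by simp
  then have "(INF x\<in>U. rate x) < ennreal (- z)"
    using e by (simp add: less_ennreal.rep_eq enn2ereal_ennreal)
  then obtain x where x: "x \<in> U" "rate x < ennreal (- z)" by (auto simp: INF_less_iff)
  then obtain L where L: "reach L x" "L\<^sup>2 / 2 < - z" using reach_of_rate_less by blast
  from liminf_ext_ln_ge[OF lower_bound[OF assms x(1) L]] z(1) show False by simp
qed

lemma limsup_walk:
  assumes "closed F"
  shows "limsup (\<lambda>n. ereal (1 / real n) * ext_ln (prob {\<omega> \<in> space M. walk n \<omega> \<in> F})) \<le> - enn2ereal (INF x\<in>F. rate x)"
    (is "?l \<le> _")
proof (rule ccontr)
  assume "\<not> ?thesis"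
  then have "- enn2ereal (INF x\<in>F. rate x) < ?l" by simp
  then obtain z :: real where z: "- enn2ereal (INF x\<in>F. rate x) < ereal z" "ereal z < ?l"
    using ereal_dense2 by blast
  have "\<forall>\<^sub>F n in sequentially. prob {\<omega> \<in> space M. walk n \<omega> \<in> F} \<le> exp (- real n * (- z))"
  \<comment> \<open>For positive \<open>z\<close> the claimed bound is at least 1. Otherwise
    \<open>- z\<close> is a nonnegative exponent, as \<open>upper_bound\<close> requires.\<close>
  proof (cases "z > 0")
    case True
    then show ?thesis by (intro always_eventually allI order_trans[OF prob_le_1]) simp
  next
    case False
    have "ereal (- z) < enn2ereal (INF x\<in>F. rate x)"
      using z(1) ereal_minus_less_minus[of "ereal z" "- enn2ereal (INF x\<in>F. rate x)"] by simp
    then have "ennreal (- z) < (INF x\<in>F. rate x)" using False by (simp add: less_ennreal.rep_eq enn2ereal_ennreal)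
    then obtain c where c: "ennreal (- z) < c" "c < (INF x\<in>F. rate x)" using dense by blast
    obtain a where a: "c = ennreal a" "a \<ge> 0" using c(2) by (cases c) auto
    have za: "- z < a" using c(1) a False by (simp add: ennreal_less_iff)
    show ?thesis
    \<comment> \<open>The rate exceeds \<open>a\<close> throughout \<open>F\<close>, so every
      product that ends in \<open>F\<close> has length at least \<open>sqrt (2 * a)\<close>.\<close>
    proof (rule upper_bound[where L="sqrt (2 * a)"])
      show "F \<in> sets borel" using assms by simp
      fix x l assume x: "x \<in> F" "reach l x"
      have "ennreal a < rate x" using c(2) a(1) x(1) by (simp add: less_INF_D)
      also have "\<dots> \<le> ennreal (l\<^sup>2 / 2)" by (rule rate_le[OF x(2)])
      finally have "a < l\<^sup>2 / 2" using a(2) by (simp add: ennreal_less_iff)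
      then show "sqrt (2 * a) \<le> l" using reach_nonneg[OF x(2)] by (intro real_le_lsqrt) auto
    qed (use False za a(2) in auto)
  qed
  from limsup_ext_ln_le[OF this] z(2) show False by simp
qed

theorem large_deviation_principle_walk:
  "large_deviation_principle
     (\<lambda>n. distr M borel (\<lambda>\<omega>. group_dilation G V r (1 / real n) (partial_product G (\<lambda>i. lie_exp G (X i \<omega>)) n)))
     (\<lambda>x. (cc_distance G (V 1) ip \<one> x)\<^sup>2 / 2)"
proof -
  have distr: "distr M borel (\<lambda>\<omega>. group_dilation G V r (1 / real n) (partial_product G (\<lambda>i. lie_exp G (X i \<omega>)) n))
      = distr M borel (walk n)" for n
    by (intro distr_cong refl dil_partial_product)
  have meas: "measure (distr M borel (walk n)) A = prob {\<omega> \<in> space M. walk n \<omega> \<in> A}" if "A \<in> sets borel" for n A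
    using measure_distr[OF walk_measurable that] by (simp add: vimage_def Int_def conj_commute)
  show ?thesis
    unfolding distr large_deviation_principle_def rate_def[symmetric]
    using prob_space_distr[OF walk_measurable] rate_function_rate liminf_walk limsup_walk
    by (auto simp: meas)
qed

end

theorem corollary1p3:
  fixes G :: "(real ^ 'n::finite) monoid"
    and V :: "nat \<Rightarrow> (real ^ 'n) set"
    and r :: nat
    and ip :: "real ^ 'n \<Rightarrow> real ^ 'n \<Rightarrow> real"
    and M :: "'w measure"
    and X :: "nat \<Rightarrow> 'w \<Rightarrow> real ^ 'n"
  assumes "homogeneous_carnot_group G V r"
    and "inner_product_on (V 1) ip"
    and "prob_space M"
    and "prob_space.indep_vars M (\<lambda>_. borel) X {1..}"
    and "\<And>n. n \<ge> 1 \<Longrightarrow> standard_normal_on M (V 1) ip (X n)"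
  shows "large_deviation_principle
           (\<lambda>n. distr M borel (\<lambda>\<omega>. group_dilation G V r (1 / real n)
                                    (partial_product G (\<lambda>i. lie_exp G (X i \<omega>)) n)))
           (\<lambda>x. (cc_distance G (V 1) ip \<one>\<^bsub>G\<^esub> x)\<^sup>2 / 2)"
proof -
  interpret carnot_walk G V r ip M X
    using assms unfolding homogeneous_carnot_group_def
    by (intro carnot_walk.intro carnot_metric.intro carnot.intro exp_group.intro
        carnot_axioms.intro carnot_metric_axioms.intro carnot_walk_axioms.intro) auto
  show ?thesis by (rule large_deviation_principle_walk)
qed

end
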